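(* Let $\mathcal{U}\subset\mathbb{R}^5$ be open and let $A,B,C,E:\mathcal{U}\to\mathbb{R}$ be real analytic functions satisfying the ellipticity condition $AC-B^2+E>0$ on $\mathcal{U}$. Let $\gamma\subset\mathbb{R}^2$ be a real analytic, regular, strictly convex Jordan curve such that $\{(0,0,0)\}\times\gamma\subset\mathcal{U}$. Then there exists a solution $z$ to $$A z_{xx}+2B z_{xy}+C z_{yy}+z_{xx}z_{yy}-z_{xy}^2=E,$$ where $A,B,C,E$ are evaluated at $(x,y,z,z_x,z_y)$, that has an isolated singularity at the origin and whose limit gradient at the singularity is $\gamma$.
   Context: A solution $z$ is defined on a punctured neighborhood of the origin in $\mathbb{R}^2$, with $(x,y,z,z_x,z_y)\in\mathcal{U}$ there. It has an isolated singularity at the origin if it extends continuously to the origin with $z(0,0)=0$ (the singularity is placed at $(0,0,0)$) but the extension is not of class $C^2$ there. Its limit gradient at the origin is the set of points $\xi\in\mathbb{R}^2$ for which there is a sequence $q_n\to(0,0)$ in the punctured neighborhood with $(z_x,z_y)(q_n)\to\xi$. A regular Jordan curve is strictly convex if its curvature is nowhere zero. *)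

theory Defs
  imports "HOL-Analysis.Analysis"
begin

(* Local expansion in an absolutely convergent multivariate power series. Multi-indices are the
   functions Basis -> nat, extended by undefined so that each one is counted only once. *)
definition real_analytic_on ::
    "('a::euclidean_space \<Rightarrow> 'b::real_normed_vector) \<Rightarrow> 'a set \<Rightarrow> bool"
    (infix "real'_analytic'_on" 50) where
  "f real_analytic_on S \<longleftrightarrow>
     (\<forall>p\<in>S. \<exists>a :: ('a \<Rightarrow> nat) \<Rightarrow> 'b. \<exists>r>0. \<forall>h. norm h < r \<longrightarrow>
        ((\<lambda>k. (\<Prod>b\<in>Basis. (h \<bullet> b) ^ k b) *\<^sub>R a k) has_sum f (p + h)) (Basis \<rightarrow>\<^sub>E UNIV))"

definition partial_x :: "(real \<times> real \<Rightarrow> real) \<Rightarrow> real \<times> real \<Rightarrow> real" where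
  "partial_x f q = deriv (\<lambda>t. f (t, snd q)) (fst q)"

definition partial_y :: "(real \<times> real \<Rightarrow> real) \<Rightarrow> real \<times> real \<Rightarrow> real" where
  "partial_y f q = deriv (\<lambda>t. f (fst q, t)) (snd q)"

(* The next two predicates are meant for open sets: derivatives are taken in the whole plane. *)
definition C1_on :: "(real \<times> real \<Rightarrow> real) \<Rightarrow> (real \<times> real) set \<Rightarrow> bool" where
  "C1_on f V \<longleftrightarrow>
     (\<forall>(x, y)\<in>V. (\<lambda>t. f (t, y)) differentiable (at x) \<and> (\<lambda>t. f (x, t)) differentiable (at y)) \<and>
     continuous_on V (partial_x f) \<and> continuous_on V (partial_y f)"

definition C2_on :: "(real \<times> real \<Rightarrow> real) \<Rightarrow> (real \<times> real) set \<Rightarrow> bool" where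
  "C2_on f V \<longleftrightarrow> C1_on f V \<and> C1_on (partial_x f) V \<and> C1_on (partial_y f) V"

definition jet1 :: "(real \<times> real \<Rightarrow> real) \<Rightarrow> real \<times> real \<Rightarrow> real \<times> real \<times> real \<times> real \<times> real" where
  "jet1 z q = (fst q, snd q, z q, partial_x z q, partial_y z q)"

definition monge_ampere_solution_on ::
    "(real \<times> real \<times> real \<times> real \<times> real) set \<Rightarrow>
     (real \<times> real \<times> real \<times> real \<times> real \<Rightarrow> real) \<Rightarrow> (real \<times> real \<times> real \<times> real \<times> real \<Rightarrow> real) \<Rightarrow>
     (real \<times> real \<times> real \<times> real \<times> real \<Rightarrow> real) \<Rightarrow> (real \<times> real \<times> real \<times> real \<times> real \<Rightarrow> real) \<Rightarrow>
     (real \<times> real \<Rightarrow> real) \<Rightarrow> (real \<times> real) set \<Rightarrow> bool" where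
  "monge_ampere_solution_on U A B C E z V \<longleftrightarrow>
     C2_on z V \<and>
     (\<forall>q\<in>V. jet1 z q \<in> U \<and>
        A (jet1 z q) * partial_x (partial_x z) q
          + 2 * B (jet1 z q) * partial_y (partial_x z) q
          + C (jet1 z q) * partial_y (partial_y z) q
          + partial_x (partial_x z) q * partial_y (partial_y z) q
          - (partial_y (partial_x z) q)\<^sup>2
        = E (jet1 z q))"

(* For z given on a punctured neighbourhood of the origin; the value of z at the origin itself
   is irrelevant. *)
definition isolated_singularity_at_origin :: "(real \<times> real \<Rightarrow> real) \<Rightarrow> bool" where
  "isolated_singularity_at_origin z \<longleftrightarrow>
     (z \<longlongrightarrow> 0) (at (0, 0)) \<and>
     \<not> (\<exists>N. open N \<and> (0, 0) \<in> N \<and> C2_on (z((0, 0) := 0)) N)"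

definition limit_gradient ::
    "(real \<times> real \<Rightarrow> real) \<Rightarrow> (real \<times> real) set \<Rightarrow> (real \<times> real) set" where
  "limit_gradient z V =
     {\<xi>. \<exists>q :: nat \<Rightarrow> real \<times> real. (\<forall>n. q n \<in> V) \<and> q \<longlonglongrightarrow> (0, 0) \<and>
        (\<lambda>n. (partial_x z (q n), partial_y z (q n))) \<longlonglongrightarrow> \<xi>}"

definition velocity :: "(real \<Rightarrow> real \<times> real) \<Rightarrow> real \<Rightarrow> real \<times> real" where
  "velocity c t = vector_derivative c (at t)"

definition plane_curvature :: "(real \<Rightarrow> real \<times> real) \<Rightarrow> real \<Rightarrow> real" where
  "plane_curvature c t =
     (fst (velocity c t) * snd (velocity (velocity c) t)
       - snd (velocity c t) * fst (velocity (velocity c) t)) / norm (velocity c t) ^ 3"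

(* Periodicity makes the curve analytic and regular also at its base point c 0 = c 1. *)
definition analytic_regular_jordan_param :: "(real \<Rightarrow> real \<times> real) \<Rightarrow> bool" where
  "analytic_regular_jordan_param c \<longleftrightarrow>
     c real_analytic_on UNIV \<and> (\<forall>t. c (t + 1) = c t) \<and> simple_path c \<and> (\<forall>t. velocity c t \<noteq> 0)"

definition analytic_regular_strictly_convex_jordan_curve :: "(real \<times> real) set \<Rightarrow> bool" where
  "analytic_regular_strictly_convex_jordan_curve \<Gamma> \<longleftrightarrow>
     (\<exists>c. analytic_regular_jordan_param c \<and> path_image c = \<Gamma> \<and> (\<forall>t. plane_curvature c t \<noteq> 0))"

end

theory Submission
  imports Defs
begin

text \<open>Near the singularity the graph is parametrized by (s, v), with the circle v = 0 collapsed to the origin.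
  Let c parametrize \<gamma> and put D = A C - B^2 + E, a = p_s + C x_s - B y_s, b = q_s - B x_s + A y_s. The unknown
  u = (x, y, z, p, q) solves the first-order system
  x_v = - b, y_v = a, z_v = q a - p b, p_v = C b + B a - D y_s, q_v = D x_s - B b - A a
  with x = y = z = 0 and (p, q) = c(s) at v = 0. Its analytic solution is the fixed point of a contraction in a
  weighted algebra of double power series; solutions with different centres agree by comparing Taylor coefficients
  in v, so they fit together to a solution that is periodic in s. The system forces dz = p dx + q dy, and where
  (x, y) is a local diffeomorphism it turns z into a solution of the Monge-Ampere equation.

  Moreover (x, y) = v \<psi>(s, v), where \<psi>(s, 0) is the tangent c'(s) turned by a right angle. The tangent of a simple
  closed curve makes one turn (Hopf), and it does so monotonically because the curvature does not vanish. Hence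
  (s, v) behave like polar coordinates: (x, y) maps a thin strip v > 0, modulo the period of s, bijectively onto a
  region that fills a punctured neighbourhood of the origin, and there the gradient (p, q) is c(s) + O(v).\<close>

text \<open>Let H be the symmetric matrix with entries z_xx + C, z_xy - B, z_yy + A, so that the
  equation says det H = D. Along a solution (a, b) = H (x_s, y_s), and with T the rotation by a
  right angle the first two equations read (x_v, y_v) = T H (x_s, y_s): the s- and v-directions are
  orthogonal for H. Since H T H = (det H) T, applying H again gives the equations for p_v and q_v,
  with D written for det H. Conformal parameters for H would differ by a factor sqrt D in v; this
  normalization keeps the right-hand side polynomial in A, B, C, E, p, q and the s-derivatives. The
  obstacle is the line v = 0, where x_s = y_s = 0 and (x, y) is not an immersion. The geometric
  estimates are therefore made for the quotient \<psi> = (x, y) / v, which is analytic across v = 0.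
  The Jacobian of (x, y) is v times a function that equals, at v = 0, minus the numerator of the
  curvature. Nonzero curvature thus enters twice: it makes the angle of \<psi> strictly monotone in
  s, and it makes (x, y) a local diffeomorphism for small v > 0.\<close>

unbundle no vec_syntax
unbundle fps_syntax

section \<open>Weighted double power series\<close>

text \<open>In a double series i counts powers of v and j powers of s. With the weights 1 / binom(i + j, i) the l1 norm is
  submultiplicative, and both the integral over v and the integral over v of the s-derivative (\<open>ms_int\<close>, \<open>ms_dint\<close>
  below) have norm at most 1; this takes the place of the majorants in the Cauchy-Kovalevskaya theorem.\<close>

definition wt :: "nat \<Rightarrow> nat \<Rightarrow> real" where
  "wt i j = 1 / real ((i + j) choose i)"

lemma wt_pos: "wt i j > 0"
  by (simp add: wt_def)

lemma wt_nonneg: "wt i j \<ge> 0"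
  by (simp add: wt_def)

lemma wt_0 [simp]: "wt 0 j = 1"
  by (simp add: wt_def)

lemma wt_ge: "1 \<le> wt i j * 2 ^ (i + j)"
proof -
  have "real ((i + j) choose i) \<le> 2 ^ (i + j)"
    using binomial_le_pow2[of "i + j" i] by (metis of_nat_le_iff of_nat_numeral of_nat_power)
  then show ?thesis by (simp add: wt_def field_simps)
qed

text \<open>A single term of Vandermonde's convolution is at most the whole sum. This is what makes
  the weighted norm submultiplicative.\<close>

lemma wt_add_le: "wt (i + i') (j + j') \<le> wt i j * wt i' j'"
proof -
  have "((i + j) choose i) * ((i' + j') choose i')
      = ((i + j) choose i) * ((i' + j') choose (i + i' - i))" by simp
  also have "\<dots> \<le> (\<Sum>k\<le>i + i'. ((i + j) choose k) * ((i' + j') choose (i + i' - k)))"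
    by (rule member_le_sum) auto
  also have "\<dots> = ((i + j) + (i' + j')) choose (i + i')"
    by (rule vandermonde)
  finally have "real (((i + j) choose i) * ((i' + j') choose i'))
      \<le> real (((i + i') + (j + j')) choose (i + i'))"
    by (simp only: of_nat_le_iff add_ac)
  then show ?thesis
    unfolding wt_def by (simp add: field_simps)
qed

text \<open>The factor is what a coefficient picks up when the series is differentiated in s and
  then integrated in v. That the weights absorb it exactly is the reason for choosing inverse
  binomial coefficients.\<close>

lemma wt_Suc_left: "wt (Suc i) j * (real (Suc j) / real (Suc i)) = wt i (Suc j)"
proof -
  have "Suc i * (Suc (i + j) choose Suc i) = Suc (i + j) * ((i + j) choose i)"
    by (rule Suc_times_binomial)
  moreover have "Suc j * (Suc (i + j) choose i) = Suc (i + j) * ((i + j) choose i)"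
  proof -
    have "Suc j * (Suc (i + j) choose Suc j) = Suc (i + j) * ((i + j) choose j)"
      by (rule Suc_times_binomial)
    moreover have "(Suc (i + j) choose Suc j) = (Suc (i + j) choose i)"
      using binomial_symmetric[of "Suc j" "Suc (i+j)"] by simp
    moreover have "((i + j) choose j) = ((i + j) choose i)"
      using binomial_symmetric[of j "i+j"] by simp
    ultimately show ?thesis by simp
  qed
  ultimately have "real (Suc i * (Suc (i + j) choose Suc i)) = real (Suc j * (Suc (i + j) choose i))"
    by metis
  then have *: "real (Suc i) * real (Suc (i + j) choose Suc i) = real (Suc j) * real (Suc (i + j) choose i)"
    by (metis of_nat_mult)
  have pos: "real (Suc (i + j) choose Suc i) > 0" "real (Suc (i + j) choose i) > 0"
    by (simp_all del: binomial_Suc_Suc)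
  show ?thesis
    unfolding wt_def using * pos
    by (simp add: field_simps del: of_nat_Suc binomial_Suc_Suc)
qed

lemma wt_Suc_le: "wt (Suc i) j / real (Suc i) \<le> wt i j"
proof -
  have "wt (Suc i) j \<le> wt 1 0 * wt i j"
    using wt_add_le[of 1 i 0 j] by simp
  then have "wt (Suc i) j \<le> wt i j" by (simp add: wt_def)
  moreover have "wt (Suc i) j / real (Suc i) \<le> wt (Suc i) j"
    using wt_nonneg[of "Suc i" j] by (simp add: field_simps)
  ultimately show ?thesis by linarith
qed

text \<open>Square partial sums are used so that the norm becomes a supremum of finite sums, and
  every norm estimate below is one about finite sums.\<close>

definition trunc :: "real fps fps \<Rightarrow> nat \<Rightarrow> real" where
  "trunc f N = (\<Sum>i\<le>N. \<Sum>j\<le>N. \<bar>f $ i $ j\<bar> * wt i j)"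

lemma trunc_nonneg: "trunc f N \<ge> 0"
  unfolding trunc_def by (intro sum_nonneg mult_nonneg_nonneg wt_nonneg) auto

lemma trunc_add: "trunc (f + g) N \<le> trunc f N + trunc g N"
  unfolding trunc_def sum.distrib[symmetric]
  by (intro sum_mono) (auto simp: distrib_right[symmetric] intro!: mult_right_mono wt_nonneg)

lemma trunc_uminus: "trunc (- f) N = trunc f N"
  unfolding trunc_def by simp

lemma trunc_scale: "trunc (fps_const (fps_const r) * f) N = \<bar>r\<bar> * trunc f N"
  unfolding trunc_def by (simp add: sum_distrib_left abs_mult mult.assoc)

lemma trunc_mult: "trunc (f * g) N \<le> trunc f N * trunc g N"
proof -
  define F where "F i j = \<bar>f $ i $ j\<bar> * wt i j" for i j
  define G where "G i j = \<bar>g $ i $ j\<bar> * wt i j" for i j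
  have F0: "F i j \<ge> 0" and G0: "G i j \<ge> 0" for i j
    by (auto simp: F_def G_def wt_nonneg)
  \<comment> \<open>A sum of nonnegative terms over the triangle i + k <= N is at most the sum over
    the square. This is applied once for each of the two variables.\<close>
  have conv: "(\<Sum>n\<le>N. \<Sum>i\<le>n. h i (n - i)) \<le> (\<Sum>i\<le>N. \<Sum>k\<le>N. h i k)"
    if "\<And>i k. h i k \<ge> (0::real)" for h :: "nat \<Rightarrow> nat \<Rightarrow> real"
  proof -
    have "(\<Sum>n\<le>N. \<Sum>i\<le>n. h i (n - i)) = (\<Sum>(n,i)\<in>Sigma {..N} (\<lambda>n. {..n}). h i (n - i))"
      by (subst sum.Sigma) auto
    also have "\<dots> = (\<Sum>(i,k)\<in>{(i,k). i + k \<le> N}. h i k)"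
      by (rule sum.reindex_bij_witness[where i = "\<lambda>(i,k). (i + k, i)" and j = "\<lambda>(n,i). (i, n - i)"]) auto
    also have "\<dots> \<le> (\<Sum>(i,k)\<in>{..N} \<times> {..N}. h i k)"
      by (rule sum_mono2) (auto intro: that)
    also have "\<dots> = (\<Sum>i\<le>N. \<Sum>k\<le>N. h i k)"
      by (subst sum.cartesian_product) auto
    finally show ?thesis .
  qed
  have "trunc (f * g) N \<le> (\<Sum>n\<le>N. \<Sum>m\<le>N. \<Sum>i\<le>n. \<Sum>j\<le>m. F i j * G (n - i) (m - j))"
    unfolding trunc_def
  proof (intro sum_mono)
    fix n m
    have "(f * g) $ n $ m = (\<Sum>i\<le>n. \<Sum>j\<le>m. f $ i $ j * g $ (n - i) $ (m - j))"
      by (simp add: fps_mult_nth fps_sum_nth atLeast0AtMost)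
    then have "\<bar>(f * g) $ n $ m\<bar> \<le> (\<Sum>i\<le>n. \<Sum>j\<le>m. \<bar>f $ i $ j\<bar> * \<bar>g $ (n - i) $ (m - j)\<bar>)"
      by (auto simp: abs_mult[symmetric] intro!: order_trans[OF sum_abs] sum_mono)
    then have "\<bar>(f * g) $ n $ m\<bar> * wt n m
        \<le> (\<Sum>i\<le>n. \<Sum>j\<le>m. \<bar>f $ i $ j\<bar> * \<bar>g $ (n - i) $ (m - j)\<bar> * wt n m)"
      using mult_right_mono[OF _ wt_nonneg[of n m]] by (simp add: sum_distrib_right[symmetric])
    also have "\<dots> \<le> (\<Sum>i\<le>n. \<Sum>j\<le>m. F i j * G (n - i) (m - j))"
    proof (intro sum_mono)
      fix i j assume "i \<in> {..n}" "j \<in> {..m}"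
      then have "wt n m \<le> wt i j * wt (n - i) (m - j)"
        using wt_add_le[of i "n - i" j "m - j"] by simp
      then have "\<bar>f $ i $ j\<bar> * \<bar>g $ (n - i) $ (m - j)\<bar> * wt n m
          \<le> \<bar>f $ i $ j\<bar> * \<bar>g $ (n - i) $ (m - j)\<bar> * (wt i j * wt (n - i) (m - j))"
        by (intro mult_left_mono) auto
      then show "\<bar>f $ i $ j\<bar> * \<bar>g $ (n - i) $ (m - j)\<bar> * wt n m \<le> F i j * G (n - i) (m - j)"
        by (simp add: F_def G_def mult_ac)
    qed
    finally show "\<bar>(f * g) $ n $ m\<bar> * wt n m \<le> (\<Sum>i\<le>n. \<Sum>j\<le>m. F i j * G (n - i) (m - j))" .
  qed
  also have "\<dots> = (\<Sum>n\<le>N. \<Sum>i\<le>n. (\<Sum>m\<le>N. \<Sum>j\<le>m. F i j * G (n - i) (m - j)))"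
    by (rule sum.cong[OF refl], rule sum.swap)
  also have "\<dots> \<le> (\<Sum>n\<le>N. \<Sum>i\<le>n. (\<Sum>j\<le>N. \<Sum>l\<le>N. F i j * G (n - i) l))"
    by (intro sum_mono conv) (simp add: F0 G0)
  also have "\<dots> \<le> (\<Sum>i\<le>N. \<Sum>k\<le>N. (\<Sum>j\<le>N. \<Sum>l\<le>N. F i j * G k l))"
    by (rule conv[of "\<lambda>i k. \<Sum>j\<le>N. \<Sum>l\<le>N. F i j * G k l"]) (intro sum_nonneg mult_nonneg_nonneg F0 G0)
  also have "\<dots> = trunc f N * trunc g N"
  proof -
    have "(\<Sum>j\<le>N. \<Sum>l\<le>N. F i j * G k l) = (\<Sum>j\<le>N. F i j) * (\<Sum>l\<le>N. G k l)" for i k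
      by (rule sum_product[symmetric])
    then show ?thesis
      unfolding trunc_def F_def[symmetric] G_def[symmetric] by (simp only: sum_product)
  qed
  finally show ?thesis .
qed

lemma trunc_0 [simp]: "trunc 0 N = 0"
  by (simp add: trunc_def)

lemma trunc_1: "trunc 1 N = 1"
proof -
  have "trunc 1 N = (\<Sum>i\<le>N. \<Sum>j\<le>N. if i = 0 \<and> j = 0 then 1 else 0)"
    unfolding trunc_def by (intro sum.cong refl) (auto simp: wt_def)
  also have "\<dots> = (\<Sum>i\<le>N. if i = 0 then 1 else 0)"
    by (intro sum.cong refl) auto
  finally show ?thesis by simp
qed

section \<open>The Banach algebra of series with finite weighted norm\<close>

typedef mseries = "{f :: real fps fps. bdd_above (range (trunc f))}"
  morphisms cfs Abs_mseries
  by (rule exI[of _ 0]) simp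

setup_lifting type_definition_mseries

lemma bdd_trunc: "bdd_above (range (trunc (cfs f)))"
  using cfs by simp

instantiation mseries :: comm_ring_1
begin
lift_definition zero_mseries :: mseries is 0 by simp
lift_definition one_mseries :: mseries is 1 by (simp add: trunc_1)
lift_definition plus_mseries :: "mseries \<Rightarrow> mseries \<Rightarrow> mseries" is "(+)"
proof -
  fix f g :: "real fps fps"
  assume "bdd_above (range (trunc f))" "bdd_above (range (trunc g))"
  then obtain K L where "\<And>N. trunc f N \<le> K" "\<And>N. trunc g N \<le> L"
    by (auto simp: bdd_above_def)
  then have "trunc (f + g) N \<le> K + L" for N
    using trunc_add[of f g N] by (meson add_mono order_trans)
  then show "bdd_above (range (trunc (f + g)))" by (auto simp: bdd_above_def)
qed
lift_definition uminus_mseries :: "mseries \<Rightarrow> mseries" is "uminus"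
  by (simp add: trunc_uminus)
lift_definition minus_mseries :: "mseries \<Rightarrow> mseries \<Rightarrow> mseries" is "(-)"
proof -
  fix f g :: "real fps fps"
  assume "bdd_above (range (trunc f))" "bdd_above (range (trunc g))"
  then obtain K L where "\<And>N. trunc f N \<le> K" "\<And>N. trunc g N \<le> L"
    by (auto simp: bdd_above_def)
  then have "trunc (f - g) N \<le> K + L" for N
    using trunc_add[of f "- g" N] trunc_uminus[of g N]
    by (metis add_mono order_trans diff_conv_add_uminus)
  then show "bdd_above (range (trunc (f - g)))" by (auto simp: bdd_above_def)
qed
lift_definition times_mseries :: "mseries \<Rightarrow> mseries \<Rightarrow> mseries" is "(*)"
proof -
  fix f g :: "real fps fps"
  assume "bdd_above (range (trunc f))" "bdd_above (range (trunc g))"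
  then obtain K L where KL: "\<And>N. trunc f N \<le> K" "\<And>N. trunc g N \<le> L"
    by (auto simp: bdd_above_def)
  have "trunc (f * g) N \<le> K * L" for N
    using trunc_mult[of f g N] mult_mono[OF KL[of N] order_trans[OF trunc_nonneg KL(1)] trunc_nonneg]
    by linarith
  then show "bdd_above (range (trunc (f * g)))" by (auto simp: bdd_above_def)
qed
instance
proof
  fix a b c :: mseries
  show "a * b * c = a * (b * c)" by transfer (rule mult.assoc)
  show "a * b = b * a" by transfer (rule mult.commute)
  show "1 * a = a" by transfer (rule mult_1_left)
  show "a + b + c = a + (b + c)" by transfer (rule add.assoc)
  show "a + b = b + a" by transfer (rule add.commute)
  show "0 + a = a" by transfer (rule add_0_left)
  show "- a + a = 0" by transfer (rule left_minus)
  show "a - b = a + - b" by transfer (rule diff_conv_add_uminus)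
  show "(a + b) * c = a * c + b * c" by transfer (rule distrib_right)
  show "(0::mseries) \<noteq> 1" by transfer simp
qed
end

instantiation mseries :: real_vector
begin
lift_definition scaleR_mseries :: "real \<Rightarrow> mseries \<Rightarrow> mseries" is
  "\<lambda>r f. fps_const (fps_const r) * f"
proof -
  fix r and f :: "real fps fps"
  assume "bdd_above (range (trunc f))"
  then obtain K where "\<And>N. trunc f N \<le> K" by (auto simp: bdd_above_def)
  then have "trunc (fps_const (fps_const r) * f) N \<le> \<bar>r\<bar> * K" for N
    by (simp add: trunc_scale mult_left_mono)
  then show "bdd_above (range (trunc (fps_const (fps_const r) * f)))" by (auto simp: bdd_above_def)
qed
instance
proof
  fix f g :: mseries and r s :: real
  show "r *\<^sub>R (f + g) = r *\<^sub>R f + r *\<^sub>R g" by transfer (simp add: algebra_simps)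
  show "(r + s) *\<^sub>R f = r *\<^sub>R f + s *\<^sub>R f"
    by transfer (simp add: algebra_simps flip: fps_const_add)
  show "r *\<^sub>R s *\<^sub>R f = (r * s) *\<^sub>R f"
    by transfer (simp add: mult.assoc flip: fps_const_mult)
  show "1 *\<^sub>R f = f" by transfer simp
qed
end

instantiation mseries :: real_normed_algebra_1
begin
definition norm_mseries :: "mseries \<Rightarrow> real" where
  "norm_mseries f = (SUP N. trunc (cfs f) N)"
definition dist_mseries :: "mseries \<Rightarrow> mseries \<Rightarrow> real" where
  "dist_mseries f g = norm (f - g)"
definition sgn_mseries :: "mseries \<Rightarrow> mseries" where
  "sgn_mseries f = f /\<^sub>R norm f"
definition uniformity_mseries :: "(mseries \<times> mseries) filter" where
  "uniformity_mseries = (INF e\<in>{0 <..}. principal {(x, y). dist x y < e})"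
definition open_mseries :: "mseries set \<Rightarrow> bool" where
  "open_mseries S \<longleftrightarrow> (\<forall>x\<in>S. \<forall>\<^sub>F (x', y) in uniformity. x' = x \<longrightarrow> y \<in> S)"

lemma trunc_le_norm: "trunc (cfs f) N \<le> norm f"
  unfolding norm_mseries_def by (rule cSUP_upper[OF _ bdd_trunc]) simp

lemma norm_mseries_le: "(\<And>N. trunc (cfs f) N \<le> K) \<Longrightarrow> norm f \<le> K"
  unfolding norm_mseries_def by (rule cSUP_least) auto

lemma coeff_wt_le_norm: "\<bar>cfs f $ i $ j\<bar> * wt i j \<le> norm f"
proof -
  have "\<bar>cfs f $ i $ j\<bar> * wt i j \<le> (\<Sum>l\<le>max i j. \<bar>cfs f $ i $ l\<bar> * wt i l)"
    by (rule member_le_sum) (auto simp: wt_nonneg)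
  also have "\<dots> \<le> trunc (cfs f) (max i j)"
    unfolding trunc_def
    by (rule member_le_sum[where f = "\<lambda>i. \<Sum>l\<le>max _ j. \<bar>cfs f $ i $ l\<bar> * wt i l"])
       (auto intro!: sum_nonneg simp: wt_nonneg)
  finally show ?thesis using trunc_le_norm[of f "max i j"] by linarith
qed

instance
proof
  fix f g :: mseries and r s :: real
  show "r *\<^sub>R f * g = r *\<^sub>R (f * g)" by transfer (simp add: algebra_simps)
  show "f * r *\<^sub>R g = r *\<^sub>R (f * g)" by transfer (simp add: algebra_simps)
  show "dist f g = norm (f - g)" by (simp add: dist_mseries_def)
  show "sgn f = f /\<^sub>R norm f" by (simp add: sgn_mseries_def)
  show "(norm f = 0) = (f = 0)"
  proof
    assume "norm f = 0"
    then have "\<bar>cfs f $ i $ j\<bar> * wt i j \<le> 0" for i j using coeff_wt_le_norm[of f i j] by simp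
    then have "cfs f $ i $ j = 0" for i j
      using wt_pos[of i j] by (metis abs_le_zero_iff linorder_not_less mult_pos_pos zero_less_abs_iff)
    then show "f = 0" by transfer (auto intro!: fps_ext)
  next
    assume "f = 0" then show "norm f = 0"
      by (simp add: norm_mseries_def zero_mseries.rep_eq)
  qed
  show "norm (f + g) \<le> norm f + norm g"
  proof (rule norm_mseries_le)
    fix N
    show "trunc (cfs (f + g)) N \<le> norm f + norm g"
      using trunc_add[of "cfs f" "cfs g" N] trunc_le_norm[of f N] trunc_le_norm[of g N]
      by (simp add: plus_mseries.rep_eq)
  qed
  show "norm (r *\<^sub>R f) = \<bar>r\<bar> * norm f"
  proof (rule antisym)
    have *: "norm (r *\<^sub>R f) \<le> \<bar>r\<bar> * norm f" for r and f :: mseries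
      by (rule norm_mseries_le) (simp add: scaleR_mseries.rep_eq trunc_scale mult_left_mono trunc_le_norm)
    from * show "norm (r *\<^sub>R f) \<le> \<bar>r\<bar> * norm f" .
    show "\<bar>r\<bar> * norm f \<le> norm (r *\<^sub>R f)"
    proof (cases "r = 0")
      case False
      have "(1/r) *\<^sub>R (r *\<^sub>R f) = f" using False
        by transfer (simp add: mult.assoc[symmetric])
      then show ?thesis using *[of "1/r" "r *\<^sub>R f"] False by (simp add: field_simps)
    qed (use order_trans[OF trunc_nonneg trunc_le_norm[of "r *\<^sub>R f" 0]] in simp)
  qed
  show "norm (f * g) \<le> norm f * norm g"
  proof (rule norm_mseries_le)
    fix N
    have "trunc (cfs f) N * trunc (cfs g) N \<le> norm f * norm g"
      by (intro mult_mono trunc_le_norm trunc_nonneg order_trans[OF trunc_nonneg trunc_le_norm])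
    then show "trunc (cfs (f * g)) N \<le> norm f * norm g"
      using trunc_mult[of "cfs f" "cfs g" N] by (simp add: times_mseries.rep_eq)
  qed
  show "norm (1 :: mseries) = 1"
    by (simp add: norm_mseries_def one_mseries.rep_eq trunc_1)
qed (rule uniformity_mseries_def open_mseries_def)+
end

instance mseries :: banach
proof
  fix X :: "nat \<Rightarrow> mseries"
  assume "Cauchy X"
  have cX: "Cauchy (\<lambda>n. cfs (X n) $ i $ j)" for i j
  proof (rule metric_CauchyI)
    fix e :: real assume "e > 0"
    then obtain M where M: "\<And>m n. m \<ge> M \<Longrightarrow> n \<ge> M \<Longrightarrow> dist (X m) (X n) < e * wt i j"
      using \<open>Cauchy X\<close> wt_pos[of i j] unfolding Cauchy_def by (meson mult_pos_pos)
    have "dist (cfs (X m) $ i $ j) (cfs (X n) $ i $ j) < e" if "m \<ge> M" "n \<ge> M" for m n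
    proof -
      have "\<bar>cfs (X m - X n) $ i $ j\<bar> * wt i j < e * wt i j"
        using coeff_wt_le_norm[of "X m - X n" i j] M[OF that] by (simp add: dist_mseries_def)
      then show ?thesis
        using wt_pos[of i j] by (simp add: minus_mseries.rep_eq dist_real_def)
    qed
    then show "\<exists>M. \<forall>m\<ge>M. \<forall>n\<ge>M. dist (cfs (X m) $ i $ j) (cfs (X n) $ i $ j) < e" by blast
  qed
  define L where "L = Abs_fps (\<lambda>i. Abs_fps (\<lambda>j. lim (\<lambda>n. cfs (X n) $ i $ j)))"
  have L: "(\<lambda>n. cfs (X n) $ i $ j) \<longlonglongrightarrow> L $ i $ j" for i j
    using cX[of i j] by (simp add: L_def Cauchy_convergent_iff convergent_LIMSEQ_iff)
  \<comment> \<open>The limit \<open>L\<close> is formed coefficientwise. A truncation involves only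
    finitely many coefficients, so a Cauchy bound passes to the limit for each \<open>N\<close>, and
    the bound does not depend on \<open>N\<close>.\<close>
  have tL: "trunc (cfs (X m) - L) N \<le> e" if "\<And>n. n \<ge> M \<Longrightarrow> norm (X m - X n) \<le> e" for m N M e
  proof (rule tendsto_upperbound)
    show "(\<lambda>n. trunc (cfs (X m - X n)) N) \<longlonglongrightarrow> trunc (cfs (X m) - L) N"
      unfolding trunc_def by (simp add: minus_mseries.rep_eq) (intro tendsto_intros L)
    show "\<forall>\<^sub>F n in sequentially. trunc (cfs (X m - X n)) N \<le> e"
      using that trunc_le_norm order_trans by (intro eventually_sequentiallyI[of M]) blast
  qed simp
  obtain M where M: "\<And>m n. m \<ge> M \<Longrightarrow> n \<ge> M \<Longrightarrow> dist (X m) (X n) < 1"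
    using \<open>Cauchy X\<close> unfolding Cauchy_def by (meson zero_less_one)
  have "trunc L N \<le> norm (X M) + 1" for N
  proof -
    have "trunc L N \<le> trunc (cfs (X M)) N + trunc (- (cfs (X M) - L)) N"
      using trunc_add[of "cfs (X M)" "- (cfs (X M) - L)" N] by simp
    also have "\<dots> \<le> norm (X M) + 1"
      unfolding trunc_uminus
      by (intro add_mono trunc_le_norm tL[of M]) (use M[of M] in \<open>auto simp: dist_mseries_def intro: less_imp_le\<close>)
    finally show ?thesis .
  qed
  then have Labs: "cfs (Abs_mseries L) = L"
    by (intro Abs_mseries_inverse) (auto simp: bdd_above_def)
  have "X \<longlonglongrightarrow> Abs_mseries L"
  proof (rule metric_LIMSEQ_I)
    fix e :: real assume "e > 0"
    then obtain M where M: "\<And>m n. m \<ge> M \<Longrightarrow> n \<ge> M \<Longrightarrow> dist (X m) (X n) < e / 2"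
      using \<open>Cauchy X\<close> unfolding Cauchy_def by (meson half_gt_zero)
    have "norm (X m - Abs_mseries L) < e" if "m \<ge> M" for m
    proof -
      have "norm (X m - Abs_mseries L) \<le> e / 2"
        by (rule norm_mseries_le, subst minus_mseries.rep_eq, subst Labs, rule tL[of M])
           (use M[OF that] in \<open>auto simp: dist_mseries_def intro: less_imp_le\<close>)
      then show ?thesis using \<open>e > 0\<close> by simp
    qed
    then show "\<exists>M. \<forall>m\<ge>M. dist (X m) (Abs_mseries L) < e"
      by (auto simp: dist_mseries_def)
  qed
  then show "convergent X" by (auto simp: convergent_def)
qed

definition cf :: "mseries \<Rightarrow> nat \<Rightarrow> nat \<Rightarrow> real" where
  "cf f i j = cfs f $ i $ j"

lemma cf_0 [simp]: "cf 0 i j = 0"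
  and cf_1: "cf 1 i j = (if i = 0 \<and> j = 0 then 1 else 0)"
  and cf_add [simp]: "cf (f + g) i j = cf f i j + cf g i j"
  and cf_diff [simp]: "cf (f - g) i j = cf f i j - cf g i j"
  and cf_uminus [simp]: "cf (- f) i j = - cf f i j"
  and cf_scaleR [simp]: "cf (r *\<^sub>R f) i j = r * cf f i j"
  by (simp_all add: cf_def zero_mseries.rep_eq one_mseries.rep_eq plus_mseries.rep_eq
      minus_mseries.rep_eq uminus_mseries.rep_eq scaleR_mseries.rep_eq)

lemma cf_mult: "cf (f * g) n m = (\<Sum>i\<le>n. \<Sum>j\<le>m. cf f i j * cf g (n - i) (m - j))"
  by (simp add: cf_def times_mseries.rep_eq fps_mult_nth fps_sum_nth atLeast0AtMost)

lemma mseries_eqI: "(\<And>i j. cf f i j = cf g i j) \<Longrightarrow> f = g"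
  unfolding cf_def by (metis cfs_inject fps_ext)

text \<open>The coefficients may grow geometrically with ratio 2; hence the radius 1/2 on which
  elements of the algebra are evaluated later.\<close>

lemma abs_cf_le: "\<bar>cf f i j\<bar> \<le> norm f * 2 ^ (i + j)"
proof -
  have "\<bar>cf f i j\<bar> * 1 \<le> \<bar>cf f i j\<bar> * (wt i j * 2 ^ (i + j))"
    by (intro mult_left_mono wt_ge) simp
  also have "\<dots> \<le> norm f * 2 ^ (i + j)"
    using coeff_wt_le_norm[of f i j] by (simp add: cf_def mult.assoc[symmetric])
  finally show ?thesis by simp
qed

lemma norm_mseries_le_cf:
  assumes "\<And>N. (\<Sum>i\<le>N. \<Sum>j\<le>N. \<bar>cf f i j\<bar> * wt i j) \<le> K"
  shows "norm f \<le> K"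
  by (rule norm_mseries_le) (use assms in \<open>simp add: trunc_def cf_def\<close>)

lemma ex_mseries:
  assumes "\<And>N. (\<Sum>i\<le>N. \<Sum>j\<le>N. \<bar>a i j\<bar> * wt i j) \<le> K"
  shows "\<exists>f. cf f = a \<and> norm f \<le> K"
proof -
  define F where "F = Abs_fps (\<lambda>i. Abs_fps (a i))"
  have "trunc F N \<le> K" for N
    using assms[of N] by (simp add: trunc_def F_def)
  then have "cfs (Abs_mseries F) = F"
    by (intro Abs_mseries_inverse) (auto simp: bdd_above_def)
  then have "cf (Abs_mseries F) = a"
    by (auto simp: cf_def F_def fun_eq_iff)
  with norm_mseries_le_cf[of "Abs_mseries F"] assms show ?thesis by auto
qed

lemma ex_mseries_row:
  assumes "\<And>N. (\<Sum>j\<le>N. \<bar>c j\<bar>) \<le> K"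
  shows "\<exists>f. cf f = (\<lambda>i j. if i = 0 then c j else 0) \<and> norm f \<le> K"
proof (rule ex_mseries)
  fix N
  have "(\<Sum>i\<le>N. \<Sum>j\<le>N. \<bar>if i = 0 then c j else 0\<bar> * wt i j) = (\<Sum>i\<le>N. if i = 0 then (\<Sum>j\<le>N. \<bar>c j\<bar>) else 0)"
    by (intro sum.cong) auto
  then show "(\<Sum>i\<le>N. \<Sum>j\<le>N. \<bar>if i = 0 then c j else 0\<bar> * wt i j) \<le> K"
    using assms[of N] by simp
qed

section \<open>Integration in v, alone and after differentiation in s\<close>

lemma sum_atMost_shift_le:
  fixes h H :: "nat \<Rightarrow> real"
  assumes "h 0 = 0" "\<And>i. h (Suc i) \<le> H i" "\<And>i. H i \<ge> 0"
  shows "(\<Sum>i\<le>N. h i) \<le> (\<Sum>i\<le>N. H i)"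
proof (cases N)
  case (Suc M)
  have "(\<Sum>i\<le>Suc M. h i) \<le> (\<Sum>i\<le>M. H i)"
    using assms by (subst sum.atMost_Suc_shift) (auto intro: sum_mono)
  then show ?thesis using assms(3)[of N] by (simp add: Suc)
qed (use assms in simp)

lemma ms_int_ex:
  "\<exists>g. cf g = (\<lambda>i j. if i = 0 then 0 else cf f (i - 1) j / real i) \<and> norm g \<le> norm f"
proof (rule ex_mseries)
  fix N
  have "(\<Sum>i\<le>N. \<Sum>j\<le>N. \<bar>if i = 0 then 0 else cf f (i - 1) j / real i\<bar> * wt i j)
      \<le> (\<Sum>i\<le>N. \<Sum>j\<le>N. \<bar>cf f i j\<bar> * wt i j)"
  proof (rule sum_atMost_shift_le)
    fix i
    show "(\<Sum>j\<le>N. \<bar>if Suc i = 0 then 0 else cf f (Suc i - 1) j / real (Suc i)\<bar> * wt (Suc i) j)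
        \<le> (\<Sum>j\<le>N. \<bar>cf f i j\<bar> * wt i j)"
    proof (rule sum_mono)
      fix j
      show "\<bar>if Suc i = 0 then 0 else cf f (Suc i - 1) j / real (Suc i)\<bar> * wt (Suc i) j
          \<le> \<bar>cf f i j\<bar> * wt i j"
        using mult_left_mono[OF wt_Suc_le[of i j], of "\<bar>cf f i j\<bar>"] by simp
    qed
  qed (auto intro!: sum_nonneg simp: wt_nonneg)
  then show "(\<Sum>i\<le>N. \<Sum>j\<le>N. \<bar>if i = 0 then 0 else cf f (i - 1) j / real i\<bar> * wt i j) \<le> norm f"
    using trunc_le_norm[of f N] by (simp add: trunc_def cf_def)
qed

definition ms_int :: "mseries \<Rightarrow> mseries" where
  "ms_int f = (SOME g. cf g = (\<lambda>i j. if i = 0 then 0 else cf f (i - 1) j / real i) \<and> norm g \<le> norm f)"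

lemma cf_ms_int: "cf (ms_int f) i j = (if i = 0 then 0 else cf f (i - 1) j / real i)"
  and norm_ms_int: "norm (ms_int f) \<le> norm f"
  using someI_ex[OF ms_int_ex[of f]] unfolding ms_int_def by auto

lemma bounded_linear_ms_int: "bounded_linear ms_int"
  by (rule bounded_linear_intro[where K = 1])
     (auto intro!: mseries_eqI norm_ms_int simp: cf_ms_int field_simps)

text \<open>Differentiation in s alone is unbounded on this algebra. The integration in v moves the
  result to the next row, where by \<open>wt_Suc_left\<close> the weighted terms are again the
  original ones.\<close>

lemma ms_dint_ex:
  "\<exists>g. cf g = (\<lambda>i j. if i = 0 then 0 else cf f (i - 1) (Suc j) * (real (Suc j) / real i)) \<and> norm g \<le> norm f"
proof (rule ex_mseries)
  fix N
  define h where "h i = (\<Sum>j\<le>N. \<bar>if i = 0 then 0 else cf f (i - 1) (Suc j) * (real (Suc j) / real i)\<bar> * wt i j)" for i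
  \<comment> \<open>One more column is needed on the right, because column j of the result comes
    from column j + 1.\<close>
  have "(\<Sum>i\<le>N. h i) \<le> (\<Sum>i\<le>N. \<Sum>j\<le>Suc N. \<bar>cf f i j\<bar> * wt i j)"
  proof (rule sum_atMost_shift_le)
    fix i
    have "h (Suc i) = (\<Sum>j\<le>N. \<bar>cf f i (Suc j)\<bar> * wt i (Suc j))"
      unfolding h_def wt_Suc_left[symmetric]
      by (intro sum.cong refl) (simp add: abs_mult mult_ac del: of_nat_Suc)
    also have "\<dots> \<le> (\<Sum>j\<le>Suc N. \<bar>cf f i j\<bar> * wt i j)"
      by (subst sum.atMost_Suc_shift) (simp add: wt_nonneg)
    finally show "h (Suc i) \<le> (\<Sum>j\<le>Suc N. \<bar>cf f i j\<bar> * wt i j)" .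
  qed (auto intro!: sum_nonneg add_nonneg_nonneg simp: wt_nonneg h_def simp del: sum.atMost_Suc)
  also have "\<dots> \<le> trunc (cfs f) (Suc N)"
    unfolding trunc_def cf_def
    by (rule sum_mono2) (auto intro!: sum_nonneg add_nonneg_nonneg simp: wt_nonneg)
  finally show "(\<Sum>i\<le>N. \<Sum>j\<le>N. \<bar>if i = 0 then 0 else cf f (i - 1) (Suc j) * (real (Suc j) / real i)\<bar> * wt i j) \<le> norm f"
    using trunc_le_norm[of f "Suc N"] unfolding h_def by linarith
qed

definition ms_dint :: "mseries \<Rightarrow> mseries" where
  "ms_dint f = (SOME g. cf g = (\<lambda>i j. if i = 0 then 0 else cf f (i - 1) (Suc j) * (real (Suc j) / real i)) \<and> norm g \<le> norm f)"

lemma cf_ms_dint: "cf (ms_dint f) i j = (if i = 0 then 0 else cf f (i - 1) (Suc j) * (real (Suc j) / real i))"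
  and norm_ms_dint: "norm (ms_dint f) \<le> norm f"
  using someI_ex[OF ms_dint_ex[of f]] unfolding ms_dint_def by auto

lemma bounded_linear_ms_dint: "bounded_linear ms_dint"
  by (rule bounded_linear_intro[where K = 1])
     (auto intro!: mseries_eqI norm_ms_dint simp: cf_ms_dint field_simps)

unbundle no fps_syntax
unbundle vec_syntax

section \<open>Substitution into convergent power series\<close>

abbreviation multi_indices :: "('a::euclidean_space \<Rightarrow> nat) set" where
  "multi_indices \<equiv> Basis \<rightarrow>\<^sub>E UNIV"

text \<open>The algebra is left open: over the reals this is the value of an analytic function, over
  \<open>mseries\<close> the composition of its expansion with series.\<close>

definition acomp :: "(('a::euclidean_space \<Rightarrow> nat) \<Rightarrow> real) \<Rightarrow> ('a \<Rightarrow> 'x) \<Rightarrow> 'x::{real_normed_algebra_1,comm_ring_1,banach}" where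
  "acomp a U = (\<Sum>\<^sub>\<infinity>k\<in>multi_indices. a k *\<^sub>R (\<Prod>b\<in>Basis. U b ^ k b))"

text \<open>Absolute convergence at the corner of the polydisc of radius \<open>R\<close>, hence on
  the whole closed polydisc.\<close>

definition acoeff :: "(('a::euclidean_space \<Rightarrow> nat) \<Rightarrow> real) \<Rightarrow> real \<Rightarrow> bool" where
  "acoeff a R \<longleftrightarrow> (\<lambda>k. \<bar>a k\<bar> * R ^ (\<Sum>b\<in>Basis. k b)) summable_on multi_indices"

lemma norm_monomial_le:
  fixes U :: "'a::euclidean_space \<Rightarrow> 'x::{real_normed_algebra_1,comm_ring_1}"
  assumes "\<And>b. b \<in> B \<Longrightarrow> norm (U b) \<le> R"
  shows "norm (\<Prod>b\<in>B. U b ^ k b) \<le> R ^ (\<Sum>b\<in>B. k b)"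
proof (cases "finite B")
  case True
  have "norm (\<Prod>b\<in>B. U b ^ k b) \<le> (\<Prod>b\<in>B. norm (U b ^ k b))" by (rule norm_prod_le)
  also have "\<dots> \<le> (\<Prod>b\<in>B. R ^ k b)"
    by (intro prod_mono conjI norm_ge_zero order_trans[OF norm_power_ineq] power_mono assms)
  also have "\<dots> = R ^ (\<Sum>b\<in>B. k b)" by (simp add: power_sum)
  finally show ?thesis .
qed simp

text \<open>The telescoped difference carries \<open>R\<close> to the power n - 1; multiplying by
  \<open>R\<close> avoids that exponent and the special case n = 0.\<close>

lemma norm_power_diff_le:
  fixes u v :: "'x::{real_normed_algebra_1,comm_ring_1}"
  assumes "norm u \<le> R" "norm v \<le> R"
  shows "norm (u ^ n - v ^ n) * R \<le> real n * R ^ n * norm (u - v)"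
proof (induction n)
  case (Suc n)
  have R: "R \<ge> 0" using assms(1) norm_ge_zero order_trans by blast
  have "u ^ Suc n - v ^ Suc n = u * (u ^ n - v ^ n) + (u - v) * v ^ n"
    by (simp add: algebra_simps)
  then have "norm (u ^ Suc n - v ^ Suc n) \<le> norm u * norm (u ^ n - v ^ n) + norm (u - v) * norm (v ^ n)"
    by (simp only:) (rule order_trans[OF norm_triangle_ineq add_mono[OF norm_mult_ineq norm_mult_ineq]])
  also have "\<dots> \<le> R * norm (u ^ n - v ^ n) + norm (u - v) * R ^ n"
    by (intro add_mono mult_mono assms R norm_ge_zero order.refl order_trans[OF norm_power_ineq] power_mono)
  finally have "norm (u ^ Suc n - v ^ Suc n) * R \<le> (R * norm (u ^ n - v ^ n) + norm (u - v) * R ^ n) * R"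
    by (rule mult_right_mono) (rule R)
  also have "\<dots> = R * (norm (u ^ n - v ^ n) * R) + norm (u - v) * R ^ Suc n" by (simp add: algebra_simps)
  also have "\<dots> \<le> R * (real n * R ^ n * norm (u - v)) + norm (u - v) * R ^ Suc n"
    by (intro add_right_mono mult_left_mono Suc R)
  finally show ?case by (simp add: algebra_simps)
qed simp

lemma norm_monomial_diff_le:
  fixes U V :: "'a::euclidean_space \<Rightarrow> 'x::{real_normed_algebra_1,comm_ring_1}"
  assumes "finite B" "\<And>b. b \<in> B \<Longrightarrow> norm (U b) \<le> R" "\<And>b. b \<in> B \<Longrightarrow> norm (V b) \<le> R"
    and "\<And>b. b \<in> B \<Longrightarrow> norm (U b - V b) \<le> d" and "R > 0" "d \<ge> 0"
  shows "norm ((\<Prod>b\<in>B. U b ^ k b) - (\<Prod>b\<in>B. V b ^ k b)) * R \<le> real (\<Sum>b\<in>B. k b) * R ^ (\<Sum>b\<in>B. k b) * d"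
  using assms(1-4)
proof (induction B rule: finite_induct)
  case (insert b B)
  let ?u = "U b ^ k b" and ?v = "V b ^ k b"
  let ?S = "\<Sum>b\<in>B. k b"
  let ?P = "\<Prod>b\<in>B. U b ^ k b" and ?Q = "\<Prod>b\<in>B. V b ^ k b"
  have R: "R \<ge> 0" using \<open>R > 0\<close> by simp
  have IH: "norm (?P - ?Q) * R \<le> real ?S * R ^ ?S * d" using insert by auto
  have 1: "norm (?u - ?v) * R \<le> real (k b) * R ^ k b * d"
  proof -
    have "norm (?u - ?v) * R \<le> real (k b) * R ^ k b * norm (U b - V b)"
      using insert.prems by (intro norm_power_diff_le) auto
    also have "\<dots> \<le> real (k b) * R ^ k b * d"
      using insert.prems R by (intro mult_left_mono) auto
    finally show ?thesis .
  qed
  have nv: "norm ?Q \<le> R ^ ?S"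
    using insert by (intro norm_monomial_le) auto
  have nu: "norm ?u \<le> R ^ k b"
    using insert by (intro order_trans[OF norm_power_ineq] power_mono) auto
  have "?u * ?P - ?v * ?Q = ?u * (?P - ?Q) + (?u - ?v) * ?Q" by (simp add: algebra_simps)
  then have "norm (?u * ?P - ?v * ?Q) \<le> norm ?u * norm (?P - ?Q) + norm (?u - ?v) * norm ?Q"
    by (simp only:) (rule order_trans[OF norm_triangle_ineq add_mono[OF norm_mult_ineq norm_mult_ineq]])
  then have "norm (?u * ?P - ?v * ?Q) * R \<le> (norm ?u * norm (?P - ?Q) + norm (?u - ?v) * norm ?Q) * R"
    by (rule mult_right_mono) (rule R)
  also have "\<dots> = norm ?u * (norm (?P - ?Q) * R) + (norm (?u - ?v) * R) * norm ?Q"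
    by (simp add: algebra_simps)
  also have "\<dots> \<le> R ^ k b * (real ?S * R ^ ?S * d) + (real (k b) * R ^ k b * d) * R ^ ?S"
    by (intro add_mono mult_mono IH 1 nv nu mult_nonneg_nonneg norm_ge_zero zero_le_power R \<open>d \<ge> 0\<close>) auto
  also have "\<dots> = real (k b + ?S) * R ^ (k b + ?S) * d" by (simp add: algebra_simps power_add)
  finally show ?case using insert by simp
qed simp

lemma acoeff_mono: "acoeff a R \<Longrightarrow> 0 \<le> R' \<Longrightarrow> R' \<le> R \<Longrightarrow> acoeff a R'"
  unfolding acoeff_def
  by (rule summable_on_comparison_test) (auto intro!: mult_left_mono power_mono)

lemma acomp_abs_summable:
  fixes U :: "'a::euclidean_space \<Rightarrow> 'x::{real_normed_algebra_1,comm_ring_1,banach}"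
  assumes "acoeff a R" "\<And>b. b \<in> Basis \<Longrightarrow> norm (U b) \<le> R"
  shows "(\<lambda>k. norm (a k *\<^sub>R (\<Prod>b\<in>Basis. U b ^ k b))) summable_on multi_indices"
  by (rule summable_on_comparison_test[OF assms(1)[unfolded acoeff_def]])
     (auto intro!: mult_left_mono norm_monomial_le assms(2))

lemma norm_acomp_le:
  fixes U :: "'a::euclidean_space \<Rightarrow> 'x::{real_normed_algebra_1,comm_ring_1,banach}"
  assumes "acoeff a R" "\<And>b. b \<in> Basis \<Longrightarrow> norm (U b) \<le> R"
  shows "norm (acomp a U) \<le> (\<Sum>\<^sub>\<infinity>k\<in>multi_indices. \<bar>a k\<bar> * R ^ (\<Sum>b\<in>Basis. k b))"
proof -
  note s = acomp_abs_summable[OF assms]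
  have "norm (acomp a U) \<le> (\<Sum>\<^sub>\<infinity>k\<in>multi_indices. norm (a k *\<^sub>R (\<Prod>b\<in>Basis. U b ^ k b)))"
    unfolding acomp_def by (rule norm_infsum_bound) (rule s)
  also have "\<dots> \<le> (\<Sum>\<^sub>\<infinity>k\<in>multi_indices. \<bar>a k\<bar> * R ^ (\<Sum>b\<in>Basis. k b))"
    by (rule infsum_mono[OF s assms(1)[unfolded acoeff_def]])
       (auto intro!: mult_left_mono norm_monomial_le assms(2))
  finally show ?thesis .
qed

text \<open>A monomial of degree n contributes a factor n to the Lipschitz bound. It is absorbed by
  n <= 2^n, which is why convergence is required at the doubled radius.\<close>

lemma acomp_diff_le:
  fixes U V :: "'a::euclidean_space \<Rightarrow> 'x::{real_normed_algebra_1,comm_ring_1,banach}"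
  assumes a: "acoeff a (2 * R)" and R: "R > 0"
    and U: "\<And>b. b \<in> Basis \<Longrightarrow> norm (U b) \<le> R" and V: "\<And>b. b \<in> Basis \<Longrightarrow> norm (V b) \<le> R"
    and d: "\<And>b. b \<in> Basis \<Longrightarrow> norm (U b - V b) \<le> d" "d \<ge> 0"
  shows "norm (acomp a U - acomp a V)
      \<le> (\<Sum>\<^sub>\<infinity>k\<in>multi_indices. \<bar>a k\<bar> * (2 * R) ^ (\<Sum>b\<in>Basis. k b)) / R * d"
proof -
  let ?u = "\<lambda>k. a k *\<^sub>R (\<Prod>b\<in>Basis. U b ^ k b)" and ?v = "\<lambda>k. a k *\<^sub>R (\<Prod>b\<in>Basis. V b ^ k b)"
  let ?g = "\<lambda>k. \<bar>a k\<bar> * (2 * R) ^ (\<Sum>b\<in>Basis. k b) * (d / R)"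
  have aR: "acoeff a R" using a R by (auto intro: acoeff_mono)
  have su: "?u summable_on multi_indices" "?v summable_on multi_indices"
    by (rule abs_summable_summable, rule acomp_abs_summable[OF aR], rule U V, assumption)+
  have sg: "?g summable_on multi_indices"
    using a unfolding acoeff_def by (rule summable_on_cmult_left)
  have le: "norm (?u k - ?v k) \<le> ?g k" for k
  proof -
    let ?S = "\<Sum>b\<in>Basis. k b"
    have "norm ((\<Prod>b\<in>Basis. U b ^ k b) - (\<Prod>b\<in>Basis. V b ^ k b)) * R \<le> real ?S * R ^ ?S * d"
      by (rule norm_monomial_diff_le) (use U V d R in auto)
    also have "\<dots> \<le> 2 ^ ?S * R ^ ?S * d"
      using R d(2) of_nat_less_two_power[of ?S, where ?'a = real]
      by (intro mult_right_mono) auto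
    also have "\<dots> = (2 * R) ^ ?S * (d / R) * R"
      using R by (simp add: power_mult_distrib)
    finally have "norm ((\<Prod>b\<in>Basis. U b ^ k b) - (\<Prod>b\<in>Basis. V b ^ k b)) \<le> (2 * R) ^ ?S * (d / R)"
      using R by (simp only: mult_le_cancel_right_pos)
    then have "\<bar>a k\<bar> * norm ((\<Prod>b\<in>Basis. U b ^ k b) - (\<Prod>b\<in>Basis. V b ^ k b)) \<le> \<bar>a k\<bar> * ((2 * R) ^ ?S * (d / R))"
      by (rule mult_left_mono) simp
    then show ?thesis
      by (simp add: scaleR_diff_right[symmetric] mult.assoc)
  qed
  have sd: "(\<lambda>k. norm (?u k - ?v k)) summable_on multi_indices"
    by (rule summable_on_comparison_test[OF sg]) (use le in auto)
  have "norm (acomp a U - acomp a V) = norm (\<Sum>\<^sub>\<infinity>k\<in>multi_indices. ?u k - ?v k)"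
  proof -
    have "((\<lambda>k. ?u k + - ?v k) has_sum (acomp a U + - acomp a V)) multi_indices"
      unfolding acomp_def using su by (intro has_sum_add has_sum_uminus[THEN iffD2]) (auto intro: has_sum_infsum)
    then show ?thesis by (simp add: infsumI)
  qed
  also have "\<dots> \<le> (\<Sum>\<^sub>\<infinity>k\<in>multi_indices. norm (?u k - ?v k))"
    by (rule norm_infsum_bound) (rule sd)
  also have "\<dots> \<le> infsum ?g multi_indices"
    by (rule infsum_mono[OF sd sg]) (rule le)
  also have "\<dots> = (\<Sum>\<^sub>\<infinity>k\<in>multi_indices. \<bar>a k\<bar> * (2 * R) ^ (\<Sum>b\<in>Basis. k b)) * (d / R)"
    by (rule infsum_cmult_left) (use a in \<open>simp add: acoeff_def\<close>)
  finally show ?thesis by simp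
qed

text \<open>Continuous homomorphisms pass through the infinite sum. The case of interest is
  evaluation at a point, which turns an identity between series into one between functions.\<close>

lemma acomp_hom:
  fixes U :: "'a::euclidean_space \<Rightarrow> 'x::{real_normed_algebra_1,comm_ring_1,banach}"
    and \<phi> :: "'x \<Rightarrow> 'y::{real_normed_algebra_1,comm_ring_1,banach}"
  assumes "acoeff a R" "\<And>b. b \<in> Basis \<Longrightarrow> norm (U b) \<le> R"
    and "bounded_linear \<phi>" and mult: "\<And>f g. \<phi> (f * g) = \<phi> f * \<phi> g" and one: "\<phi> 1 = 1"
  shows "\<phi> (acomp a U) = acomp a (\<lambda>b. \<phi> (U b))"
proof -
  interpret bounded_linear \<phi> by fact
  have pow: "\<phi> (f ^ n) = \<phi> f ^ n" for f n
    by (induction n) (simp_all add: mult one)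
  have prod: "\<phi> (\<Prod>b\<in>B. U b ^ k b) = (\<Prod>b\<in>B. \<phi> (U b) ^ k b)" if "finite B" for B k
    using that by induction (simp_all add: mult one pow)
  have "(\<lambda>k. a k *\<^sub>R (\<Prod>b\<in>Basis. U b ^ k b)) summable_on multi_indices"
    using acomp_abs_summable[OF assms(1,2)] by (rule abs_summable_summable)
  then have "((\<lambda>k. a k *\<^sub>R (\<Prod>b\<in>Basis. U b ^ k b)) has_sum acomp a U) multi_indices"
    unfolding acomp_def by (rule has_sum_infsum)
  then have "((\<lambda>k. \<phi> (a k *\<^sub>R (\<Prod>b\<in>Basis. U b ^ k b))) has_sum \<phi> (acomp a U)) multi_indices"
    by (rule has_sum_bounded_linear[OF bounded_linear_axioms])
  then have "((\<lambda>k. a k *\<^sub>R (\<Prod>b\<in>Basis. \<phi> (U b) ^ k b)) has_sum \<phi> (acomp a U)) multi_indices"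
    by (simp add: scaleR prod)
  then show ?thesis
    unfolding acomp_def by (simp add: infsumI)
qed

lemma real_analytic_acomp:
  fixes f :: "'a::euclidean_space \<Rightarrow> real"
  assumes "f real_analytic_on S" "p \<in> S"
  obtains a R where "R > 0" "acoeff a R"
    "\<And>h. (\<And>b. b \<in> Basis \<Longrightarrow> \<bar>h \<bullet> b\<bar> \<le> R) \<Longrightarrow> f (p + h) = acomp a (\<lambda>b. h \<bullet> b)"
proof -
  obtain a :: "('a \<Rightarrow> nat) \<Rightarrow> real" and r where r: "r > 0"
    and hs: "\<And>h. norm h < r \<Longrightarrow>
      ((\<lambda>k. (\<Prod>b\<in>Basis. (h \<bullet> b) ^ k b) *\<^sub>R a k) has_sum f (p + h)) multi_indices"
    using assms unfolding real_analytic_on_def by blast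
  define R where "R = r / (2 * real DIM('a))"
  have R: "R > 0" "real DIM('a) * R < r" using r by (auto simp: R_def field_simps)
  have small: "norm h < r" if "\<And>b. b \<in> Basis \<Longrightarrow> \<bar>h \<bullet> b\<bar> \<le> R" for h :: 'a
  proof -
    have "norm h \<le> (\<Sum>b\<in>Basis. \<bar>h \<bullet> b\<bar>)" by (rule norm_le_l1)
    also have "\<dots> \<le> real DIM('a) * R" using sum_bounded_above[of Basis "\<lambda>b. \<bar>h \<bullet> b\<bar>" R] that by simp
    finally show ?thesis using R by linarith
  qed
  \<comment> \<open>At the corner \<open>h0\<close> of the cube every monomial attains its largest
    modulus, so summability there is \<open>acoeff a R\<close>. The choice of \<open>R\<close> keeps
    the cube inside the ball of convergence.\<close>
  define h0 :: 'a where "h0 = (\<Sum>b\<in>Basis. R *\<^sub>R b)"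
  have h0: "h0 \<bullet> b = R" if "b \<in> Basis" for b
    unfolding h0_def using that by (simp add: inner_sum_left inner_Basis if_distrib cong: if_cong)
  have "norm h0 < r" by (rule small) (use R in \<open>simp add: h0\<close>)
  then have "(\<lambda>k. (\<Prod>b\<in>Basis. (h0 \<bullet> b) ^ k b) *\<^sub>R a k) summable_on multi_indices"
    by (rule has_sum_imp_summable[OF hs])
  then have "(\<lambda>k. norm ((\<Prod>b\<in>Basis. (h0 \<bullet> b) ^ k b) *\<^sub>R a k)) summable_on multi_indices"
    by (rule summable_on_iff_abs_summable_on_real[THEN iffD1])
  then have "acoeff a R"
    unfolding acoeff_def
    by (rule summable_on_cong[THEN iffD1, rotated])
       (use R in \<open>simp add: h0 power_sum abs_mult abs_prod power_abs mult.commute\<close>)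
  moreover have "f (p + h) = acomp a (\<lambda>b. h \<bullet> b)" if "\<And>b. b \<in> Basis \<Longrightarrow> \<bar>h \<bullet> b\<bar> \<le> R" for h
    using infsumI[OF hs[OF small[OF that]]] by (simp add: acomp_def mult.commute)
  ultimately show ?thesis using that R by blast
qed

section \<open>Sums of power series in one and two variables\<close>

lemma Suc_mult_power_bounded:
  fixes q :: real
  assumes "0 \<le> q" "q < 1"
  shows "real (Suc n) * q ^ n \<le> 1 / (1 - q)\<^sup>2"
proof -
  have s: "(\<lambda>n. real (Suc n) * q ^ n) sums (1 / (1 - q)\<^sup>2)"
    using geometric_deriv_sums[of q] assms by simp
  have "sum (\<lambda>n. real (Suc n) * q ^ n) {n} \<le> (\<Sum>n. real (Suc n) * q ^ n)"
    using s assms by (intro sum_le_suminf) (auto simp: sums_iff)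
  then show ?thesis using s by (simp add: sums_iff)
qed

text \<open>A Weierstrass majorant \<open>M\<close> for the derivatives makes their tails uniformly
  small, which is what termwise differentiation needs.\<close>

lemma has_derivative_suminf:
  fixes F :: "nat \<Rightarrow> 'a::real_normed_vector \<Rightarrow> 'b::banach"
  assumes S: "open S" "convex S" "x \<in> S"
    and deriv: "\<And>i y. y \<in> S \<Longrightarrow> (F i has_derivative F' i y) (at y)"
    and M: "\<And>i y h. y \<in> S \<Longrightarrow> norm (F' i y h) \<le> M i * norm h" "summable M"
    and N: "\<And>y. y \<in> S \<Longrightarrow> summable (\<lambda>i. F i y)"
  shows "((\<lambda>y. \<Sum>i. F i y) has_derivative (\<lambda>h. \<Sum>i. F' i x h)) (at x)"
proof -
  have sn: "summable (\<lambda>i. norm (F' i y h))" if "y \<in> S" for y h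
    by (rule summable_comparison_test'[OF summable_mult2[OF M(2), of "norm h"], where N = 0])
       (simp add: M(1)[OF that])
  have "\<forall>\<^sub>F n in sequentially. \<forall>y\<in>S. \<forall>h. norm (sum (\<lambda>i. F' i y h) {..<n} - (\<Sum>i. F' i y h)) \<le> e * norm h"
    if "e > 0" for e
  proof -
    obtain N where N: "\<And>n. n \<ge> N \<Longrightarrow> norm (\<Sum>i. M (i + n)) < e"
      using suminf_exist_split[OF \<open>e > 0\<close> M(2)] by blast
    show ?thesis
    proof (rule eventually_sequentiallyI[of N], intro ballI allI)
      fix n y h assume n: "N \<le> n" and y: "y \<in> S"
      have "norm (sum (\<lambda>i. F' i y h) {..<n} - (\<Sum>i. F' i y h)) = norm (\<Sum>i. F' (i + n) y h)"
        using suminf_split_initial_segment[OF summable_norm_cancel[OF sn[OF y, of h]], of n]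
        by (simp add: norm_minus_commute)
      also have "\<dots> \<le> (\<Sum>i. norm (F' (i + n) y h))"
        by (rule summable_norm) (rule summable_ignore_initial_segment[OF sn[OF y]])
      also have "\<dots> \<le> (\<Sum>i. M (i + n) * norm h)"
        by (rule suminf_le[OF M(1)[OF y] summable_ignore_initial_segment[OF sn[OF y]]
              summable_mult2[OF summable_ignore_initial_segment[OF M(2)]]])
      also have "\<dots> = (\<Sum>i. M (i + n)) * norm h"
        by (rule suminf_mult2[symmetric, OF summable_ignore_initial_segment[OF M(2)]])
      also have "\<dots> \<le> e * norm h"
        using N[OF n] by (intro mult_right_mono) auto
      finally show "norm (sum (\<lambda>i. F' i y h) {..<n} - (\<Sum>i. F' i y h)) \<le> e * norm h" .
    qed
  qed
  note tail = this
  have "\<exists>g. \<forall>y\<in>S. (\<lambda>n. F n y) sums (g y) \<and> (g has_derivative (\<lambda>h. \<Sum>i. F' i y h)) (at y within S)"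
    by (rule has_derivative_series[where f' = F' and x = x,
          OF S(2) has_derivative_at_withinI[OF deriv] tail S(3) summable_sums[OF N[OF S(3)]]])
  then obtain g where g: "\<forall>y\<in>S. (\<lambda>n. F n y) sums (g y) \<and> (g has_derivative (\<lambda>h. \<Sum>i. F' i y h)) (at y within S)" ..
  have "(g has_derivative (\<lambda>h. \<Sum>i. F' i x h)) (at x)"
    using bspec[OF g S(3)] at_within_open[OF S(3,1)] by simp
  then show ?thesis
  proof (rule has_derivative_transform_within_open[OF _ S(1,3)])
    show "g y = (\<Sum>i. F i y)" if "y \<in> S" for y
      using bspec[OF g that] sums_unique by blast
  qed
qed

definition psum1 :: "(nat \<Rightarrow> 'a::banach) \<Rightarrow> real \<Rightarrow> 'a" where
  "psum1 c s = (\<Sum>j. s ^ j *\<^sub>R c j)"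

definition dseq :: "(nat \<Rightarrow> 'a::real_vector) \<Rightarrow> nat \<Rightarrow> 'a" where
  "dseq c j = real (Suc j) *\<^sub>R c (Suc j)"

lemma psum1_summable:
  fixes c :: "nat \<Rightarrow> 'a::banach"
  assumes c: "\<And>j. norm (c j) * \<rho> ^ j \<le> M" and s: "\<bar>s\<bar> < \<rho>"
  shows "summable (\<lambda>j. norm (s ^ j *\<^sub>R c j))"
    and "norm (psum1 c s) \<le> M * (\<rho> / (\<rho> - \<bar>s\<bar>))"
proof -
  define q where "q = \<bar>s\<bar> / \<rho>"
  have \<rho>: "\<rho> > 0" using s by linarith
  have q: "0 \<le> q" "q < 1" using s \<rho> by (auto simp: q_def)
  have le: "norm (s ^ j *\<^sub>R c j) \<le> M * q ^ j" for j
  proof -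
    have "norm (s ^ j *\<^sub>R c j) = norm (c j) * \<rho> ^ j * q ^ j"
      using \<rho> by (simp add: q_def power_divide power_abs)
    also have "\<dots> \<le> M * q ^ j" using c[of j] q by (intro mult_right_mono) auto
    finally show ?thesis .
  qed
  have sg: "summable (\<lambda>j. M * q ^ j)" using q by (intro summable_mult summable_geometric) auto
  show sm: "summable (\<lambda>j. norm (s ^ j *\<^sub>R c j))"
    by (rule summable_comparison_test'[OF sg, where N = 0]) (use le in auto)
  have "norm (psum1 c s) \<le> (\<Sum>j. norm (s ^ j *\<^sub>R c j))"
    unfolding psum1_def by (rule summable_norm[OF sm])
  also have "\<dots> \<le> (\<Sum>j. M * q ^ j)" by (rule suminf_le[OF le sm sg])
  also have "\<dots> = M * (1 / (1 - q))"
    using q by (subst suminf_mult) (auto simp: suminf_geometric)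
  also have "1 / (1 - q) = \<rho> / (\<rho> - \<bar>s\<bar>)" using \<rho> s by (simp add: q_def field_simps)
  finally show "norm (psum1 c s) \<le> M * (\<rho> / (\<rho> - \<bar>s\<bar>))" .
qed

text \<open>Shrinking the radius from \<rho> to \<open>r\<close> leaves a factor (r / \<rho>)^j,
  which beats the factor j + 1 produced by differentiation.\<close>

lemma dseq_bound:
  fixes c :: "nat \<Rightarrow> 'a::real_normed_vector"
  assumes c: "\<And>j. norm (c j) * \<rho> ^ j \<le> M" and r: "0 < r" "r < \<rho>"
  shows "norm (dseq c j) * r ^ j \<le> M / \<rho> * (1 / (1 - r / \<rho>)\<^sup>2)"
proof -
  have \<rho>: "\<rho> > 0" using r by linarith
  have M: "M \<ge> 0" using order_trans[OF _ c[of 0]] by simp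
  have "norm (dseq c j) * r ^ j = (norm (c (Suc j)) * \<rho> ^ Suc j) / \<rho> * (real (Suc j) * (r / \<rho>) ^ j)"
    using \<rho> by (simp add: dseq_def power_divide field_simps del: of_nat_Suc)
  also have "\<dots> \<le> M / \<rho> * (1 / (1 - r / \<rho>)\<^sup>2)"
    using \<rho> M r by (intro mult_mono divide_right_mono c Suc_mult_power_bounded) auto
  finally show ?thesis .
qed

lemma psum1_has_vector_derivative:
  fixes c :: "nat \<Rightarrow> 'a::banach"
  assumes c: "\<And>j. norm (c j) * \<rho> ^ j \<le> M" and s: "\<bar>s\<bar> < \<rho>"
  shows "(psum1 c has_vector_derivative psum1 (dseq c) s) (at s)"
proof -
  obtain r where r: "\<bar>s\<bar> < r" "r < \<rho>" using s dense by blast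
  obtain r' where r': "r < r'" "r' < \<rho>" using r dense by blast
  have r0: "0 < r" "0 < r'" using r r' by linarith+
  define M' where "M' = M / \<rho> * (1 / (1 - r' / \<rho>)\<^sup>2)"
  have dM: "norm (dseq c j) * r' ^ j \<le> M'" for j
    unfolding M'_def by (rule dseq_bound[OF c r0(2) r'(2)])
  let ?F' = "\<lambda>j y h. (real j * y ^ (j - 1) * h) *\<^sub>R c j"
  have sd: "summable (\<lambda>j. r ^ j * norm (dseq c j))"
    using psum1_summable(1)[OF dM, of r] r0 r' by simp
  have "((\<lambda>y. \<Sum>j. y ^ j *\<^sub>R c j) has_derivative (\<lambda>h. \<Sum>j. ?F' j s h)) (at s)"
  proof (rule has_derivative_suminf[where S = "{-r<..<r}" and
        M = "\<lambda>j. case j of 0 \<Rightarrow> 0 | Suc i \<Rightarrow> r ^ i * norm (dseq c i)"])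
    show "s \<in> {-r<..<r}" using r by auto
    show "((\<lambda>y. y ^ i *\<^sub>R c i) has_derivative ?F' i y) (at y)" for i y
      by (auto intro!: derivative_eq_intros simp: mult_ac)
    show "summable (\<lambda>j. case j of 0 \<Rightarrow> 0 | Suc i \<Rightarrow> r ^ i * norm (dseq c i))"
      by (subst summable_Suc_iff[symmetric]) (simp add: sd)
    show "norm (?F' i y h) \<le> (case i of 0 \<Rightarrow> 0 | Suc i \<Rightarrow> r ^ i * norm (dseq c i)) * norm h"
      if "y \<in> {-r<..<r}" for i y h
    proof (cases i)
      case (Suc n)
      have "norm (?F' i y h) = \<bar>y\<bar> ^ n * norm (dseq c n) * norm h"
        by (simp add: Suc dseq_def abs_mult power_abs mult_ac del: of_nat_Suc)
      also have "\<dots> \<le> r ^ n * norm (dseq c n) * norm h"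
        using that by (intro mult_right_mono power_mono) auto
      finally show ?thesis by (simp add: Suc)
    qed simp
    show "summable (\<lambda>i. y ^ i *\<^sub>R c i)" if "y \<in> {-r<..<r}" for y
      by (rule summable_norm_cancel[OF psum1_summable(1)[OF c]]) (use that r in auto)
  qed auto
  moreover have "(\<Sum>j. ?F' j s h) = h *\<^sub>R psum1 (dseq c) s" for h
  proof -
    have s1: "summable (\<lambda>j. s ^ j *\<^sub>R dseq c j)"
      by (rule summable_norm_cancel[OF psum1_summable(1)[OF dM]]) (use r r' in auto)
    have eq: "?F' (Suc j) s h = h *\<^sub>R (s ^ j *\<^sub>R dseq c j)" for j
      by (simp add: dseq_def mult_ac del: of_nat_Suc)
    have "summable (\<lambda>j. ?F' (Suc j) s h)" unfolding eq by (rule summable_scaleR_right[OF s1])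
    then have "summable (\<lambda>j. ?F' j s h)" by (subst (asm) summable_Suc_iff)
    then have "(\<Sum>j. ?F' j s h) = (\<Sum>j. ?F' (Suc j) s h)"
      by (subst suminf_split_head) auto
    then show ?thesis unfolding eq psum1_def by (simp add: suminf_scaleR_right[OF s1])
  qed
  ultimately show ?thesis
    unfolding has_vector_derivative_def psum1_def[abs_def] by simp
qed

text \<open>The entry \<open>a i j\<close> is the coefficient of v^i s^j.\<close>

definition psum :: "(nat \<Rightarrow> nat \<Rightarrow> 'a::banach) \<Rightarrow> real \<Rightarrow> real \<Rightarrow> 'a" where
  "psum a s v = psum1 (\<lambda>i. psum1 (a i) s) v"

text \<open>Only boundedness is recorded, not summability: any smaller radius gives summability, and
  each derivative costs a little radius as well.\<close>

definition gbound :: "(nat \<Rightarrow> nat \<Rightarrow> 'a::real_normed_vector) \<Rightarrow> real \<Rightarrow> bool" where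
  "gbound a \<rho> \<longleftrightarrow> (\<exists>M. \<forall>i j. norm (a i j) * \<rho> ^ (i + j) \<le> M)"

definition ds :: "(nat \<Rightarrow> nat \<Rightarrow> 'a::real_vector) \<Rightarrow> nat \<Rightarrow> nat \<Rightarrow> 'a" where
  "ds a i = dseq (a i)"

definition dv :: "(nat \<Rightarrow> nat \<Rightarrow> 'a::real_vector) \<Rightarrow> nat \<Rightarrow> nat \<Rightarrow> 'a" where
  "dv a i j = real (Suc i) *\<^sub>R a (Suc i) j"

lemma dv_ds: "dv (ds a) = ds (dv a)"
  by (auto simp: dv_def ds_def dseq_def fun_eq_iff mult_ac)

lemma gbound_row:
  assumes "\<And>i j. norm (a i j) * \<rho> ^ (i + j) \<le> M" "\<rho> > 0"
  shows "norm (a i j) * \<rho> ^ j \<le> M / \<rho> ^ i"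
  using assms(1)[of i j] assms(2) by (simp add: field_simps power_add)

lemma gbound_mono:
  assumes "gbound a \<rho>" "0 \<le> r" "r \<le> \<rho>"
  shows "gbound a r"
proof -
  obtain M where M: "\<And>i j. norm (a i j) * \<rho> ^ (i + j) \<le> M" using assms unfolding gbound_def by blast
  have "norm (a i j) * r ^ (i + j) \<le> M" for i j
    using M[of i j] mult_left_mono[OF power_mono[OF assms(3,2), of "i+j"] norm_ge_zero[of "a i j"]] by linarith
  then show ?thesis unfolding gbound_def by blast
qed

lemma gbound_ds:
  assumes "gbound a \<rho>" "0 < r" "r < \<rho>"
  shows "gbound (ds a) r"
proof -
  obtain M where M: "\<And>i j. norm (a i j) * \<rho> ^ (i + j) \<le> M" using assms unfolding gbound_def by blast
  have \<rho>: "\<rho> > 0" using assms by linarith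
  define K where "K = 1 / \<rho> * (1 / (1 - r / \<rho>)\<^sup>2)"
  have M0: "M \<ge> 0" using order_trans[OF _ M[of 0 0]] by simp
  have K: "K \<ge> 0" using \<rho> by (simp add: K_def)
  have "norm (ds a i j) * r ^ (i + j) \<le> M * K" for i j
  proof -
    have "norm (ds a i j) * r ^ j \<le> (M / \<rho> ^ i) / \<rho> * (1 / (1 - r / \<rho>)\<^sup>2)"
      unfolding ds_def by (rule dseq_bound[OF gbound_row[OF M \<rho>] assms(2,3)])
    then have "norm (ds a i j) * r ^ j \<le> (M / \<rho> ^ i) * K" by (simp add: K_def)
    then have "norm (ds a i j) * r ^ j * r ^ i \<le> (M / \<rho> ^ i) * K * r ^ i"
      using assms by (intro mult_right_mono) auto
    also have "\<dots> = M * K * (r / \<rho>) ^ i" by (simp add: power_divide)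
    also have "\<dots> \<le> M * K * 1"
      using assms M0 K \<rho> by (intro mult_left_mono power_le_one) auto
    finally show ?thesis by (simp add: power_add mult_ac)
  qed
  then show ?thesis unfolding gbound_def by blast
qed

lemma gbound_transpose:
  assumes "gbound a \<rho>"
  shows "gbound (\<lambda>i j. a j i) \<rho>"
proof -
  obtain M where M: "\<And>i j. norm (a i j) * \<rho> ^ (i + j) \<le> M" using assms unfolding gbound_def by blast
  have "norm (a j i) * \<rho> ^ (i + j) \<le> M" for i j
    using M[of j i] by (simp only: add.commute)
  then show ?thesis unfolding gbound_def by blast
qed

text \<open>Exchanging the two indices turns the v-derivative into the s-derivative.\<close>

lemma gbound_dv:
  assumes "gbound a \<rho>" "0 < r" "r < \<rho>"
  shows "gbound (dv a) r"
proof -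
  have "dv a = (\<lambda>i j. ds (\<lambda>i j. a j i) j i)" by (simp add: fun_eq_iff dv_def ds_def dseq_def)
  then show ?thesis
    using gbound_transpose[OF gbound_ds[OF gbound_transpose[OF assms(1)] assms(2,3)]] by simp
qed

lemma psum_row_bound:
  assumes "\<And>i j. norm (a i j) * \<rho> ^ (i + j) \<le> M" "\<bar>s\<bar> \<le> r" "r < \<rho>"
  shows "norm (psum1 (a i) s) * \<rho> ^ i \<le> M * (\<rho> / (\<rho> - r))"
proof -
  have \<rho>: "\<rho> > 0" using assms by linarith
  have M0: "M \<ge> 0" using order_trans[OF _ assms(1)[of 0 0]] by simp
  have "norm (psum1 (a i) s) \<le> M / \<rho> ^ i * (\<rho> / (\<rho> - \<bar>s\<bar>))"
    by (rule psum1_summable(2)[OF gbound_row[OF assms(1) \<rho>]]) (use assms in auto)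
  also have "\<dots> \<le> M / \<rho> ^ i * (\<rho> / (\<rho> - r))"
    using \<rho> M0 assms by (intro mult_left_mono divide_left_mono mult_pos_pos) auto
  finally have "norm (psum1 (a i) s) * \<rho> ^ i \<le> M / \<rho> ^ i * (\<rho> / (\<rho> - r)) * \<rho> ^ i"
    using \<rho> by (intro mult_right_mono) auto
  then show ?thesis using \<rho> by simp
qed

lemma psum_has_derivative:
  fixes a :: "nat \<Rightarrow> nat \<Rightarrow> 'a::banach"
  assumes "gbound a \<rho>" "\<bar>s\<bar> < \<rho>" "\<bar>v\<bar> < \<rho>"
  shows "((\<lambda>w. psum a (fst w) (snd w)) has_derivative
     (\<lambda>h. fst h *\<^sub>R psum (ds a) s v + snd h *\<^sub>R psum (dv a) s v)) (at (s, v))"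
proof -
  \<comment> \<open>Bounds for the s-derivative are available only below \<rho>, hence the
    intermediate \<open>r'\<close> chosen next; the row sums at points of size up to
    \<open>r\<close> in turn need bounds on a radius larger than \<open>r\<close>.\<close>
  obtain r where r: "max \<bar>s\<bar> \<bar>v\<bar> < r" "r < \<rho>" using assms dense[of "max \<bar>s\<bar> \<bar>v\<bar>" \<rho>] by auto
  obtain r' where r': "r < r'" "r' < \<rho>" using r dense by blast
  have r0: "0 < r" "0 < r'" "0 < \<rho>" using r r' by linarith+
  obtain M where M: "\<And>i j. norm (a i j) * \<rho> ^ (i + j) \<le> M" using assms(1) unfolding gbound_def by blast
  obtain M1 where M1: "\<And>i j. norm (ds a i j) * r' ^ (i + j) \<le> M1"
    using gbound_ds[OF assms(1) r0(2) r'(2)] unfolding gbound_def by blast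
  define R where "R i = psum1 (a i)" for i
  define R' where "R' i = psum1 (ds a i)" for i
  define C where "C = M * (\<rho> / (\<rho> - r))"
  define C1 where "C1 = M1 * (r' / (r' - r))"
  have RC: "norm (R i y) * \<rho> ^ i \<le> C" if "\<bar>y\<bar> \<le> r" for i y
    unfolding R_def C_def by (rule psum_row_bound[OF M that r(2)])
  have RC1: "norm (R' i y) * r' ^ i \<le> C1" if "\<bar>y\<bar> \<le> r" for i y
    unfolding R'_def C1_def by (rule psum_row_bound[OF M1 that r'(1)])
  have derR: "(R i has_vector_derivative R' i y) (at y)" if "\<bar>y\<bar> < r" for i y
    unfolding R_def R'_def ds_def
    by (rule psum1_has_vector_derivative[OF gbound_row[OF M r0(3)]]) (use that r in auto)
  let ?S = "{-r<..<r} \<times> {-r<..<r}"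
  let ?F = "\<lambda>i (w::real\<times>real). snd w ^ i *\<^sub>R R i (fst w)"
  let ?F' = "\<lambda>i (w::real\<times>real) h. (snd w) ^ i *\<^sub>R (fst h *\<^sub>R R' i (fst w)) + (real i * snd w ^ (i - 1) * snd h) *\<^sub>R R i (fst w)"
  \<comment> \<open>The two summands majorize the two terms in the derivative of v^i R_i(s). The
    first is controlled by (r / r')^i, the second by the differentiated geometric series in r /
    \<rho>.\<close>
  define B where "B i = C1 * (r / r') ^ i + C / \<rho> * (case i of 0 \<Rightarrow> 0 | Suc n \<Rightarrow> real (Suc n) * (r / \<rho>) ^ n)" for i
  have C0: "C \<ge> 0" "C1 \<ge> 0"
    using order_trans[OF _ RC[of 0 0]] order_trans[OF _ RC1[of 0 0]] r0 by auto
  have sB: "summable B"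
    unfolding B_def
  proof (intro summable_add summable_mult)
    show "summable (\<lambda>i. (r / r') ^ i)" using r0 r' by (intro summable_geometric) auto
    show "summable (case_nat 0 (\<lambda>n. real (Suc n) * (r / \<rho>) ^ n))"
    proof (subst summable_Suc_iff[symmetric])
      show "summable (\<lambda>n. case Suc n of 0 \<Rightarrow> 0 | Suc n \<Rightarrow> real (Suc n) * (r / \<rho>) ^ n)"
        using geometric_deriv_sums[of "r / \<rho>"] r0 r by (simp add: sums_iff)
    qed
  qed
  have sum1: "summable (\<lambda>i. y2 ^ i *\<^sub>R R i y1)" if "\<bar>y1\<bar> < r" "\<bar>y2\<bar> < r" for y1 y2
    by (rule summable_norm_cancel[OF psum1_summable(1)[OF RC]]) (use that r in auto)
  have "((\<lambda>w. \<Sum>i. ?F i w) has_derivative (\<lambda>h. \<Sum>i. ?F' i (s,v) h)) (at (s,v))"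
  proof (rule has_derivative_suminf[where S = ?S and M = B])
    show "(?F i has_derivative ?F' i w) (at w)" if "w \<in> ?S" for i w
    proof -
      have "((\<lambda>w. R i (fst w)) has_derivative (\<lambda>h. fst h *\<^sub>R R' i (fst w))) (at w)"
        using derR[of "fst w" i] that
        by (auto simp: has_vector_derivative_def intro!: has_derivative_compose[where f = fst] derivative_intros)
      then show ?thesis
        by (auto intro!: derivative_eq_intros simp: mult_ac)
    qed
    show "norm (?F' i w h) \<le> B i * norm h" if w: "w \<in> ?S" for i w h
    proof -
      have w': "\<bar>fst w\<bar> \<le> r" "\<bar>snd w\<bar> \<le> r" using w by auto
      have h: "\<bar>fst h\<bar> \<le> norm h" "\<bar>snd h\<bar> \<le> norm h"
        using norm_fst_le[of "fst h" "snd h"] norm_snd_le[of "snd h" "fst h"] by auto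
      have 1: "norm ((snd w) ^ i *\<^sub>R (fst h *\<^sub>R R' i (fst w))) \<le> C1 * (r / r') ^ i * norm h"
      proof -
        have "norm ((snd w) ^ i *\<^sub>R (fst h *\<^sub>R R' i (fst w))) = \<bar>snd w\<bar> ^ i * \<bar>fst h\<bar> * norm (R' i (fst w))"
          by (simp add: power_abs abs_mult)
        also have "\<dots> \<le> r ^ i * norm h * norm (R' i (fst w))"
          using w' h r0 by (intro mult_mono power_mono) auto
        also have "\<dots> = (norm (R' i (fst w)) * r' ^ i) * (r / r') ^ i * norm h"
          using r0 by (simp add: power_divide)
        also have "\<dots> \<le> C1 * (r / r') ^ i * norm h"
          using RC1[OF w'(1)] r0 by (intro mult_right_mono) auto
        finally show ?thesis .
      qed
      have 2: "norm ((real i * snd w ^ (i - 1) * snd h) *\<^sub>R R i (fst w))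
        \<le> C / \<rho> * (case i of 0 \<Rightarrow> 0 | Suc n \<Rightarrow> real (Suc n) * (r / \<rho>) ^ n) * norm h"
      proof (cases i)
        case (Suc n)
        have "norm ((real i * snd w ^ (i - 1) * snd h) *\<^sub>R R i (fst w))
            = real (Suc n) * \<bar>snd w\<bar> ^ n * \<bar>snd h\<bar> * norm (R i (fst w))"
          by (simp add: Suc abs_mult power_abs)
        also have "\<dots> \<le> real (Suc n) * r ^ n * norm h * norm (R i (fst w))"
          using w' h r0 by (intro mult_mono power_mono) auto
        also have "\<dots> = (norm (R i (fst w)) * \<rho> ^ i) / \<rho> * (real (Suc n) * (r / \<rho>) ^ n) * norm h"
          using r0 by (simp add: Suc power_divide del: of_nat_Suc)
        also have "\<dots> \<le> C / \<rho> * (real (Suc n) * (r / \<rho>) ^ n) * norm h"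
          using RC[OF w'(1)] r0 by (intro mult_right_mono divide_right_mono) auto
        finally show ?thesis by (simp add: Suc)
      qed simp
      show ?thesis
        using norm_triangle_le[OF add_mono[OF 1 2]] unfolding B_def by (simp add: distrib_right)
    qed
    show "summable (\<lambda>i. ?F i w)" if "w \<in> ?S" for w
      using that by (intro sum1) auto
    show "(s, v) \<in> ?S" using r by auto
  qed (auto intro: sB open_Times convex_Times)
  moreover have "(\<Sum>i. ?F' i (s,v) h) = fst h *\<^sub>R psum (ds a) s v + snd h *\<^sub>R psum (dv a) s v" for h
  proof -
    have sv: "\<bar>s\<bar> \<le> r" "\<bar>v\<bar> < r'" "\<bar>v\<bar> < r" "\<bar>s\<bar> < \<rho>" "\<bar>v\<bar> < \<rho>" using r r' by auto
    have s1: "summable (\<lambda>i. v ^ i *\<^sub>R R' i s)"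
      by (rule summable_norm_cancel[OF psum1_summable(1)[OF RC1]]) (use sv in auto)
    have e1: "(\<lambda>i. v ^ i *\<^sub>R (fst h *\<^sub>R R' i s)) = (\<lambda>i. fst h *\<^sub>R (v ^ i *\<^sub>R R' i s))"
      by (simp add: mult_ac)
    have t1: "(\<lambda>i. v ^ i *\<^sub>R (fst h *\<^sub>R R' i s)) sums (fst h *\<^sub>R psum (ds a) s v)"
    proof -
      have "psum (ds a) s v = (\<Sum>i. v ^ i *\<^sub>R R' i s)"
        by (simp add: psum_def psum1_def[of _ v] R'_def)
      then show ?thesis unfolding e1 using sums_scaleR_right[OF summable_sums[OF s1]] by simp
    qed
    have dR: "psum1 (dv a i) s = dseq (\<lambda>i. R i s) i" for i
    proof -
      have "summable (\<lambda>j. s ^ j *\<^sub>R a (Suc i) j)"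
        by (rule summable_norm_cancel[OF psum1_summable(1)[OF gbound_row[OF M r0(3)]]]) (rule sv)
      then have "real (Suc i) *\<^sub>R psum1 (a (Suc i)) s = (\<Sum>j. real (Suc i) *\<^sub>R (s ^ j *\<^sub>R a (Suc i) j))"
        unfolding psum1_def by (rule suminf_scaleR_right)
      then show ?thesis
        by (simp add: psum1_def dv_def dseq_def R_def mult_ac del: of_nat_Suc)
    qed
    have s2: "summable (\<lambda>i. v ^ i *\<^sub>R dseq (\<lambda>i. R i s) i)"
      by (rule summable_norm_cancel[OF psum1_summable(1)[OF dseq_bound[OF RC r0(2) r'(2)]]]) (use sv in auto)
    have e2: "(real (Suc i) * v ^ (Suc i - 1) * snd h) *\<^sub>R R (Suc i) s = snd h *\<^sub>R (v ^ i *\<^sub>R dseq (\<lambda>i. R i s) i)" for i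
      by (simp add: dseq_def mult_ac del: of_nat_Suc)
    have "(\<lambda>i. (real (Suc i) * v ^ (Suc i - 1) * snd h) *\<^sub>R R (Suc i) s) sums (snd h *\<^sub>R psum (dv a) s v)"
    proof -
      have "psum (dv a) s v = (\<Sum>i. v ^ i *\<^sub>R dseq (\<lambda>i. R i s) i)"
        by (simp add: psum_def psum1_def[of _ v] dR)
      then show ?thesis unfolding e2 using sums_scaleR_right[OF summable_sums[OF s2]] by simp
    qed
    then have t2: "(\<lambda>i. (real i * v ^ (i - 1) * snd h) *\<^sub>R R i s) sums (snd h *\<^sub>R psum (dv a) s v)"
      by (subst (asm) sums_Suc_iff) simp
    show ?thesis using sums_add[OF t1 t2] by (simp add: sums_iff)
  qed
  ultimately show ?thesis
    unfolding psum_def psum1_def[of "\<lambda>i. psum1 (a i) _"] R_def by simp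
qed

lemma psum1_0 [simp]: "psum1 c 0 = c 0"
proof -
  have "(\<lambda>j. (0::real) ^ j *\<^sub>R c j) = (\<lambda>j. if j = 0 then c j else 0)" by auto
  then show ?thesis
    unfolding psum1_def using suminf_finite[of "{0}" "\<lambda>j. if j = 0 then c j else 0"] by simp
qed

lemma psum_v0: "psum a s 0 = psum1 (a 0) s"
  by (simp add: psum_def)

lemma psum1_finite_row:
  assumes "\<And>j. j > 0 \<Longrightarrow> c j = 0"
  shows "psum1 c s = c 0"
proof -
  have "(\<lambda>j. s ^ j *\<^sub>R c j) = (\<lambda>j. if j = 0 then c 0 else 0)" using assms by fastforce
  then show ?thesis
    unfolding psum1_def using suminf_finite[of "{0}" "\<lambda>j. if j = 0 then c 0 else 0"] by simp
qed

text \<open>Scaling is done on the coefficients, so that a solution found in normalized variables is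
  again given by a double series.\<close>

lemma psum_scale:
  assumes "gbound a \<rho>" "\<bar>s / b\<bar> < \<rho>" "\<epsilon> \<noteq> 0"
  shows "psum (\<lambda>i j. (1 / (\<epsilon> ^ i * b ^ j)) *\<^sub>R a i j) s v = psum a (s / b) (v / \<epsilon>)"
proof -
  obtain M where M: "\<And>i j. norm (a i j) * \<rho> ^ (i + j) \<le> M" using assms(1) unfolding gbound_def by blast
  have \<rho>: "\<rho> > 0" using assms by linarith
  have "psum1 (\<lambda>j. (1 / (\<epsilon> ^ i * b ^ j)) *\<^sub>R a i j) s = (1 / \<epsilon> ^ i) *\<^sub>R psum1 (a i) (s / b)" for i
  proof -
    have "summable (\<lambda>j. (s / b) ^ j *\<^sub>R a i j)"
      by (rule summable_norm_cancel[OF psum1_summable(1)[OF gbound_row[OF M \<rho>] assms(2)]])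
    then show ?thesis
      unfolding psum1_def by (subst suminf_scaleR_right) (simp_all add: power_divide)
  qed
  then show ?thesis
    unfolding psum_def psum1_def[of _ v] psum1_def[of _ "v / \<epsilon>"] by (simp add: power_divide)
qed

lemma psum1_bounded_linear:
  fixes c :: "nat \<Rightarrow> 'a::banach"
  assumes c: "\<And>j. norm (c j) * \<rho> ^ j \<le> M" and s: "\<bar>s\<bar> < \<rho>" and L: "bounded_linear L"
  shows "L (psum1 c s) = psum1 (\<lambda>j. L (c j)) s"
  unfolding psum1_def
  by (subst bounded_linear.suminf[OF L summable_norm_cancel[OF psum1_summable(1)[OF c s]]])
     (simp add: linear_simps[OF L])

lemma psum_bounded_linear:
  fixes a :: "nat \<Rightarrow> nat \<Rightarrow> 'a::banach"
  assumes "gbound a \<rho>" "\<bar>s\<bar> < \<rho>" "\<bar>v\<bar> < \<rho>" and L: "bounded_linear L"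
  shows "L (psum a s v) = psum (\<lambda>i j. L (a i j)) s v"
proof -
  obtain M where M: "\<And>i j. norm (a i j) * \<rho> ^ (i + j) \<le> M" using assms(1) unfolding gbound_def by blast
  have \<rho>: "\<rho> > 0" using assms by linarith
  show ?thesis
    unfolding psum_def
    by (subst psum1_bounded_linear[OF psum_row_bound[OF M order.refl assms(2)] assms(3) L])
       (simp add: psum1_bounded_linear[OF gbound_row[OF M \<rho>] assms(2) L])
qed

lemma psum1_mult:
  fixes c d :: "nat \<Rightarrow> real"
  assumes c: "\<And>j. norm (c j) * \<rho> ^ j \<le> M" and d: "\<And>j. norm (d j) * \<rho> ^ j \<le> N" and s: "\<bar>s\<bar> < \<rho>"
  shows "(\<lambda>m. s ^ m *\<^sub>R (\<Sum>j\<le>m. c j * d (m - j))) sums (psum1 c s * psum1 d s)"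
proof -
  have "(\<lambda>m. \<Sum>j\<le>m. (s ^ j *\<^sub>R c j) * (s ^ (m - j) *\<^sub>R d (m - j))) sums (psum1 c s * psum1 d s)"
    unfolding psum1_def by (intro Cauchy_product_sums psum1_summable(1)[OF c s] psum1_summable(1)[OF d s])
  moreover have "(\<Sum>j\<le>m. (s ^ j *\<^sub>R c j) * (s ^ (m - j) *\<^sub>R d (m - j))) = s ^ m *\<^sub>R (\<Sum>j\<le>m. c j * d (m - j))" for m
  proof -
    have "(s ^ j *\<^sub>R c j) * (s ^ (m - j) *\<^sub>R d (m - j)) = s ^ m * (c j * d (m - j))" if "j \<le> m" for j
      using that power_add[of s j "m - j"] by simp
    then have "(\<Sum>j\<le>m. (s ^ j *\<^sub>R c j) * (s ^ (m - j) *\<^sub>R d (m - j))) = (\<Sum>j\<le>m. s ^ m * (c j * d (m - j)))"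
      by (intro sum.cong) auto
    then show ?thesis by (simp add: sum_distrib_left)
  qed
  ultimately show ?thesis by simp
qed

section \<open>Evaluation at a point as a homomorphism on the algebra\<close>

lemma norm_cf_bound: "norm (cf f i j) * (1/2) ^ (i + j) \<le> norm f"
  using abs_cf_le[of f i j] by (simp add: field_simps power_one_over)

context
  fixes s v :: real
  assumes sv: "\<bar>s\<bar> < 1/2" "\<bar>v\<bar> < 1/2"
begin

lemma cf_row_bound: "norm (cf f i j) * (1/2) ^ j \<le> norm f / (1/2) ^ i"
  by (rule gbound_row[OF norm_cf_bound]) simp

lemma cf_rows_bound: "norm (psum1 (cf f i) s) * (1/2) ^ i \<le> norm f * ((1/2) / (1/2 - \<bar>s\<bar>))"
  by (rule psum_row_bound[OF norm_cf_bound]) (use sv in auto)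

lemma cf_row_summable: "summable (\<lambda>j. s ^ j *\<^sub>R cf f i j)"
  by (rule summable_norm_cancel[OF psum1_summable(1)[OF cf_row_bound]]) (use sv in auto)

lemma cf_rows_summable: "summable (\<lambda>i. v ^ i *\<^sub>R psum1 (cf f i) s)"
  by (rule summable_norm_cancel[OF psum1_summable(1)[OF cf_rows_bound]]) (use sv in auto)

text \<open>The Cauchy product is used twice: in s for each pair of rows, then in v for the row
  sums.\<close>

lemma psum_cf_mult: "psum (cf (f * g)) s v = psum (cf f) s v * psum (cf g) s v"
proof -
  have row: "psum1 (cf (f * g) n) s = (\<Sum>i\<le>n. psum1 (cf f i) s * psum1 (cf g (n - i)) s)" for n
  proof -
    have "(\<lambda>m. \<Sum>i\<le>n. s ^ m *\<^sub>R (\<Sum>j\<le>m. cf f i j * cf g (n - i) (m - j)))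
        sums (\<Sum>i\<le>n. psum1 (cf f i) s * psum1 (cf g (n - i)) s)"
      by (intro sums_sum psum1_mult[OF cf_row_bound cf_row_bound sv(1)])
    moreover have "(\<Sum>i\<le>n. s ^ m *\<^sub>R (\<Sum>j\<le>m. cf f i j * cf g (n - i) (m - j))) = s ^ m *\<^sub>R cf (f * g) n m" for m
      by (simp add: cf_mult sum_distrib_left)
    ultimately show ?thesis by (simp add: psum1_def sums_iff)
  qed
  have "(\<lambda>n. v ^ n *\<^sub>R (\<Sum>i\<le>n. psum1 (cf f i) s * psum1 (cf g (n - i)) s))
      sums (psum1 (\<lambda>i. psum1 (cf f i) s) v * psum1 (\<lambda>i. psum1 (cf g i) s) v)"
    by (rule psum1_mult[OF cf_rows_bound cf_rows_bound sv(2)])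
  then show ?thesis
    unfolding row[symmetric] psum_def by (simp add: psum1_def[of _ v] sums_iff)
qed

lemma psum_cf_1: "psum (cf 1) s v = 1"
proof -
  have "psum1 (cf 1 i) s = (if i = 0 then 1 else 0)" for i
    by (subst psum1_finite_row) (auto simp: cf_1)
  then show ?thesis unfolding psum_def by (subst psum1_finite_row) auto
qed

lemma bounded_linear_psum_cf: "bounded_linear (\<lambda>f. psum (cf f) s v)"
proof (rule bounded_linear_intro)
  fix f g :: mseries and r :: real
  have r1: "psum1 (cf (f + g) i) s = psum1 (cf f i) s + psum1 (cf g i) s" for i
    using suminf_add[OF cf_row_summable[of f i] cf_row_summable[of g i]]
    by (simp add: psum1_def distrib_left)
  show "psum (cf (f + g)) s v = psum (cf f) s v + psum (cf g) s v"
    using suminf_add[OF cf_rows_summable[of f] cf_rows_summable[of g]]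
    unfolding psum_def r1 by (simp add: psum1_def[of _ v] distrib_left)
  have r2: "psum1 (cf (r *\<^sub>R f) i) s = r * psum1 (cf f i) s" for i
    using suminf_mult[OF cf_row_summable[of f i], of r]
    by (simp add: psum1_def mult_ac)
  show "psum (cf (r *\<^sub>R f)) s v = r *\<^sub>R psum (cf f) s v"
    using suminf_mult[OF cf_rows_summable[of f], of r]
    unfolding psum_def r2 by (simp add: psum1_def[of _ v] mult_ac)
  show "norm (psum (cf f) s v) \<le> norm f * ((1/2) / (1/2 - \<bar>s\<bar>) * ((1/2) / (1/2 - \<bar>v\<bar>)))"
    using psum1_summable(2)[OF cf_rows_bound[of f] sv(2)] by (simp add: psum_def mult_ac)
qed

end

section \<open>Local solutions of the first-order system\<close>

text \<open>Boundedness is included because a product of Lipschitz maps is Lipschitz only if the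
  factors are bounded. One constant serves for both conditions.\<close>

definition blip :: "'m::metric_space set \<Rightarrow> ('m \<Rightarrow> 'x::real_normed_vector) \<Rightarrow> bool" where
  "blip S f \<longleftrightarrow> (\<exists>K. (\<forall>w\<in>S. norm (f w) \<le> K) \<and> (\<forall>w\<in>S. \<forall>w'\<in>S. norm (f w - f w') \<le> K * dist w w'))"

lemma blipE:
  assumes "blip S f"
  obtains K where "K > 0" "\<And>w. w \<in> S \<Longrightarrow> norm (f w) \<le> K"
    "\<And>w w'. w \<in> S \<Longrightarrow> w' \<in> S \<Longrightarrow> norm (f w - f w') \<le> K * dist w w'"
proof -
  obtain K where K: "\<And>w. w \<in> S \<Longrightarrow> norm (f w) \<le> K"
    "\<And>w w'. w \<in> S \<Longrightarrow> w' \<in> S \<Longrightarrow> norm (f w - f w') \<le> K * dist w w'"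
    using assms unfolding blip_def by blast
  show ?thesis
  proof (rule that[of "max K 1"])
    show "norm (f w) \<le> max K 1" if "w \<in> S" for w using K(1)[OF that] by simp
    show "norm (f w - f w') \<le> max K 1 * dist w w'" if "w \<in> S" "w' \<in> S" for w w'
      using K(2)[OF that] mult_right_mono[of K "max K 1" "dist w w'"] by simp
  qed simp
qed

lemma blipI:
  assumes "\<And>w. w \<in> S \<Longrightarrow> norm (f w) \<le> K"
    "\<And>w w'. w \<in> S \<Longrightarrow> w' \<in> S \<Longrightarrow> norm (f w - f w') \<le> L * dist w w'"
  shows "blip S f"
  unfolding blip_def
proof (intro exI[of _ "max K L"] conjI ballI)
  show "norm (f w) \<le> max K L" if "w \<in> S" for w using assms(1)[OF that] by simp
  show "norm (f w - f w') \<le> max K L * dist w w'" if "w \<in> S" "w' \<in> S" for w w'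
    using assms(2)[OF that] mult_right_mono[of L "max K L" "dist w w'"] by simp
qed

lemma blip_const: "blip S (\<lambda>w. c)"
  by (rule blipI[where K = "norm c" and L = 0]) auto

lemma blip_bounded_linear:
  assumes "bounded S" "bounded_linear f"
  shows "blip S f"
proof -
  obtain M where M: "M > 0" "\<And>x. norm (f x) \<le> norm x * M"
    using bounded_linear.pos_bounded[OF assms(2)] by blast
  obtain B where B: "\<And>x. x \<in> S \<Longrightarrow> norm x \<le> B" using assms(1) unfolding bounded_iff by blast
  show ?thesis
  proof (rule blipI[where K = "B * M" and L = M])
    show "norm (f w) \<le> B * M" if "w \<in> S" for w
      using M(2)[of w] mult_right_mono[OF B[OF that], of M] M(1) by linarith
    show "norm (f w - f w') \<le> M * dist w w'" for w w'
      using M(2)[of "w - w'"] by (simp add: linear_simps[OF assms(2)] dist_norm mult.commute)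
  qed
qed

lemma blip_add:
  assumes "blip S f" "blip S g"
  shows "blip S (\<lambda>w. f w + g w)"
proof -
  obtain K L where K: "\<And>w. w \<in> S \<Longrightarrow> norm (f w) \<le> K"
    "\<And>w w'. w \<in> S \<Longrightarrow> w' \<in> S \<Longrightarrow> norm (f w - f w') \<le> K * dist w w'"
   and L: "\<And>w. w \<in> S \<Longrightarrow> norm (g w) \<le> L"
    "\<And>w w'. w \<in> S \<Longrightarrow> w' \<in> S \<Longrightarrow> norm (g w - g w') \<le> L * dist w w'"
    using assms unfolding blip_def by blast
  show ?thesis
  proof (rule blipI[where K = "K + L" and L = "K + L"])
    show "norm (f w + g w) \<le> K + L" if "w \<in> S" for w
      by (rule norm_triangle_le[OF add_mono[OF K(1) L(1)]]) (rule that)+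
    show "norm (f w + g w - (f w' + g w')) \<le> (K + L) * dist w w'" if "w \<in> S" "w' \<in> S" for w w'
      using norm_triangle_le[OF add_mono[OF K(2)[OF that] L(2)[OF that]]]
      by (simp add: algebra_simps)
  qed
qed

lemma blip_uminus: "blip S f \<Longrightarrow> blip S (\<lambda>w. - f w)"
  unfolding blip_def by (simp add: norm_minus_commute)

lemma blip_diff: "blip S f \<Longrightarrow> blip S g \<Longrightarrow> blip S (\<lambda>w. f w - g w)"
  using blip_add[OF _ blip_uminus, of S f g] by simp

lemma blip_mult:
  fixes f g :: "'m::metric_space \<Rightarrow> 'x::real_normed_algebra"
  assumes "blip S f" "blip S g"
  shows "blip S (\<lambda>w. f w * g w)"
proof -
  obtain K where K: "K > 0" "\<And>w. w \<in> S \<Longrightarrow> norm (f w) \<le> K"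
    "\<And>w w'. w \<in> S \<Longrightarrow> w' \<in> S \<Longrightarrow> norm (f w - f w') \<le> K * dist w w'"
    using blipE[OF assms(1)] by blast
  obtain L where L: "L > 0" "\<And>w. w \<in> S \<Longrightarrow> norm (g w) \<le> L"
    "\<And>w w'. w \<in> S \<Longrightarrow> w' \<in> S \<Longrightarrow> norm (g w - g w') \<le> L * dist w w'"
    using blipE[OF assms(2)] by blast
  show ?thesis
  proof (rule blipI[where K = "K * L" and L = "2 * K * L"])
    show "norm (f w * g w) \<le> K * L" if "w \<in> S" for w
      using K L that by (intro order_trans[OF norm_mult_ineq] mult_mono) auto
    show "norm (f w * g w - f w' * g w') \<le> 2 * K * L * dist w w'" if "w \<in> S" "w' \<in> S" for w w'
    proof -
      have "f w * g w - f w' * g w' = f w * (g w - g w') + (f w - f w') * g w'"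
        by (simp add: algebra_simps)
      then have "norm (f w * g w - f w' * g w') \<le> norm (f w) * norm (g w - g w') + norm (f w - f w') * norm (g w')"
        by (simp only:) (rule order_trans[OF norm_triangle_ineq add_mono[OF norm_mult_ineq norm_mult_ineq]])
      also have "\<dots> \<le> K * (L * dist w w') + (K * dist w w') * L"
        using K L that by (intro add_mono mult_mono) auto
      finally show ?thesis by (simp add: algebra_simps)
    qed
  qed
qed

lemma blip_Pair:
  assumes "blip S f" "blip S g"
  shows "blip S (\<lambda>w. (f w, g w))"
proof -
  obtain K L where K: "\<And>w. w \<in> S \<Longrightarrow> norm (f w) \<le> K"
    "\<And>w w'. w \<in> S \<Longrightarrow> w' \<in> S \<Longrightarrow> norm (f w - f w') \<le> K * dist w w'"
   and L: "\<And>w. w \<in> S \<Longrightarrow> norm (g w) \<le> L"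
    "\<And>w w'. w \<in> S \<Longrightarrow> w' \<in> S \<Longrightarrow> norm (g w - g w') \<le> L * dist w w'"
    using assms unfolding blip_def by blast
  show ?thesis
  proof (rule blipI[where K = "K + L" and L = "K + L"])
    show "norm (f w, g w) \<le> K + L" if "w \<in> S" for w
      by (rule order_trans[OF norm_Pair_le add_mono[OF K(1) L(1)]]) (rule that)+
    show "norm ((f w, g w) - (f w', g w')) \<le> (K + L) * dist w w'" if "w \<in> S" "w' \<in> S" for w w'
      using order_trans[OF norm_Pair_le add_mono[OF K(2)[OF that] L(2)[OF that]]]
      by (simp add: algebra_simps)
  qed
qed

text \<open>The unknown g is the v-derivative of the solution, \<open>\<Lambda>\<close> recovers the solution and its s-derivative from g, and
  \<open>\<epsilon>\<close> is a rescaling of v.\<close>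

lemma small_fixpoint:
  fixes F :: "'m::banach \<Rightarrow> 'n::banach"
  assumes r: "r > 0" and F: "blip (cball w0 r) F" and \<Lambda>: "bounded_linear \<Lambda>"
  shows "\<exists>\<epsilon>>0. \<exists>g. w0 + \<epsilon> *\<^sub>R \<Lambda> g \<in> cball w0 r \<and> g = F (w0 + \<epsilon> *\<^sub>R \<Lambda> g)"
proof -
  obtain K where K: "K > 0" "\<And>w. w \<in> cball w0 r \<Longrightarrow> norm (F w) \<le> K"
    "\<And>w w'. w \<in> cball w0 r \<Longrightarrow> w' \<in> cball w0 r \<Longrightarrow> norm (F w - F w') \<le> K * dist w w'"
    using blipE[OF F] by blast
  obtain M where M: "M > 0" "\<And>x. norm (\<Lambda> x) \<le> norm x * M"
    using bounded_linear.pos_bounded[OF \<Lambda>] by blast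
  \<comment> \<open>With \<open>norm g\<close> at most \<open>K\<close>, the first bound keeps the
    argument of \<open>F\<close> in the ball of radius \<open>r\<close>; the second makes the
    contraction constant 1/2.\<close>
  define \<epsilon> where "\<epsilon> = min (r / (K * M)) (1 / (2 * K * M))"
  have \<epsilon>: "\<epsilon> > 0" "\<epsilon> * (K * M) \<le> r" "K * (\<epsilon> * M) \<le> 1/2"
  proof -
    show "\<epsilon> > 0" using r K(1) M(1) by (simp add: \<epsilon>_def)
    have "\<epsilon> * (K * M) \<le> r / (K * M) * (K * M)"
      using K(1) M(1) by (intro mult_right_mono) (auto simp: \<epsilon>_def)
    then show "\<epsilon> * (K * M) \<le> r" using K(1) M(1) by simp
    have "\<epsilon> * (K * M) \<le> 1 / (2 * K * M) * (K * M)"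
      using K(1) M(1) by (intro mult_right_mono) (auto simp: \<epsilon>_def)
    then show "K * (\<epsilon> * M) \<le> 1/2" using K(1) M(1) by (simp add: mult_ac)
  qed
  have ball: "w0 + \<epsilon> *\<^sub>R \<Lambda> g \<in> cball w0 r" if "g \<in> cball 0 K" for g
  proof -
    have "norm (\<Lambda> g) \<le> K * M"
      using order_trans[OF M(2)[of g] mult_right_mono[of "norm g" K M]] that M(1) by simp
    then have "\<epsilon> * norm (\<Lambda> g) \<le> \<epsilon> * (K * M)" using \<epsilon>(1) by (intro mult_left_mono) auto
    also note \<epsilon>(2)
    finally show ?thesis using \<epsilon>(1) by (simp add: dist_norm)
  qed
  have "\<exists>!g\<in>cball 0 K. F (w0 + \<epsilon> *\<^sub>R \<Lambda> g) = g"
  proof (rule Banach_fix[where c = "1/2"])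
    show "complete (cball 0 K :: 'n set)" by (simp add: complete_eq_closed)
    show "cball 0 K \<noteq> ({} :: 'n set)" using K(1) by auto
    show "(\<lambda>g. F (w0 + \<epsilon> *\<^sub>R \<Lambda> g)) ` cball 0 K \<subseteq> cball 0 K"
      using K(2)[OF ball] by auto
    show "dist (F (w0 + \<epsilon> *\<^sub>R \<Lambda> g)) (F (w0 + \<epsilon> *\<^sub>R \<Lambda> h)) \<le> 1/2 * dist g h"
      if "g \<in> cball 0 K" "h \<in> cball 0 K" for g h
    proof -
      have "dist (F (w0 + \<epsilon> *\<^sub>R \<Lambda> g)) (F (w0 + \<epsilon> *\<^sub>R \<Lambda> h)) \<le> K * dist (w0 + \<epsilon> *\<^sub>R \<Lambda> g) (w0 + \<epsilon> *\<^sub>R \<Lambda> h)"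
        unfolding dist_norm[of "F _"] by (rule K(3)[OF ball ball]) (rule that)+
      also have "dist (w0 + \<epsilon> *\<^sub>R \<Lambda> g) (w0 + \<epsilon> *\<^sub>R \<Lambda> h) = \<epsilon> * norm (\<Lambda> (g - h))"
        using \<epsilon>(1) by (simp add: dist_norm linear_simps[OF \<Lambda>] flip: scaleR_diff_right)
      also have "K * (\<epsilon> * norm (\<Lambda> (g - h))) \<le> K * (\<epsilon> * (norm (g - h) * M))"
        using K(1) \<epsilon>(1) by (intro mult_left_mono M(2)) auto
      also have "\<dots> = (K * (\<epsilon> * M)) * dist g h" by (simp add: dist_norm)
      also have "\<dots> \<le> 1/2 * dist g h" using \<epsilon>(3) by (intro mult_right_mono) auto
      finally show ?thesis by simp
    qed
  qed auto
  then obtain g where "g \<in> cball 0 K" "F (w0 + \<epsilon> *\<^sub>R \<Lambda> g) = g" by (elim ex1E) auto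
  with \<epsilon>(1) ball[of g] show ?thesis by (intro exI[of _ \<epsilon>] conjI exI[of _ g]) auto
qed

section \<open>Quintuples over an algebra and the operator of the system\<close>

type_synonym 'x five = "'x \<times> 'x \<times> 'x \<times> 'x \<times> 'x"

definition c1 :: "'x five \<Rightarrow> 'x" where "c1 w = fst w"
definition c2 :: "'x five \<Rightarrow> 'x" where "c2 w = fst (snd w)"
definition c3 :: "'x five \<Rightarrow> 'x" where "c3 w = fst (snd (snd w))"
definition c4 :: "'x five \<Rightarrow> 'x" where "c4 w = fst (snd (snd (snd w)))"
definition c5 :: "'x five \<Rightarrow> 'x" where "c5 w = snd (snd (snd (snd w)))"

lemmas c_defs = c1_def c2_def c3_def c4_def c5_def

lemma bounded_linear_c:
  "bounded_linear (c1 :: 'x::real_normed_vector five \<Rightarrow> 'x)"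
  "bounded_linear (c2 :: 'x::real_normed_vector five \<Rightarrow> 'x)"
  "bounded_linear (c3 :: 'x::real_normed_vector five \<Rightarrow> 'x)"
  "bounded_linear (c4 :: 'x::real_normed_vector five \<Rightarrow> 'x)"
  "bounded_linear (c5 :: 'x::real_normed_vector five \<Rightarrow> 'x)"
  unfolding c_defs
  by (intro bounded_linear_fst bounded_linear_snd bounded_linear_ident
      bounded_linear_compose[OF bounded_linear_fst] bounded_linear_compose[OF bounded_linear_snd])+

lemma five_eqI:
  "c1 u = c1 w \<Longrightarrow> c2 u = c2 w \<Longrightarrow> c3 u = c3 w \<Longrightarrow> c4 u = c4 w \<Longrightarrow> c5 u = c5 w \<Longrightarrow> u = w"
  by (simp add: c_defs prod_eq_iff)

lemma c_tuple [simp]: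
  "c1 (x, y, z, p, q) = x" "c2 (x, y, z, p, q) = y" "c3 (x, y, z, p, q) = z"
  "c4 (x, y, z, p, q) = p" "c5 (x, y, z, p, q) = q"
  by (simp_all add: c_defs)

definition map5 :: "('x \<Rightarrow> 'y) \<Rightarrow> 'x five \<Rightarrow> 'y five" where
  "map5 f w = (f (c1 w), f (c2 w), f (c3 w), f (c4 w), f (c5 w))"

lemma c_map5 [simp]:
  "c1 (map5 f w) = f (c1 w)" "c2 (map5 f w) = f (c2 w)" "c3 (map5 f w) = f (c3 w)"
  "c4 (map5 f w) = f (c4 w)" "c5 (map5 f w) = f (c5 w)"
  by (simp_all add: map5_def)

lemma bounded_linear_map5:
  assumes "bounded_linear f"
  shows "bounded_linear (map5 f)"
  unfolding map5_def
  by (intro bounded_linear_Pair bounded_linear_compose[OF assms] bounded_linear_c)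

lemma c_linear [simp]:
  fixes u w :: "'x::real_vector five"
  shows "c1 (u + w) = c1 u + c1 w" "c2 (u + w) = c2 u + c2 w" "c3 (u + w) = c3 u + c3 w"
   "c4 (u + w) = c4 u + c4 w" "c5 (u + w) = c5 u + c5 w"
   "c1 (r *\<^sub>R u) = r *\<^sub>R c1 u" "c2 (r *\<^sub>R u) = r *\<^sub>R c2 u" "c3 (r *\<^sub>R u) = r *\<^sub>R c3 u"
   "c4 (r *\<^sub>R u) = r *\<^sub>R c4 u" "c5 (r *\<^sub>R u) = r *\<^sub>R c5 u"
   "c1 (0 :: 'x five) = 0" "c2 (0 :: 'x five) = 0" "c3 (0 :: 'x five) = 0"
   "c4 (0 :: 'x five) = 0" "c5 (0 :: 'x five) = 0"
  by (simp_all add: c_defs)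

text \<open>For real quintuples this is the inner product with \<open>b\<close>. The formula also
  makes sense for quintuples of series, and so supplies the family indexed by basis vectors that
  \<open>acomp\<close> expects.\<close>

definition lin5 :: "'x::real_vector five \<Rightarrow> real five \<Rightarrow> 'x" where
  "lin5 w b = c1 b *\<^sub>R c1 w + c2 b *\<^sub>R c2 w + c3 b *\<^sub>R c3 w + c4 b *\<^sub>R c4 w + c5 b *\<^sub>R c5 w"

lemma lin5_real: "lin5 u b = u \<bullet> b"
  by (simp add: lin5_def c_defs inner_prod_def mult.commute)

lemma lin5_map5: "bounded_linear f \<Longrightarrow> lin5 (map5 f w) b = f (lin5 w b)"
  by (simp add: lin5_def linear_simps)

lemma bounded_linear_lin5: "bounded_linear (\<lambda>w. lin5 w b)"
  unfolding lin5_def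
  by (intro bounded_linear_add bounded_linear_compose[OF bounded_linear_scaleR_right] bounded_linear_c)

lemma norm_c_le:
  fixes w :: "'x::real_normed_vector five"
  shows "norm (c1 w) \<le> norm w" "norm (c2 w) \<le> norm w" "norm (c3 w) \<le> norm w"
    "norm (c4 w) \<le> norm w" "norm (c5 w) \<le> norm w"
proof -
  obtain x y z p q where w: "w = (x, y, z, p, q)" by (metis surj_pair)
  have "norm x \<le> norm w" "norm (y, z, p, q) \<le> norm w" unfolding w by (rule norm_fst_le norm_snd_le)+
  moreover have "norm y \<le> norm (y, z, p, q)" "norm (z, p, q) \<le> norm (y, z, p, q)" by (rule norm_fst_le norm_snd_le)+
  moreover have "norm z \<le> norm (z, p, q)" "norm (p, q) \<le> norm (z, p, q)" by (rule norm_fst_le norm_snd_le)+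
  moreover have "norm p \<le> norm (p, q)" "norm q \<le> norm (p, q)" by (rule norm_fst_le norm_snd_le)+
  ultimately show "norm (c1 w) \<le> norm w" "norm (c2 w) \<le> norm w" "norm (c3 w) \<le> norm w"
    "norm (c4 w) \<le> norm w" "norm (c5 w) \<le> norm w"
    by (simp_all add: w)
qed

lemma norm_lin5_le:
  fixes w :: "'x::real_normed_vector five"
  assumes "b \<in> Basis"
  shows "norm (lin5 w b) \<le> norm w"
  using assms norm_c_le[of w] by (auto simp: Basis_prod_def lin5_def c_defs)

text \<open>The argument w is the s-derivative of u. Any commutative ring is allowed, since the system is used both for
  series and for their values.\<close>

definition ma_a :: "'x::comm_ring_1 \<Rightarrow> 'x \<Rightarrow> 'x five \<Rightarrow> 'x" where
  "ma_a B C w = c4 w + C * c1 w - B * c2 w"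

definition ma_b :: "'x::comm_ring_1 \<Rightarrow> 'x \<Rightarrow> 'x five \<Rightarrow> 'x" where
  "ma_b A B w = c5 w - B * c1 w + A * c2 w"

definition ma_rhs :: "'x::comm_ring_1 \<Rightarrow> 'x \<Rightarrow> 'x \<Rightarrow> 'x \<Rightarrow> 'x \<Rightarrow> 'x \<Rightarrow> 'x five \<Rightarrow> 'x five" where
  "ma_rhs A B C E p q w =
    (- ma_b A B w, ma_a B C w, q * ma_a B C w - p * ma_b A B w,
     C * ma_b A B w + B * ma_a B C w - (A * C - B * B + E) * c2 w,
     (A * C - B * B + E) * c1 w - B * ma_b A B w - A * ma_a B C w)"

text \<open>The four coefficient families stand for the expansions of A, B, C, E at one point, and
  \<open>u\<close> is the displacement from that point. Of the point itself only \<open>p0\<close>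
  and \<open>q0\<close> occur explicitly in the system.\<close>

definition ma_op :: "((real five \<Rightarrow> nat) \<Rightarrow> real) \<Rightarrow> ((real five \<Rightarrow> nat) \<Rightarrow> real) \<Rightarrow> ((real five \<Rightarrow> nat) \<Rightarrow> real) \<Rightarrow>
    ((real five \<Rightarrow> nat) \<Rightarrow> real) \<Rightarrow> real \<Rightarrow> real \<Rightarrow> 'x five \<Rightarrow> 'x five \<Rightarrow> 'x::{real_normed_algebra_1,comm_ring_1,banach} five" where
  "ma_op \<alpha> \<beta> \<kappa> \<eta> p0 q0 u w = ma_rhs (acomp \<alpha> (lin5 u)) (acomp \<beta> (lin5 u)) (acomp \<kappa> (lin5 u)) (acomp \<eta> (lin5 u))
     (p0 *\<^sub>R 1 + c4 u) (q0 *\<^sub>R 1 + c5 u) w"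

lemma blip_acomp:
  fixes S :: "('x::{real_normed_algebra_1,comm_ring_1,banach} five \<times> 'x five) set"
  assumes "acoeff a (2 * R)" "R > 0" "\<And>w. w \<in> S \<Longrightarrow> norm (fst w) \<le> R"
  shows "blip S (\<lambda>w. acomp a (lin5 (fst w)))"
proof (rule blipI)
  fix w assume "w \<in> S"
  show "norm (acomp a (lin5 (fst w))) \<le> (\<Sum>\<^sub>\<infinity>k\<in>multi_indices. \<bar>a k\<bar> * R ^ (\<Sum>b\<in>Basis. k b))"
  proof (rule norm_acomp_le)
    show "acoeff a R" using assms by (auto intro: acoeff_mono[OF assms(1)])
    show "norm (lin5 (fst w) b) \<le> R" if "b \<in> Basis" for b
      using norm_lin5_le[OF that, of "fst w"] assms(3)[OF \<open>w \<in> S\<close>] by linarith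
  qed
next
  fix w w' assume w: "w \<in> S" "w' \<in> S"
  show "norm (acomp a (lin5 (fst w)) - acomp a (lin5 (fst w')))
      \<le> (\<Sum>\<^sub>\<infinity>k\<in>multi_indices. \<bar>a k\<bar> * (2 * R) ^ (\<Sum>b\<in>Basis. k b)) / R * dist w w'"
  proof (rule acomp_diff_le[OF assms(1,2)])
    show "norm (lin5 (fst w) b) \<le> R" if "b \<in> Basis" for b
      using norm_lin5_le[OF that, of "fst w"] assms(3)[OF \<open>w \<in> S\<close>] by linarith
    show "norm (lin5 (fst w') b) \<le> R" if "b \<in> Basis" for b
      using norm_lin5_le[OF that, of "fst w'"] assms(3)[OF \<open>w' \<in> S\<close>] by linarith
    show "norm (lin5 (fst w) b - lin5 (fst w') b) \<le> dist w w'" if "b \<in> Basis" for b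
      using norm_lin5_le[OF that, of "fst w - fst w'"] dist_fst_le[of w w']
      by (simp add: linear_simps[OF bounded_linear_lin5] dist_norm)
  qed simp
qed

lemma blip_ma_op:
  fixes S :: "('x::{real_normed_algebra_1,comm_ring_1,banach} five \<times> 'x five) set"
  assumes a: "acoeff \<alpha> (2 * R)" "acoeff \<beta> (2 * R)" "acoeff \<kappa> (2 * R)" "acoeff \<eta> (2 * R)"
    and R: "R > 0" "\<And>w. w \<in> S \<Longrightarrow> norm (fst w) \<le> R" and S: "bounded S"
  shows "blip S (\<lambda>w. ma_op \<alpha> \<beta> \<kappa> \<eta> p0 q0 (fst w) (snd w))"
proof -
  note A = blip_acomp[OF a(1) R] blip_acomp[OF a(2) R] blip_acomp[OF a(3) R] blip_acomp[OF a(4) R]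
  have "blip S (\<lambda>w. c1 (snd w))" "blip S (\<lambda>w. c2 (snd w))" "blip S (\<lambda>w. c4 (snd w))" "blip S (\<lambda>w. c5 (snd w))"
     "blip S (\<lambda>w. c4 (fst w))" "blip S (\<lambda>w. c5 (fst w))"
    by (intro blip_bounded_linear[OF S] bounded_linear_compose[OF bounded_linear_c(1)]
        bounded_linear_compose[OF bounded_linear_c(2)] bounded_linear_compose[OF bounded_linear_c(4)]
        bounded_linear_compose[OF bounded_linear_c(5)] bounded_linear_fst bounded_linear_snd)+
  then show ?thesis
    unfolding ma_op_def ma_rhs_def ma_a_def ma_b_def
    by (intro blip_Pair blip_add blip_diff blip_uminus blip_mult blip_const A)
qed

text \<open>Every ingredient is a polynomial or a substituted power series, so a continuous
  homomorphism commutes with the whole operator.\<close>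

lemma ma_op_hom:
  fixes \<phi> :: "'x::{real_normed_algebra_1,comm_ring_1,banach} \<Rightarrow> 'y::{real_normed_algebra_1,comm_ring_1,banach}"
  assumes a: "acoeff \<alpha> R" "acoeff \<beta> R" "acoeff \<kappa> R" "acoeff \<eta> R"
    and R: "norm u \<le> R"
    and \<phi>: "bounded_linear \<phi>" and mult: "\<And>f g. \<phi> (f * g) = \<phi> f * \<phi> g" and one: "\<phi> 1 = 1"
  shows "map5 \<phi> (ma_op \<alpha> \<beta> \<kappa> \<eta> p0 q0 u w) = ma_op \<alpha> \<beta> \<kappa> \<eta> p0 q0 (map5 \<phi> u) (map5 \<phi> w)"
proof -
  have ac: "\<phi> (acomp a (lin5 u)) = acomp a (lin5 (map5 \<phi> u))" if "acoeff a R" for a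
  proof -
    have "\<phi> (acomp a (lin5 u)) = acomp a (\<lambda>b. \<phi> (lin5 u b))"
      by (rule acomp_hom[OF that _ \<phi> mult one]) (rule order_trans[OF norm_lin5_le R])
    then show ?thesis by (simp add: lin5_map5[OF \<phi>, symmetric])
  qed
  show ?thesis
    unfolding ma_op_def ma_rhs_def ma_a_def ma_b_def map5_def
    by (simp add: linear_simps[OF \<phi>] mult one ac[OF a(1)] ac[OF a(2)] ac[OF a(3)] ac[OF a(4)] map5_def[symmetric])
qed

lemma real_analytic_psum1:
  fixes c :: "real \<Rightarrow> 'b::banach"
  assumes "c real_analytic_on UNIV"
  obtains a \<rho> M where "\<rho> > 0" "\<And>j. norm (a j) * \<rho> ^ j \<le> M" "\<And>h. \<bar>h\<bar> < \<rho> \<Longrightarrow> c (s0 + h) = psum1 a h"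
proof -
  obtain A :: "(real \<Rightarrow> nat) \<Rightarrow> 'b" and r where r: "r > 0"
    and hs: "\<And>h. norm h < r \<Longrightarrow>
      ((\<lambda>k. (\<Prod>b\<in>Basis. (h \<bullet> b) ^ k b) *\<^sub>R A k) has_sum c (s0 + h)) (Basis \<rightarrow>\<^sub>E UNIV)"
    using assms unfolding real_analytic_on_def by blast
  \<comment> \<open>In dimension one a multi-index is a function on the basis {1}, extended by
    \<open>undefined\<close>; \<open>idx\<close> identifies these functions with the natural
    numbers.\<close>
  define idx :: "nat \<Rightarrow> real \<Rightarrow> nat" where "idx n = (\<lambda>x. if x = 1 then n else undefined)" for n
  have bij: "bij_betw idx UNIV ({1} \<rightarrow>\<^sub>E UNIV)"
    by (rule bij_betwI[where g = "\<lambda>k. k 1"]) (auto simp: idx_def PiE_def extensional_def fun_eq_iff)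
  define a where "a n = A (idx n)" for n
  have sums: "(\<lambda>n. h ^ n *\<^sub>R a n) sums c (s0 + h)" if "\<bar>h\<bar> < r" for h
  proof -
    have "((\<lambda>k. h ^ k 1 *\<^sub>R A k) has_sum c (s0 + h)) ({1} \<rightarrow>\<^sub>E UNIV)"
      using hs[of h] that by simp
    then have "((\<lambda>n. h ^ idx n 1 *\<^sub>R A (idx n)) has_sum c (s0 + h)) UNIV"
      by (subst has_sum_reindex_bij_betw[OF bij])
    then have "((\<lambda>n. h ^ n *\<^sub>R a n) has_sum c (s0 + h)) UNIV"
      by (simp add: idx_def a_def)
    then show ?thesis by (rule has_sum_imp_sums)
  qed
  have "(\<lambda>n. (r/2) ^ n *\<^sub>R a n) \<longlonglongrightarrow> 0"
    using sums[of "r/2"] r by (intro summable_LIMSEQ_zero) (auto simp: sums_iff)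
  then have "Bseq (\<lambda>n. (r/2) ^ n *\<^sub>R a n)" by (intro convergent_imp_Bseq convergentI)
  then obtain M where M: "\<And>n. norm ((r/2) ^ n *\<^sub>R a n) \<le> M" unfolding Bseq_def by blast
  show ?thesis
  proof (rule that[of "r/2" a M])
    show "norm (a j) * (r/2) ^ j \<le> M" for j using M[of j] r by (simp add: mult.commute)
    show "c (s0 + h) = psum1 a h" if "\<bar>h\<bar> < r / 2" for h
      using sums[of h] that r by (simp add: psum1_def sums_iff)
  qed (use r in simp)
qed

lemma geometric_sum_le:
  fixes q :: real
  assumes "0 \<le> q" "q \<le> 1/2"
  shows "(\<Sum>j\<le>N. q ^ j) \<le> 2"
proof -
  have "(\<Sum>j\<le>N. q ^ j) \<le> (\<Sum>j. q ^ j)"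
    using assms by (intro sum_le_suminf summable_geometric) auto
  also have "\<dots> = 1 / (1 - q)" using assms by (intro suminf_geometric) auto
  also have "\<dots> \<le> 2" using assms by (simp add: field_simps)
  finally show ?thesis .
qed

text \<open>Without its constant term the rescaled Taylor series is O(b), so the initial data can be
  made small in norm by the choice of \<open>b\<close>. The series \<open>f'\<close> of the unscaled
  derivative only has to lie in the algebra; its size is harmless.\<close>

lemma ex_mseries_initial:
  fixes a :: "nat \<Rightarrow> real"
  assumes a: "\<And>j. \<bar>a j\<bar> * \<rho> ^ j \<le> M" and b: "0 < b" "4 * b \<le> \<rho>"
  shows "\<exists>f f'. cf f = (\<lambda>i j. if i = 0 \<and> j > 0 then a j * b ^ j else 0) \<and> norm f \<le> 2 * M / \<rho> * b
    \<and> cf f' = (\<lambda>i j. if i = 0 then dseq a j * b ^ j else 0)"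
proof -
  have \<rho>: "\<rho> > 0" using b by linarith
  have M: "M \<ge> 0" using order_trans[OF _ a[of 0]] by simp
  have le1: "(\<Sum>j\<le>N. \<bar>if j > 0 then a j * b ^ j else 0\<bar>) \<le> 2 * M / \<rho> * b" for N
  proof -
    define h where "h j = \<bar>if j > 0 then a j * b ^ j else 0\<bar>" for j
    have "(\<Sum>j\<le>N. h j) \<le> (\<Sum>j\<le>N. M * (b / \<rho>) * (b / \<rho>) ^ j)"
    proof (rule sum_atMost_shift_le)
      fix j
      have "h (Suc j) = (\<bar>a (Suc j)\<bar> * \<rho> ^ Suc j) * (b / \<rho>) ^ Suc j"
        using b \<rho> by (simp add: h_def power_divide abs_mult)
      also have "\<dots> \<le> M * (b / \<rho>) ^ Suc j" using b \<rho> by (intro mult_right_mono a) auto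
      finally show "h (Suc j) \<le> M * (b / \<rho>) * (b / \<rho>) ^ j" by (simp add: mult_ac)
    qed (use b \<rho> M in \<open>auto simp: h_def\<close>)
    also have "\<dots> = M * (b / \<rho>) * (\<Sum>j\<le>N. (b / \<rho>) ^ j)" by (simp add: sum_distrib_left)
    also have "\<dots> \<le> M * (b / \<rho>) * 2"
      using b \<rho> M by (intro mult_left_mono geometric_sum_le) (auto simp: field_simps)
    finally show ?thesis by (simp add: h_def mult_ac)
  qed
  \<comment> \<open>The derivative is bounded on radius \<rho> / 2, and
    \<open>4 * b \<le> \<rho>\<close> is what leaves the ratio 1/2 there.\<close>
  define M' where "M' = M / \<rho> * (1 / (1 - (\<rho>/2) / \<rho>)\<^sup>2)"
  have da: "norm (dseq a j) * (\<rho>/2) ^ j \<le> M'" for j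
    unfolding M'_def by (rule dseq_bound) (use a \<rho> in auto)
  have M': "M' \<ge> 0" using order_trans[OF _ da[of 0]] by simp
  have le2: "(\<Sum>j\<le>N. \<bar>dseq a j * b ^ j\<bar>) \<le> M' * 2" for N
  proof -
    have "\<bar>dseq a j * b ^ j\<bar> \<le> M' * (b / (\<rho>/2)) ^ j" for j
    proof -
      have "\<bar>dseq a j * b ^ j\<bar> = (norm (dseq a j) * (\<rho>/2) ^ j) * (b / (\<rho>/2)) ^ j"
        using b \<rho> by (simp add: power_divide abs_mult)
      also have "\<dots> \<le> M' * (b / (\<rho>/2)) ^ j" using b \<rho> by (intro mult_right_mono da) auto
      finally show ?thesis .
    qed
    then have "(\<Sum>j\<le>N. \<bar>dseq a j * b ^ j\<bar>) \<le> M' * (\<Sum>j\<le>N. (b / (\<rho>/2)) ^ j)"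
      by (simp add: sum_distrib_left sum_mono)
    also have "\<dots> \<le> M' * 2"
      using b \<rho> M' by (intro mult_left_mono geometric_sum_le) (auto simp: field_simps)
    finally show ?thesis .
  qed
  from ex_mseries_row[OF le1] obtain f where f:
    "cf f = (\<lambda>i j. if i = 0 then if j > 0 then a j * b ^ j else 0 else 0)" "norm f \<le> 2 * M / \<rho> * b" by blast
  from ex_mseries_row[OF le2] obtain f' where f': "cf f' = (\<lambda>i j. if i = 0 then dseq a j * b ^ j else 0)" by blast
  have "cf f = (\<lambda>i j. if i = 0 \<and> j > 0 then a j * b ^ j else 0)" unfolding f(1) by (auto simp: fun_eq_iff)
  with f f' show ?thesis by blast
qed

section \<open>Existence of local solutions\<close>

locale monge_ampere_data =
  fixes U :: "real five set" and A B C E :: "real five \<Rightarrow> real" and c :: "real \<Rightarrow> real \<times> real"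
  assumes open_U: "open U"
    and analytic: "A real_analytic_on U" "B real_analytic_on U" "C real_analytic_on U" "E real_analytic_on U"
    and analytic_c: "c real_analytic_on UNIV"
    and c_in_U: "\<And>s. (0, 0, 0, c s) \<in> U"
begin

definition rhs :: "real five \<Rightarrow> real five \<Rightarrow> real five" where
  "rhs u w = ma_rhs (A u) (B u) (C u) (E u) (c4 u) (c5 u) w"

text \<open>Here t = s - s0. The coefficients are bounded on twice the radius of validity, so that
  first and second derivatives still converge on the region where the system is asserted.\<close>

definition local_sol :: "real \<Rightarrow> real \<Rightarrow> (nat \<Rightarrow> nat \<Rightarrow> real five) \<Rightarrow> bool" where
  "local_sol s0 \<delta> a \<longleftrightarrow> \<delta> > 0 \<and> gbound a (2 * \<delta>) \<and>
     (\<forall>t v. \<bar>t\<bar> < \<delta> \<longrightarrow> \<bar>v\<bar> < \<delta> \<longrightarrow> psum a t v \<in> U \<and>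
        psum (dv a) t v = rhs (psum a t v) (psum (ds a) t v)) \<and>
     (\<forall>t. \<bar>t\<bar> < \<delta> \<longrightarrow> psum a t 0 = (0, 0, 0, c (s0 + t)))"

lemma local_expansion:
  assumes "P0 \<in> U"
  obtains R \<alpha> \<beta> \<kappa> \<eta> where "R > 0"
    "acoeff \<alpha> (2 * R)" "acoeff \<beta> (2 * R)" "acoeff \<kappa> (2 * R)" "acoeff \<eta> (2 * R)"
    "\<And>u w. norm u \<le> R \<Longrightarrow> P0 + u \<in> U \<and> rhs (P0 + u) w = ma_op \<alpha> \<beta> \<kappa> \<eta> (c4 P0) (c5 P0) u w"
proof -
  obtain \<alpha> Ra where a: "Ra > 0" "acoeff \<alpha> Ra"
    "\<And>h. (\<And>b. b \<in> Basis \<Longrightarrow> \<bar>h \<bullet> b\<bar> \<le> Ra) \<Longrightarrow> A (P0 + h) = acomp \<alpha> (\<lambda>b. h \<bullet> b)"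
    using real_analytic_acomp[OF analytic(1) assms] by metis
  obtain \<beta> Rb where b: "Rb > 0" "acoeff \<beta> Rb"
    "\<And>h. (\<And>b. b \<in> Basis \<Longrightarrow> \<bar>h \<bullet> b\<bar> \<le> Rb) \<Longrightarrow> B (P0 + h) = acomp \<beta> (\<lambda>b. h \<bullet> b)"
    using real_analytic_acomp[OF analytic(2) assms] by metis
  obtain \<kappa> Rc where k: "Rc > 0" "acoeff \<kappa> Rc"
    "\<And>h. (\<And>b. b \<in> Basis \<Longrightarrow> \<bar>h \<bullet> b\<bar> \<le> Rc) \<Longrightarrow> C (P0 + h) = acomp \<kappa> (\<lambda>b. h \<bullet> b)"
    using real_analytic_acomp[OF analytic(3) assms] by metis
  obtain \<eta> Re where e: "Re > 0" "acoeff \<eta> Re"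
    "\<And>h. (\<And>b. b \<in> Basis \<Longrightarrow> \<bar>h \<bullet> b\<bar> \<le> Re) \<Longrightarrow> E (P0 + h) = acomp \<eta> (\<lambda>b. h \<bullet> b)"
    using real_analytic_acomp[OF analytic(4) assms] by metis
  obtain \<epsilon> where eps: "\<epsilon> > 0" "ball P0 \<epsilon> \<subseteq> U"
    using open_U assms openE by blast
  define m where "m = min (min Ra Rb) (min (min Rc Re) \<epsilon>)"
  \<comment> \<open>Half of the common radius, because the Lipschitz estimate
    \<open>acomp_diff_le\<close> needs convergence at \<open>2 * R\<close>.\<close>
  define R where "R = m / 2"
  have m: "m > 0" "m \<le> Ra" "m \<le> Rb" "m \<le> Rc" "m \<le> Re" "m \<le> \<epsilon>"
    using a b k e eps by (auto simp: m_def)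
  have R: "R > 0" "2 * R \<le> Ra" "2 * R \<le> Rb" "2 * R \<le> Rc" "2 * R \<le> Re" "R < \<epsilon>"
    using m by (auto simp: R_def)
  show ?thesis
  proof (rule that[of R \<alpha> \<beta> \<kappa> \<eta>])
    fix u w :: "real five" assume u: "norm u \<le> R"
    have comp: "\<bar>u \<bullet> b\<bar> \<le> R" if "b \<in> Basis" for b
      using Basis_le_norm[OF that, of u] u by linarith
    have "P0 + u \<in> ball P0 \<epsilon>" using u R by (simp add: dist_norm)
    moreover have "A (P0 + u) = acomp \<alpha> (lin5 u)"
      using a(3)[of u] comp R by (force simp: lin5_real[abs_def])
    moreover have "B (P0 + u) = acomp \<beta> (lin5 u)"
      using b(3)[of u] comp R by (force simp: lin5_real[abs_def])
    moreover have "C (P0 + u) = acomp \<kappa> (lin5 u)"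
      using k(3)[of u] comp R by (force simp: lin5_real[abs_def])
    moreover have "E (P0 + u) = acomp \<eta> (lin5 u)"
      using e(3)[of u] comp R by (force simp: lin5_real[abs_def])
    ultimately show "P0 + u \<in> U \<and> rhs (P0 + u) w = ma_op \<alpha> \<beta> \<kappa> \<eta> (c4 P0) (c5 P0) u w"
      using eps(2) by (auto simp: rhs_def ma_op_def)
  qed (use R a b k e in \<open>auto intro: acoeff_mono\<close>)
qed

text \<open>The variable s is scaled by \<open>b\<close> so that the initial curve stays near
  \<open>c s0\<close> in the norm of the algebra, and v by \<epsilon> so that the fixed-point map
  contracts. Evaluation of the resulting series at (t / b, v / \<epsilon>) is a homomorphism and
  yields genuine functions.\<close>

lemma ex_local_sol: "\<exists>\<delta> a. local_sol s0 \<delta> a"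
proof -
  define P0 where "P0 = (0::real, 0::real, 0::real, c s0)"
  have "P0 \<in> U" using c_in_U by (simp add: P0_def)
  obtain R \<alpha> \<beta> \<kappa> \<eta> where R: "R > 0" and
    ac: "acoeff \<alpha> (2 * R)" "acoeff \<beta> (2 * R)" "acoeff \<kappa> (2 * R)" "acoeff \<eta> (2 * R)" and
    exp: "\<And>u w. norm u \<le> R \<Longrightarrow> P0 + u \<in> U \<and> rhs (P0 + u) w = ma_op \<alpha> \<beta> \<kappa> \<eta> (c4 P0) (c5 P0) u w"
    using local_expansion[OF \<open>P0 \<in> U\<close>] by metis
  have acR: "acoeff \<alpha> R" "acoeff \<beta> R" "acoeff \<kappa> R" "acoeff \<eta> R"
    using R by (auto intro: acoeff_mono[OF ac(1)] acoeff_mono[OF ac(2)] acoeff_mono[OF ac(3)] acoeff_mono[OF ac(4)])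
  obtain cc :: "nat \<Rightarrow> real \<times> real" and \<rho> M where \<rho>: "\<rho> > 0" and cc: "\<And>j. norm (cc j) * \<rho> ^ j \<le> M"
    and ccs: "\<And>h. \<bar>h\<bar> < \<rho> \<Longrightarrow> c (s0 + h) = psum1 cc h"
    using real_analytic_psum1[OF analytic_c] by metis
  have M: "M \<ge> 0" using order_trans[OF _ cc[of 0]] by simp
  \<comment> \<open>The first bound gives the geometric ratio needed in
    \<open>ex_mseries_initial\<close>. The second makes the norms of \<open>p\<close> and
    \<open>q\<close> at most R / 4 each, so that the ball of radius R / 2 about \<open>u0\<close>
    stays within norm \<open>R\<close>; \<open>M + 1\<close> guards against M = 0.\<close>
  define b where "b = min (\<rho> / 4) (R * \<rho> / (8 * (M + 1)))"
  have b: "b > 0" "4 * b \<le> \<rho>" using \<rho> R M by (auto simp: b_def)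
  have bR: "2 * M / \<rho> * b \<le> R / 4"
  proof -
    have "2 * M / \<rho> * b \<le> 2 * (M + 1) / \<rho> * (R * \<rho> / (8 * (M + 1)))"
      using \<rho> R M b by (intro mult_mono divide_right_mono) (auto simp: b_def)
    also have "\<dots> = R / 4"
    proof -
      have "2 * N / \<rho> * (R * \<rho> / (8 * N)) = R / 4" if "N \<noteq> 0" for N
        using \<rho> that by (simp add: field_simps)
      moreover have "M + 1 \<noteq> 0" using M by linarith
      ultimately show ?thesis by blast
    qed
    finally show ?thesis .
  qed
  have ccf: "\<bar>fst (cc j)\<bar> * \<rho> ^ j \<le> M" "\<bar>snd (cc j)\<bar> * \<rho> ^ j \<le> M" for j
  proof -
    have "\<bar>fst (cc j)\<bar> \<le> norm (cc j)" "\<bar>snd (cc j)\<bar> \<le> norm (cc j)"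
      using norm_fst_le[of "fst (cc j)" "snd (cc j)"] norm_snd_le[of "snd (cc j)" "fst (cc j)"] by auto
    then show "\<bar>fst (cc j)\<bar> * \<rho> ^ j \<le> M" "\<bar>snd (cc j)\<bar> * \<rho> ^ j \<le> M"
      using mult_right_mono[of _ "norm (cc j)" "\<rho> ^ j"] cc[of j] \<rho> by (meson order_trans zero_le_power less_imp_le)+
  qed
  obtain p p' where p: "cf p = (\<lambda>i j. if i = 0 \<and> j > 0 then fst (cc j) * b ^ j else 0)" "norm p \<le> 2 * M / \<rho> * b"
    "cf p' = (\<lambda>i j. if i = 0 then dseq (\<lambda>j. fst (cc j)) j * b ^ j else 0)"
    using ex_mseries_initial[where a = "\<lambda>j. fst (cc j)", OF ccf(1) b] by blast
  obtain q q' where q: "cf q = (\<lambda>i j. if i = 0 \<and> j > 0 then snd (cc j) * b ^ j else 0)" "norm q \<le> 2 * M / \<rho> * b"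
    "cf q' = (\<lambda>i j. if i = 0 then dseq (\<lambda>j. snd (cc j)) j * b ^ j else 0)"
    using ex_mseries_initial[where a = "\<lambda>j. snd (cc j)", OF ccf(2) b] by blast
  \<comment> \<open>These are the displacement of the initial curve from \<open>P0\<close>, and its
    s-derivative.\<close>
  define u0 :: "mseries five" where "u0 = (0, 0, 0, p, q)"
  define u0' :: "mseries five" where "u0' = (0, 0, 0, p', q')"
  \<comment> \<open>The factor 1 / b converts differentiation in the scaled variable into
    differentiation in s.\<close>
  define \<Lambda> :: "mseries five \<Rightarrow> mseries five \<times> mseries five" where
    "\<Lambda> g = (map5 ms_int g, (1/b) *\<^sub>R map5 ms_dint g)" for g
  have \<Lambda>: "bounded_linear \<Lambda>"
    unfolding \<Lambda>_def
    by (intro bounded_linear_Pair bounded_linear_compose[OF bounded_linear_scaleR_right]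
        bounded_linear_map5 bounded_linear_ms_int bounded_linear_ms_dint)
  define S where "S = cball (u0, u0') (R / 2)"
  have nu0: "norm u0 \<le> R / 2"
  proof -
    have "norm u0 \<le> norm (0::mseries) + (norm (0::mseries) + (norm (0::mseries) + (norm p + norm q)))"
      unfolding u0_def by (intro order_trans[OF norm_Pair_le] add_left_mono norm_Pair_le)
    then show ?thesis using p(2) q(2) bR by simp
  qed
  have fstS: "norm (fst w) \<le> R" if "w \<in> S" for w
  proof -
    have "dist u0 (fst w) \<le> R / 2"
      using dist_fst_le[of "(u0, u0')" w] that by (simp add: S_def)
    then show ?thesis using nu0 norm_triangle_sub[of "fst w" u0]
      by (simp add: dist_norm norm_minus_commute)
  qed
  let ?F = "\<lambda>w. ma_op \<alpha> \<beta> \<kappa> \<eta> (c4 P0) (c5 P0) (fst w) (snd w) :: mseries five"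
  have "blip S ?F"
    by (rule blip_ma_op[OF ac R fstS]) (auto simp: S_def)
  then obtain \<epsilon> g where eps: "\<epsilon> > 0" and "g = ?F ((u0, u0') + \<epsilon> *\<^sub>R \<Lambda> g)" and inS: "(u0, u0') + \<epsilon> *\<^sub>R \<Lambda> g \<in> S"
    using small_fixpoint[of "R/2" "(u0, u0')" ?F, OF _ _ \<Lambda>] R unfolding S_def by auto
  define u where "u = u0 + \<epsilon> *\<^sub>R map5 ms_int g"
  define u' where "u' = u0' + (\<epsilon> / b) *\<^sub>R map5 ms_dint g"
  have g: "g = ma_op \<alpha> \<beta> \<kappa> \<eta> (c4 P0) (c5 P0) u u'"
    using \<open>g = _\<close> by (simp add: \<Lambda>_def u_def u'_def)
  have nu: "norm u \<le> R" using fstS[OF inS] by (simp add: \<Lambda>_def u_def)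
  define CF :: "mseries five \<Rightarrow> nat \<Rightarrow> nat \<Rightarrow> real five" where "CF w i j = map5 (\<lambda>f. cf f i j) w" for w i j
  define scl :: "(nat \<Rightarrow> nat \<Rightarrow> real five) \<Rightarrow> nat \<Rightarrow> nat \<Rightarrow> real five" where
    "scl a i j = (1 / (\<epsilon> ^ i * b ^ j)) *\<^sub>R a i j" for a i j
  \<comment> \<open>Adding \<open>K\<close> restores the constant term \<open>c s0\<close>, which
    \<open>u\<close> lacks as a displacement from \<open>P0\<close>.\<close>
  define K :: "mseries five" where "K = (0, 0, 0, fst (c s0) *\<^sub>R 1, snd (c s0) *\<^sub>R 1)"
  define a where "a = scl (CF (u + K))"
  \<comment> \<open>This comparison of coefficients and the next one show that \<open>u'\<close> and
    \<open>g\<close> really are the s- and v-derivatives of the solution. So far they were tied to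
    \<open>u\<close> only through the two integration operators.\<close>
  have ds_a: "ds a = scl (CF u')"
  proof (intro ext five_eqI)
    fix i j
    note simps = ds_def dseq_def a_def scl_def CF_def K_def cf_1 u_def u'_def u0_def u0'_def
        cf_ms_int cf_ms_dint p q
    show "c1 (ds a i j) = c1 (scl (CF u') i j)" "c2 (ds a i j) = c2 (scl (CF u') i j)"
      "c3 (ds a i j) = c3 (scl (CF u') i j)" "c4 (ds a i j) = c4 (scl (CF u') i j)"
      "c5 (ds a i j) = c5 (scl (CF u') i j)"
      using b(1) eps by (simp_all add: simps field_simps del: of_nat_Suc)
  qed
  have dv_a: "dv a = scl (CF g)"
  proof (intro ext five_eqI)
    fix i j
    note simps = dv_def a_def scl_def CF_def K_def cf_1 u_def u0_def cf_ms_int p q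
    show "c1 (dv a i j) = c1 (scl (CF g) i j)" "c2 (dv a i j) = c2 (scl (CF g) i j)"
      "c3 (dv a i j) = c3 (scl (CF g) i j)" "c4 (dv a i j) = c4 (scl (CF g) i j)"
      "c5 (dv a i j) = c5 (scl (CF g) i j)"
      using b(1) eps by (simp_all add: simps field_simps del: of_nat_Suc)
  qed
  have gCF: "gbound (CF w) (1/2)" for w
  proof -
    have le: "norm (CF w i j) * (1/2) ^ (i + j)
        \<le> norm (c1 w) + (norm (c2 w) + (norm (c3 w) + (norm (c4 w) + norm (c5 w))))" for i j
    proof -
      have "norm (CF w i j) \<le> norm (cf (c1 w) i j) + (norm (cf (c2 w) i j) + (norm (cf (c3 w) i j)
          + (norm (cf (c4 w) i j) + norm (cf (c5 w) i j))))"
        unfolding CF_def map5_def by (intro order_trans[OF norm_Pair_le] add_left_mono norm_Pair_le)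
      then have "norm (CF w i j) * (1/2) ^ (i + j) \<le> (norm (cf (c1 w) i j) + (norm (cf (c2 w) i j) + (norm (cf (c3 w) i j)
          + (norm (cf (c4 w) i j) + norm (cf (c5 w) i j))))) * (1/2) ^ (i + j)"
        by (rule mult_right_mono) simp
      also have "\<dots> \<le> norm (c1 w) + (norm (c2 w) + (norm (c3 w) + (norm (c4 w) + norm (c5 w))))"
        unfolding distrib_right by (intro add_mono norm_cf_bound)
      finally show ?thesis .
    qed
    then show ?thesis unfolding gbound_def by blast
  qed
  \<comment> \<open>Evaluation requires t / b and v / \<epsilon> to be smaller than 1/2 in
    modulus.\<close>
  define \<rho>1 where "\<rho>1 = min \<epsilon> b / 2"
  have \<rho>1: "\<rho>1 > 0" "\<rho>1 \<le> \<epsilon> / 2" "\<rho>1 \<le> b / 2" using eps b by (auto simp: \<rho>1_def)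
  have gscl: "gbound (scl (CF w)) \<rho>1" for w
  proof -
    obtain N where N: "\<And>i j. norm (CF w i j) * (1/2) ^ (i + j) \<le> N" using gCF unfolding gbound_def by blast
    have "norm (scl (CF w) i j) * \<rho>1 ^ (i + j) \<le> N" for i j
    proof -
      have "\<rho>1 ^ (i + j) \<le> (\<epsilon> / 2) ^ i * (b / 2) ^ j"
        unfolding power_add using \<rho>1 eps b by (intro mult_mono power_mono) auto
      then have "norm (scl (CF w) i j) * \<rho>1 ^ (i + j) \<le> norm (scl (CF w) i j) * ((\<epsilon> / 2) ^ i * (b / 2) ^ j)"
        by (rule mult_left_mono) simp
      also have "\<dots> = norm (CF w i j) * (1/2) ^ (i + j)"
        using eps b(1) by (simp add: scl_def power_divide power_add)
      finally show ?thesis using N[of i j] by linarith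
    qed
    then show ?thesis unfolding gbound_def by blast
  qed
  define ev where "ev t v f = psum (cf f) (t / b) (v / \<epsilon>)" for t v f
  have small: "\<bar>t / b\<bar> < 1/2" "\<bar>v / \<epsilon>\<bar> < 1/2" if "\<bar>t\<bar> < \<rho>1" "\<bar>v\<bar> < \<rho>1" for t v
    using that \<rho>1 eps b(1) by (auto simp: field_simps abs_less_iff)
  have ev_scl: "psum (scl (CF w)) t v = map5 (ev t v) w" if tv: "\<bar>t\<bar> < \<rho>1" "\<bar>v\<bar> < \<rho>1" for t v w
  proof -
    note sm = small[OF tv]
    have e: "psum (scl (CF w)) t v = psum (CF w) (t / b) (v / \<epsilon>)"
      unfolding scl_def[abs_def] by (rule psum_scale[OF gCF sm(1)]) (use eps in simp)
    show ?thesis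
      unfolding e ev_def
      by (intro five_eqI; subst psum_bounded_linear[OF gCF sm]; (rule bounded_linear_c)?)
         (simp_all add: CF_def)
  qed
  have ev_lin: "bounded_linear (ev t v)" and ev_mult: "ev t v (f * h) = ev t v f * ev t v h" and ev_1: "ev t v 1 = 1"
    if tv: "\<bar>t\<bar> < \<rho>1" "\<bar>v\<bar> < \<rho>1" for t v f h
    unfolding ev_def[abs_def]
    by (rule bounded_linear_psum_cf[OF small[OF tv]] psum_cf_mult[OF small[OF tv]] psum_cf_1[OF small[OF tv]])+
  have psum_a: "psum a t v = P0 + map5 (ev t v) u" if tv: "\<bar>t\<bar> < \<rho>1" "\<bar>v\<bar> < \<rho>1" for t v
  proof -
    have "c1 P0 = 0" "c2 P0 = 0" "c3 P0 = 0" "c4 P0 = fst (c s0)" "c5 P0 = snd (c s0)"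
      by (simp_all add: P0_def c_defs)
    then show ?thesis
      unfolding a_def ev_scl[OF tv]
      by (intro five_eqI) (simp_all add: linear_simps[OF ev_lin[OF tv]] K_def ev_1[OF tv])
  qed
  have c_quad: "c1 (0, 0, 0, r) = 0" "c2 (0, 0, 0, r) = 0" "c3 (0, 0, 0, r) = 0" "c4 (0, 0, 0, r) = fst r"
    "c5 (0, 0, 0, r) = snd r" for r :: "real \<times> real"
    by (simp_all add: c_defs)
  have init: "psum a t 0 = (0, 0, 0, c (s0 + t))" if "\<bar>t\<bar> < \<rho>1" for t
  proof -
    have cc0: "cc 0 = c s0" using ccs[of 0] \<rho> by simp
    have "a 0 j = (0, 0, 0, cc j)" for j
      using b(1) unfolding a_def scl_def CF_def
      by (intro five_eqI) (simp_all add: u_def u0_def K_def cf_ms_int cf_1 p q cc0 c_quad)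
    then have "psum a t 0 = psum1 (\<lambda>j. (0, 0, 0, cc j)) t" unfolding psum_v0 by presburger
    also have "\<dots> = (0, 0, 0, psum1 cc t)"
    proof (rule psum1_bounded_linear[symmetric, OF cc])
      show "\<bar>t\<bar> < \<rho>" using that \<rho>1 b by linarith
      show "bounded_linear (\<lambda>x::real\<times>real. (0::real, 0::real, 0::real, x))"
        by (intro bounded_linear_Pair bounded_linear_zero bounded_linear_ident)
    qed
    also have "psum1 cc t = c (s0 + t)" using ccs[of t] that \<rho>1 b by simp
    finally show ?thesis .
  qed
  \<comment> \<open>The expansion of the right-hand side is valid only for displacements of norm at
    most \<open>R\<close>. Continuity at the centre, where the displacement is 0, provides a smaller
    \<delta> with this property.\<close>
  have "((\<lambda>w. psum a (fst w) (snd w)) has_derivative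
     (\<lambda>h. fst h *\<^sub>R psum (ds a) 0 0 + snd h *\<^sub>R psum (dv a) 0 0)) (at (0, 0))"
    by (rule psum_has_derivative[where \<rho> = \<rho>1]) (use gscl \<rho>1 in \<open>auto simp: a_def\<close>)
  then have "isCont (\<lambda>w. psum a (fst w) (snd w)) (0, 0)" by (rule has_derivative_continuous)
  then obtain \<delta>2 where d2: "\<delta>2 > 0" "\<And>w. dist w (0, 0) < \<delta>2 \<Longrightarrow> dist (psum a (fst w) (snd w)) (psum a 0 0) < R"
    unfolding continuous_at_eps_delta using R by (metis fst_conv snd_conv)
  define \<delta> where "\<delta> = min \<rho>1 \<delta>2 / 2"
  have \<delta>: "\<delta> > 0" "2 * \<delta> \<le> \<rho>1" "2 * \<delta> \<le> \<delta>2" using \<rho>1 d2 by (auto simp: \<delta>_def)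
  have "psum a t v \<in> U \<and> psum (dv a) t v = rhs (psum a t v) (psum (ds a) t v)" if "\<bar>t\<bar> < \<delta>" "\<bar>v\<bar> < \<delta>" for t v
  proof -
    have tv: "\<bar>t\<bar> < \<rho>1" "\<bar>v\<bar> < \<rho>1" using that \<delta> by auto
    have "dist (t, v) (0, 0) \<le> \<bar>t\<bar> + \<bar>v\<bar>" using norm_Pair_le[of t v] by (simp add: dist_norm flip: zero_prod_def)
    then have "dist (psum a t v) (psum a 0 0) < R" using d2(2)[of "(t, v)"] that \<delta> by simp
    moreover have "psum a 0 0 = P0" using init[of 0] \<rho>1 by (simp add: P0_def)
    ultimately have nm: "norm (map5 (ev t v) u) \<le> R" by (simp add: psum_a[OF tv] dist_norm)
    have "psum (dv a) t v = map5 (ev t v) g" by (simp add: dv_a ev_scl[OF tv])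
    also have "\<dots> = ma_op \<alpha> \<beta> \<kappa> \<eta> (c4 P0) (c5 P0) (map5 (ev t v) u) (map5 (ev t v) u')"
      by (subst g) (rule ma_op_hom[OF acR nu ev_lin[OF tv] ev_mult[OF tv] ev_1[OF tv]])
    also have "\<dots> = rhs (psum a t v) (psum (ds a) t v)"
      using exp[OF nm] by (simp add: psum_a[OF tv] ds_a ev_scl[OF tv])
    finally show ?thesis using exp[OF nm] by (simp add: psum_a[OF tv])
  qed
  moreover have "gbound a (2 * \<delta>)"
    using gbound_mono[OF gscl, of "2 * \<delta>"] \<delta> by (simp add: a_def)
  moreover have "psum a t 0 = (0, 0, 0, c (s0 + t))" if "\<bar>t\<bar> < \<delta>" for t
    using init that \<delta> by simp
  ultimately have "local_sol s0 \<delta> a" unfolding local_sol_def using \<delta>(1) by blast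
  then show ?thesis by blast
qed

end

section \<open>Order of vanishing at v = 0 and uniqueness\<close>

lemma psum1_shift:
  fixes c :: "nat \<Rightarrow> 'a::banach"
  assumes c: "\<And>j. norm (c j) * \<rho> ^ j \<le> M" and v: "\<bar>v\<bar> < \<rho>" and z: "\<And>j. j < m \<Longrightarrow> c j = 0"
  shows "psum1 c v = v ^ m *\<^sub>R psum1 (\<lambda>i. c (i + m)) v"
proof -
  have sm: "summable (\<lambda>j. v ^ j *\<^sub>R c j)"
    by (rule summable_norm_cancel[OF psum1_summable(1)[OF c v]])
  have \<rho>: "\<rho> > 0" using v by linarith
  have c': "norm (c (i + m)) * \<rho> ^ i \<le> M / \<rho> ^ m" for i
    using c[of "i + m"] \<rho> by (simp add: field_simps power_add)
  have sm': "summable (\<lambda>i. v ^ i *\<^sub>R c (i + m))"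
    by (rule summable_norm_cancel[OF psum1_summable(1)[OF c' v]])
  have "psum1 c v = (\<Sum>i. v ^ (i + m) *\<^sub>R c (i + m))"
    unfolding psum1_def using suminf_split_initial_segment[OF sm, of m] z by simp
  also have "\<dots> = v ^ m *\<^sub>R psum1 (\<lambda>i. c (i + m)) v"
    unfolding psum1_def by (subst suminf_scaleR_right[OF sm']) (simp add: power_add mult.commute)
  finally show ?thesis .
qed

lemma psum1_split_head:
  fixes c :: "nat \<Rightarrow> 'a::banach"
  assumes c: "\<And>j. norm (c j) * \<rho> ^ j \<le> M" and v: "\<bar>v\<bar> < \<rho>"
  shows "psum1 c v = c 0 + v *\<^sub>R psum1 (\<lambda>i. c (Suc i)) v"
proof -
  have M: "M \<ge> 0" using order_trans[OF _ c[of 0]] by simp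
  have sm: "summable (\<lambda>j. v ^ j *\<^sub>R c j)"
    by (rule summable_norm_cancel[OF psum1_summable(1)[OF c v]])
  have "psum1 (\<lambda>j. if j = 0 then 0 else c j) v = v ^ 1 *\<^sub>R psum1 (\<lambda>i. (if i + 1 = 0 then 0 else c (i + 1))) v"
    by (rule psum1_shift[where \<rho> = \<rho> and M = M]) (use c v M in auto)
  moreover have "psum1 c v = c 0 + psum1 (\<lambda>j. if j = 0 then 0 else c j) v"
  proof -
    have sm': "summable (\<lambda>j. v ^ j *\<^sub>R (if j = 0 then 0 else c j))"
      by (subst summable_Suc_iff[symmetric])
         (use summable_Suc_iff[of "\<lambda>j. v ^ j *\<^sub>R c j"] sm in \<open>simp del: power_Suc\<close>)
    show ?thesis
      using suminf_split_head[OF sm] suminf_split_head[OF sm']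
      by (simp add: psum1_def diff_eq_eq add.commute)
  qed
  ultimately show ?thesis by simp
qed

text \<open>When the lower coefficients vanish, dividing by v^j and letting v tend to 0 isolates the
  j-th one; the assumed bound forces this limit to be 0 as long as j < m.\<close>

lemma psum1_vanishing_order:
  fixes c :: "nat \<Rightarrow> 'a::banach"
  assumes c: "\<And>j. norm (c j) * \<rho> ^ j \<le> M" and \<rho>: "\<rho> > 0"
    and le: "\<forall>\<^sub>F v in at 0. norm (psum1 c v) \<le> K * \<bar>v\<bar> ^ m"
  shows "j < m \<Longrightarrow> c j = 0"
proof (induction j rule: less_induct)
  case (less j)
  have c': "norm (c (i + j)) * \<rho> ^ i \<le> M / \<rho> ^ j" for i
    using c[of "i + j"] \<rho> by (simp add: field_simps power_add)
  let ?g = "psum1 (\<lambda>i. c (i + j))"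
  have "isCont ?g 0"
    by (rule has_vector_derivative_continuous[OF psum1_has_vector_derivative[OF c']]) (use \<rho> in auto)
  then have "((\<lambda>v. norm (?g v)) \<longlongrightarrow> norm (c j)) (at 0)"
    using tendsto_norm by (fastforce simp: isCont_def)
  moreover have "((\<lambda>v. norm (?g v)) \<longlongrightarrow> 0) (at (0::real))"
  proof (rule tendsto_0_le[where K = 1])
    show "((\<lambda>v. K * \<bar>v\<bar> ^ (m - j)) \<longlongrightarrow> 0) (at (0::real))"
      using less.prems by (auto intro!: tendsto_eq_intros simp: zero_power)
    have "\<forall>\<^sub>F v in at (0::real). v \<in> {-\<rho><..<\<rho>} \<and> v \<noteq> 0"
      using \<rho> by (intro eventually_conj eventually_at_in_open' eventually_neq_at_within) auto
    then show "\<forall>\<^sub>F v in at 0. norm (norm (?g v)) \<le> norm (K * \<bar>v\<bar> ^ (m - j)) * 1"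
      using le
    proof eventually_elim
      case (elim v)
      have "psum1 c v = v ^ j *\<^sub>R ?g v"
        by (rule psum1_shift[OF c]) (use elim less in auto)
      then have "\<bar>v\<bar> ^ j * norm (?g v) \<le> K * \<bar>v\<bar> ^ m" using elim by (simp add: power_abs)
      also have "\<bar>v\<bar> ^ m = \<bar>v\<bar> ^ j * \<bar>v\<bar> ^ (m - j)" using less.prems by (simp flip: power_add)
      finally have "\<bar>v\<bar> ^ j * norm (?g v) \<le> \<bar>v\<bar> ^ j * (K * \<bar>v\<bar> ^ (m - j))" by (simp add: mult_ac)
      then have "norm (?g v) \<le> K * \<bar>v\<bar> ^ (m - j)" using elim by (simp add: mult_le_cancel_left)
      then show ?case by simp
    qed
  qed
  ultimately have "norm (c j) = 0" by (rule tendsto_unique[rotated]) simp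
  then show ?case by simp
qed

text \<open>Once v^m is split off, the remaining series is bounded near 0.\<close>

lemma psum1_order_le:
  fixes c :: "nat \<Rightarrow> 'a::banach"
  assumes c: "\<And>j. norm (c j) * \<rho> ^ j \<le> M" and \<rho>: "\<rho> > 0" and z: "\<And>j. j < m \<Longrightarrow> c j = 0"
  shows "\<exists>K\<ge>0. \<forall>\<^sub>F v in at 0. norm (psum1 c v) \<le> K * \<bar>v\<bar> ^ m"
proof -
  have M: "M \<ge> 0" using order_trans[OF _ c[of 0]] by simp
  have c': "norm (c (i + m)) * \<rho> ^ i \<le> M / \<rho> ^ m" for i
    using c[of "i + m"] \<rho> by (simp add: field_simps power_add)
  have *: "norm (psum1 c v) \<le> (M / \<rho> ^ m * 2) * \<bar>v\<bar> ^ m" if "v \<in> {-\<rho>/2<..<\<rho>/2}" for v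
  proof -
    have v: "\<bar>v\<bar> < \<rho> / 2" using that by auto
    then have v': "\<bar>v\<bar> < \<rho>" using \<rho> by auto
    have "norm (psum1 (\<lambda>i. c (i + m)) v) \<le> M / \<rho> ^ m * (\<rho> / (\<rho> - \<bar>v\<bar>))"
      by (rule psum1_summable(2)[OF c' v'])
    also have "\<dots> \<le> M / \<rho> ^ m * 2"
      using \<rho> v M by (intro mult_left_mono) (auto simp: field_simps)
    finally have "\<bar>v\<bar> ^ m * norm (psum1 (\<lambda>i. c (i + m)) v) \<le> \<bar>v\<bar> ^ m * (M / \<rho> ^ m * 2)"
      by (rule mult_left_mono) simp
    moreover have "psum1 c v = v ^ m *\<^sub>R psum1 (\<lambda>i. c (i + m)) v"
      by (rule psum1_shift[OF c v' z])
    ultimately show ?thesis by (simp add: power_abs mult.commute)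
  qed
  have "\<forall>\<^sub>F v in at 0. v \<in> {-\<rho>/2<..<\<rho>/2}"
    by (rule eventually_at_in_open') (use \<rho> in auto)
  then have "\<forall>\<^sub>F v in at 0. norm (psum1 c v) \<le> (M / \<rho> ^ m * 2) * \<bar>v\<bar> ^ m"
    by (rule eventually_mono) (rule *)
  then show ?thesis using M \<rho> by (intro exI[of _ "M / \<rho> ^ m * 2"]) auto
qed

lemma psum1_diff:
  fixes c d :: "nat \<Rightarrow> 'a::banach"
  assumes c: "\<And>j. norm (c j) * \<rho> ^ j \<le> M" and d: "\<And>j. norm (d j) * \<rho> ^ j \<le> N" and v: "\<bar>v\<bar> < \<rho>"
  shows "psum1 (\<lambda>j. c j - d j) v = psum1 c v - psum1 d v"
  unfolding psum1_def
  using suminf_diff[OF summable_norm_cancel[OF psum1_summable(1)[OF c v]] summable_norm_cancel[OF psum1_summable(1)[OF d v]]]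
  by (simp add: scaleR_diff_right)

lemma psum_dv:
  assumes "gbound a \<rho>" "\<bar>t\<bar> < \<rho>"
  shows "psum (dv a) t v = psum1 (dseq (\<lambda>i. psum1 (a i) t)) v"
proof -
  have \<rho>: "\<rho> > 0" using assms by linarith
  obtain M where M: "\<And>i j. norm (a i j) * \<rho> ^ (i + j) \<le> M"
    using assms unfolding gbound_def by blast
  have "psum1 (\<lambda>j. real (Suc i) *\<^sub>R a (Suc i) j) t = real (Suc i) *\<^sub>R psum1 (a (Suc i)) t" for i
    by (rule psum1_bounded_linear[OF gbound_row[OF M \<rho>] assms(2) bounded_linear_scaleR_right, symmetric])
  then show ?thesis unfolding psum_def dv_def dseq_def by simp
qed

context monge_ampere_data
begin

text \<open>The rows are summed at t, which needs coefficient bounds beyond radius \<delta>, and the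
  differentiated rows have bounds only below 2 \<delta>. The radius 3/2 \<delta> lies between the
  two.\<close>

lemma local_sol_row_bound:
  assumes "local_sol s0 \<delta> a" "\<bar>t\<bar> < \<delta>"
  obtains M where "\<And>i. norm (psum1 (a i) t) * \<delta> ^ i \<le> M" "\<And>i. norm (psum1 (dseq (a i)) t) * \<delta> ^ i \<le> M"
    "\<And>i j. norm (a i j) * \<delta> ^ j \<le> M / \<delta> ^ i"
proof -
  have \<delta>: "\<delta> > 0" and g: "gbound a (2 * \<delta>)" using assms(1) by (auto simp: local_sol_def)
  obtain M0 where M0: "\<And>i j. norm (a i j) * \<delta> ^ (i + j) \<le> M0"
    using gbound_mono[OF g, of \<delta>] \<delta> unfolding gbound_def by auto
  obtain M1 where M1: "\<And>i j. norm (a i j) * (3/2 * \<delta>) ^ (i + j) \<le> M1"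
    using gbound_mono[OF g, of "3/2*\<delta>"] \<delta> unfolding gbound_def by auto
  obtain M2 where M2: "\<And>i j. norm (ds a i j) * (3/2 * \<delta>) ^ (i + j) \<le> M2"
    using gbound_ds[OF g, of "3/2*\<delta>"] \<delta> unfolding gbound_def by auto
  have mono: "x * \<delta> ^ i \<le> K" if "x * (3/2 * \<delta>) ^ i \<le> K" "x \<ge> 0" for x K i
    using mult_left_mono[OF power_mono[of \<delta> "3/2*\<delta>" i] that(2)] \<delta> that(1) by auto
  have r1: "norm (psum1 (a i) t) * \<delta> ^ i \<le> M1 * ((3/2*\<delta>) / (3/2*\<delta> - \<bar>t\<bar>))" for i
    by (rule mono, rule psum_row_bound[OF M1]) (use assms(2) in auto)
  have r2: "norm (psum1 (ds a i) t) * \<delta> ^ i \<le> M2 * ((3/2*\<delta>) / (3/2*\<delta> - \<bar>t\<bar>))" for i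
    by (rule mono, rule psum_row_bound[OF M2]) (use assms(2) in auto)
  show ?thesis
  proof (rule that[of "max M0 (max (M1 * ((3/2*\<delta>) / (3/2*\<delta> - \<bar>t\<bar>))) (M2 * ((3/2*\<delta>) / (3/2*\<delta> - \<bar>t\<bar>))))"])
    show "norm (a i j) * \<delta> ^ j \<le> max M0 (max (M1 * ((3/2*\<delta>) / (3/2*\<delta> - \<bar>t\<bar>))) (M2 * ((3/2*\<delta>) / (3/2*\<delta> - \<bar>t\<bar>)))) / \<delta> ^ i" for i j
      using gbound_row[OF M0 \<delta>, of i j] divide_right_mono[of M0 "max M0 (max (M1 * ((3/2*\<delta>) / (3/2*\<delta> - \<bar>t\<bar>))) (M2 * ((3/2*\<delta>) / (3/2*\<delta> - \<bar>t\<bar>))))" "\<delta> ^ i"] \<delta>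
      by (meson max.cobounded1 order_trans zero_le_power less_imp_le)
  qed (use r1 r2 in \<open>auto simp: ds_def le_max_iff_disj\<close>)
qed

lemma local_sol_deriv:
  assumes "local_sol s0 \<delta> a" "\<bar>s - s0\<bar> < \<delta>"
  shows "((\<lambda>s. psum1 (a i) (s - s0)) has_vector_derivative psum1 (dseq (a i)) (s - s0)) (at s)"
proof -
  obtain M where "\<And>i j. norm (a i j) * \<delta> ^ j \<le> M / \<delta> ^ i"
    using local_sol_row_bound[OF assms] by metis
  then have "(psum1 (a i) has_vector_derivative psum1 (dseq (a i)) (s - s0)) (at (s - s0))"
    by (rule psum1_has_vector_derivative[OF _ assms(2)])
  moreover have "((\<lambda>s. s - s0) has_vector_derivative 1) (at s)"
    by (auto intro!: derivative_eq_intros)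
  ultimately show ?thesis
    using vector_diff_chain_at[of "\<lambda>s. s - s0" 1 s "psum1 (a i)"] by (simp add: o_def)
qed

text \<open>Near \<open>P0\<close> the right-hand side is \<open>ma_op\<close> over the reals, so
  \<open>blip_ma_op\<close> applies with the real numbers as the algebra.\<close>

lemma rhs_lipschitz_near:
  assumes "P0 \<in> U"
  obtains R L where "R > 0" "L \<ge> 0"
    "\<And>u u' w w'. \<lbrakk>dist u P0 \<le> R; dist u' P0 \<le> R; norm w \<le> K; norm w' \<le> K\<rbrakk> \<Longrightarrow>
       norm (rhs u w - rhs u' w') \<le> L * (norm (u - u') + norm (w - w'))"
proof -
  obtain R \<alpha> \<beta> \<kappa> \<eta> where R: "R > 0" and
    ac: "acoeff \<alpha> (2 * R)" "acoeff \<beta> (2 * R)" "acoeff \<kappa> (2 * R)" "acoeff \<eta> (2 * R)" and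
    exp: "\<And>u w. norm u \<le> R \<Longrightarrow> P0 + u \<in> U \<and> rhs (P0 + u) w = ma_op \<alpha> \<beta> \<kappa> \<eta> (c4 P0) (c5 P0) u w"
    using local_expansion[OF assms] by metis
  define S where "S = (cball 0 R :: real five set) \<times> (cball 0 K :: real five set)"
  let ?F = "\<lambda>w. ma_op \<alpha> \<beta> \<kappa> \<eta> (c4 P0) (c5 P0) (fst w) (snd w) :: real five"
  have "blip S ?F"
    by (rule blip_ma_op[OF ac R]) (auto simp: S_def bounded_Times)
  then obtain L where "L > 0" and "\<And>w. w \<in> S \<Longrightarrow> norm (?F w) \<le> L"
    and L: "\<And>w w'. w \<in> S \<Longrightarrow> w' \<in> S \<Longrightarrow> norm (?F w - ?F w') \<le> L * dist w w'"
    by (rule blipE) blast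
  then have L0: "L \<ge> 0" by simp
  show ?thesis
  proof (rule that[OF R L0])
    fix u u' w w' :: "real five"
    assume h: "dist u P0 \<le> R" "dist u' P0 \<le> R" "norm w \<le> K" "norm w' \<le> K"
    have eq: "rhs u w = ?F (u - P0, w)" "rhs u' w' = ?F (u' - P0, w')"
      using exp[of "u - P0" w] exp[of "u' - P0" w'] h by (auto simp: dist_norm)
    have "norm (rhs u w - rhs u' w') \<le> L * dist (u - P0, w) (u' - P0, w')"
      unfolding eq by (rule L) (use h in \<open>auto simp: S_def dist_norm norm_minus_commute\<close>)
    also have "\<dots> \<le> L * (norm (u - u') + norm (w - w'))"
      using norm_Pair_le[of "u - u'" "w - w'"] L0 by (intro mult_left_mono) (auto simp: dist_norm)
    finally show "norm (rhs u w - rhs u' w') \<le> L * (norm (u - u') + norm (w - w'))" .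
  qed
qed

lemma local_sol_rows_isCont:
  assumes "local_sol s0 \<delta> a" "\<bar>t\<bar> < \<delta>"
  shows "isCont (psum a t) 0" "isCont (psum (ds a) t) 0"
proof -
  obtain M where M: "\<And>i. norm (psum1 (a i) t) * \<delta> ^ i \<le> M" "\<And>i. norm (psum1 (dseq (a i)) t) * \<delta> ^ i \<le> M"
    using local_sol_row_bound[OF assms] by metis
  have \<delta>: "\<delta> > 0" using assms by (auto simp: local_sol_def)
  show "isCont (psum a t) 0" "isCont (psum (ds a) t) 0"
    unfolding psum_def[abs_def] ds_def
    by (rule has_vector_derivative_continuous[OF psum1_has_vector_derivative[OF M(1)]]
       has_vector_derivative_continuous[OF psum1_has_vector_derivative[OF M(2)]]; use \<delta> in simp)+
qed

text \<open>If the v-coefficients of two solutions agree below order n, then the right-hand sides of the system differ by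
  O(v^n), which determines the coefficient of order n.\<close>

lemma local_sol_unique:
  assumes a: "local_sol s0 \<delta> a" and b: "local_sol s1 \<epsilon> b"
  shows "\<bar>s - s0\<bar> < \<delta> \<Longrightarrow> \<bar>s - s1\<bar> < \<epsilon> \<Longrightarrow> psum1 (a n) (s - s0) = psum1 (b n) (s - s1)"
proof (induction n arbitrary: s rule: less_induct)
  case (less n)
  have ga: "gbound a (2 * \<delta>)" and gb: "gbound b (2 * \<epsilon>)" using a b by (auto simp: local_sol_def)
  have s: "\<bar>s - s0\<bar> < \<delta>" "\<bar>s - s1\<bar> < \<epsilon>" "\<bar>s - s0\<bar> < 2 * \<delta>" "\<bar>s - s1\<bar> < 2 * \<epsilon>"
    using less.prems by auto
  show ?case
  proof (cases n)
    case 0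
    have "psum a (s - s0) 0 = (0, 0, 0, c s)" "psum b (s - s1) 0 = (0, 0, 0, c s)"
      using a b s by (auto simp: local_sol_def)
    then show ?thesis by (simp add: 0 psum_v0)
  next
    case (Suc m)
    define \<rho> where "\<rho> = min \<delta> \<epsilon>"
    have pos: "\<delta> > 0" "\<epsilon> > 0" "\<rho> > 0" using a b by (auto simp: local_sol_def \<rho>_def)
    define X where "X i = psum1 (a i) (s - s0)" for i
    define X' where "X' i = psum1 (dseq (a i)) (s - s0)" for i
    define Y where "Y i = psum1 (b i) (s - s1)" for i
    define Y' where "Y' i = psum1 (dseq (b i)) (s - s1)" for i
    obtain M where M: "\<And>i. norm (X i) * \<delta> ^ i \<le> M" "\<And>i. norm (X' i) * \<delta> ^ i \<le> M"
      using local_sol_row_bound[OF a s(1)] unfolding X_def X'_def by metis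
    obtain N where N: "\<And>i. norm (Y i) * \<epsilon> ^ i \<le> N" "\<And>i. norm (Y' i) * \<epsilon> ^ i \<le> N"
      using local_sol_row_bound[OF b s(2)] unfolding Y_def Y'_def by metis
    have mono: "norm x * \<rho> ^ i \<le> K" if "norm x * r ^ i \<le> K" "\<rho> \<le> r" for x :: "real five" and r K i
      using mult_left_mono[OF power_mono[of \<rho> r i] norm_ge_zero[of x]] that pos by auto
    have M\<rho>: "\<And>i. norm (X i) * \<rho> ^ i \<le> M" "\<And>i. norm (X' i) * \<rho> ^ i \<le> M"
      "\<And>i. norm (Y i) * \<rho> ^ i \<le> N" "\<And>i. norm (Y' i) * \<rho> ^ i \<le> N"
      by (rule mono, rule M N, simp add: \<rho>_def)+
    have df: "norm (x - y) * \<rho> ^ i \<le> M + N" if "norm x * \<rho> ^ i \<le> M" "norm y * \<rho> ^ i \<le> N" for x y :: "real five" and i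
      using mult_right_mono[OF norm_triangle_ineq4[of x y], of "\<rho> ^ i"] that pos by (auto simp: distrib_right)
    \<comment> \<open>The induction hypothesis holds on a whole interval of s, so the s-derivatives
      of the lower rows agree as well.\<close>
    have eq: "X i = Y i" "X' i = Y' i" if "i < n" for i
    proof -
      show "X i = Y i" using less.IH[OF that s(1,2)] by (simp add: X_def Y_def)
      have dX: "((\<lambda>s. psum1 (a i) (s - s0)) has_vector_derivative X' i) (at s)"
        unfolding X'_def by (rule local_sol_deriv[OF a s(1)])
      have dY: "((\<lambda>s. psum1 (b i) (s - s1)) has_vector_derivative Y' i) (at s)"
        unfolding Y'_def by (rule local_sol_deriv[OF b s(2)])
      have "((\<lambda>s. psum1 (b i) (s - s1)) has_vector_derivative X' i) (at s)"
      proof (rule has_vector_derivative_transform_within_open[OF dX])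
        show "open ({s0 - \<delta><..<s0 + \<delta>} \<inter> {s1 - \<epsilon><..<s1 + \<epsilon>})" by auto
        show "s \<in> {s0 - \<delta><..<s0 + \<delta>} \<inter> {s1 - \<epsilon><..<s1 + \<epsilon>}" using s by auto
        show "psum1 (a i) (x - s0) = psum1 (b i) (x - s1)"
          if "x \<in> {s0 - \<delta><..<s0 + \<delta>} \<inter> {s1 - \<epsilon><..<s1 + \<epsilon>}" for x
          by (rule less.IH[OF \<open>i < n\<close>]) (use that in auto)
      qed
      then show "X' i = Y' i" using dY by (rule vector_derivative_unique_at)
    qed
    obtain K1 where K1: "K1 \<ge> 0" "\<forall>\<^sub>F v in at 0. norm (psum1 (\<lambda>i. X i - Y i) v) \<le> K1 * \<bar>v\<bar> ^ n"
      using psum1_order_le[where c = "\<lambda>i. X i - Y i" and m = n, OF df[OF M\<rho>(1,3)] pos(3)] eq by auto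
    obtain K2 where K2: "K2 \<ge> 0" "\<forall>\<^sub>F v in at 0. norm (psum1 (\<lambda>i. X' i - Y' i) v) \<le> K2 * \<bar>v\<bar> ^ n"
      using psum1_order_le[where c = "\<lambda>i. X' i - Y' i" and m = n, OF df[OF M\<rho>(2,4)] pos(3)] eq by auto
    define P0 where "P0 = (0::real, 0::real, 0::real, c s)"
    have P0: "psum a (s - s0) 0 = P0" "psum b (s - s1) 0 = P0"
      using a b s by (auto simp: local_sol_def P0_def)
    define K where "K = max (norm (psum (ds a) (s - s0) 0)) (norm (psum (ds b) (s - s1) 0)) + 1"
    obtain R L where RL: "R > 0" "L \<ge> 0"
      "\<And>u u' w w'. \<lbrakk>dist u P0 \<le> R; dist u' P0 \<le> R; norm w \<le> K; norm w' \<le> K\<rbrakk> \<Longrightarrow>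
       norm (rhs u w - rhs u' w') \<le> L * (norm (u - u') + norm (w - w'))"
      using rhs_lipschitz_near[of P0 K] c_in_U by (metis P0_def)
    have lim: "psum a (s - s0) \<midarrow>0\<rightarrow> P0" "psum b (s - s1) \<midarrow>0\<rightarrow> P0"
      using local_sol_rows_isCont(1)[OF a s(1)] local_sol_rows_isCont(1)[OF b s(2)] P0 by (auto simp: isCont_def)
    have lim': "(\<lambda>v. norm (psum (ds a) (s - s0) v)) \<midarrow>0\<rightarrow> norm (psum (ds a) (s - s0) 0)"
       "(\<lambda>v. norm (psum (ds b) (s - s1) v)) \<midarrow>0\<rightarrow> norm (psum (ds b) (s - s1) 0)"
      using local_sol_rows_isCont(2)[OF a s(1)] local_sol_rows_isCont(2)[OF b s(2)] unfolding isCont_def by (auto intro: tendsto_norm)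
    have ev: "\<forall>\<^sub>F v in at 0. dist (psum a (s - s0) v) P0 < R" "\<forall>\<^sub>F v in at 0. dist (psum b (s - s1) v) P0 < R"
      using lim RL(1) by (auto dest: tendstoD)
    have ev': "\<forall>\<^sub>F v in at 0. norm (psum (ds a) (s - s0) v) < K" "\<forall>\<^sub>F v in at 0. norm (psum (ds b) (s - s1) v) < K"
      by (rule order_tendstoD(2)[OF lim'(1)], simp add: K_def) (rule order_tendstoD(2)[OF lim'(2)], simp add: K_def)
    have evv: "\<forall>\<^sub>F v in at 0. v \<in> {-\<rho><..<\<rho>}" by (rule eventually_at_in_open') (use pos in auto)
    have le: "\<forall>\<^sub>F v in at 0. norm (psum1 (dseq (\<lambda>i. X i - Y i)) v) \<le> (L * (K1 + K2)) * \<bar>v\<bar> ^ n"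
      using ev ev' evv K1(2) K2(2)
    proof eventually_elim
      case (elim v)
      have v: "\<bar>v\<bar> < \<rho>" "\<bar>v\<bar> < \<delta>" "\<bar>v\<bar> < \<epsilon>" using elim by (auto simp: \<rho>_def)
      obtain r where r: "\<bar>v\<bar> < r" "r < \<rho>" using v dense by blast
      have e1: "psum a (s - s0) v - psum b (s - s1) v = psum1 (\<lambda>i. X i - Y i) v"
        unfolding psum_def X_def[symmetric] Y_def[symmetric] by (rule psum1_diff[OF M\<rho>(1) M\<rho>(3) v(1), symmetric])
      have e2: "psum (ds a) (s - s0) v - psum (ds b) (s - s1) v = psum1 (\<lambda>i. X' i - Y' i) v"
        unfolding psum_def ds_def X'_def[symmetric] Y'_def[symmetric] by (rule psum1_diff[OF M\<rho>(2) M\<rho>(4) v(1), symmetric])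
      have "psum (dv a) (s - s0) v - psum (dv b) (s - s1) v = psum1 (dseq X) v - psum1 (dseq Y) v"
        by (simp add: psum_dv[OF ga s(3)] psum_dv[OF gb s(4)] X_def[abs_def] Y_def[abs_def])
      also have "\<dots> = psum1 (\<lambda>i. dseq X i - dseq Y i) v"
        by (rule psum1_diff[OF dseq_bound[OF M\<rho>(1)] dseq_bound[OF M\<rho>(3)] r(1), symmetric]) (use r in auto)
      also have "(\<lambda>i. dseq X i - dseq Y i) = dseq (\<lambda>i. X i - Y i)"
        by (simp add: dseq_def fun_eq_iff scaleR_diff_right)
      finally have "norm (psum1 (dseq (\<lambda>i. X i - Y i)) v)
         = norm (rhs (psum a (s - s0) v) (psum (ds a) (s - s0) v) - rhs (psum b (s - s1) v) (psum (ds b) (s - s1) v))"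
        using a b s v by (auto simp: local_sol_def)
      also have "\<dots> \<le> L * (norm (psum1 (\<lambda>i. X i - Y i) v) + norm (psum1 (\<lambda>i. X' i - Y' i) v))"
        unfolding e1[symmetric] e2[symmetric] by (rule RL(3)) (use elim in auto)
      also have "\<dots> \<le> L * (K1 * \<bar>v\<bar> ^ n + K2 * \<bar>v\<bar> ^ n)"
        using elim RL(2) by (intro mult_left_mono add_mono) auto
      finally show ?case by (simp add: algebra_simps)
    qed
    obtain r where r: "0 < r" "r < \<rho>" using pos dense by blast
    have "dseq (\<lambda>i. X i - Y i) m = 0"
      by (rule psum1_vanishing_order[OF dseq_bound[OF df[OF M\<rho>(1,3)] r] r(1) le]) (simp add: Suc)
    then show ?thesis by (simp add: dseq_def Suc X_def Y_def)
  qed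
qed

end

lemma has_derivative_fst_line:
  assumes "(f has_derivative (\<lambda>h. fst h *\<^sub>R a + snd h *\<^sub>R b)) (at (s, v))"
  shows "((\<lambda>s. f (s, v)) has_vector_derivative a) (at s)"
proof -
  have "((\<lambda>s. (s, v)) has_derivative (\<lambda>h. (h, 0))) (at s)"
    by (auto intro!: derivative_eq_intros)
  from diff_chain_at[OF this assms] show ?thesis
    by (simp add: o_def has_vector_derivative_def)
qed

lemma has_derivative_snd_line:
  assumes "(f has_derivative (\<lambda>h. fst h *\<^sub>R a + snd h *\<^sub>R b)) (at (s, v))"
  shows "((\<lambda>v. f (s, v)) has_vector_derivative b) (at v)"
proof -
  have "((\<lambda>v. (s, v)) has_derivative (\<lambda>h. (0, h))) (at v)"
    by (auto intro!: derivative_eq_intros)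
  from diff_chain_at[OF this assms] show ?thesis
    by (simp add: o_def has_vector_derivative_def)
qed

lemma has_vector_derivative_c:
  assumes "(f has_vector_derivative D) (at x)"
  shows "((\<lambda>x. c1 (f x)) has_real_derivative c1 D) (at x)" "((\<lambda>x. c2 (f x)) has_real_derivative c2 D) (at x)"
   "((\<lambda>x. c3 (f x)) has_real_derivative c3 D) (at x)" "((\<lambda>x. c4 (f x)) has_real_derivative c4 D) (at x)"
   "((\<lambda>x. c5 (f x)) has_real_derivative c5 D) (at x)"
  using bounded_linear.has_vector_derivative[OF bounded_linear_c(1) assms]
    bounded_linear.has_vector_derivative[OF bounded_linear_c(2) assms]
    bounded_linear.has_vector_derivative[OF bounded_linear_c(3) assms]
    bounded_linear.has_vector_derivative[OF bounded_linear_c(4) assms]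
    bounded_linear.has_vector_derivative[OF bounded_linear_c(5) assms]
  by (simp_all add: has_real_derivative_iff_has_vector_derivative)

text \<open>The system implies that the v-derivative of z_s - p x_s - q y_s is zero.\<close>

lemma (in monge_ampere_data) local_sol_contact:
  assumes "local_sol s0 \<delta> a" "\<bar>t\<bar> < \<delta>" "\<bar>v\<bar> < \<delta>"
  shows "c3 (psum (ds a) t v) = c4 (psum a t v) * c1 (psum (ds a) t v) + c5 (psum a t v) * c2 (psum (ds a) t v)"
proof -
  have \<delta>: "\<delta> > 0" and g: "gbound a (2 * \<delta>)"
    and eq: "\<And>t v. \<bar>t\<bar> < \<delta> \<Longrightarrow> \<bar>v\<bar> < \<delta> \<Longrightarrow> psum (dv a) t v = rhs (psum a t v) (psum (ds a) t v)"
    and init: "\<And>t. \<bar>t\<bar> < \<delta> \<Longrightarrow> psum a t 0 = (0, 0, 0, c (s0 + t))"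
    using assms(1) by (auto simp: local_sol_def)
  have g': "gbound (ds a) \<delta>" "gbound (dv a) \<delta>" by (rule gbound_ds[OF g] gbound_dv[OF g]; use \<delta> in simp)+
  define u where "u w = psum a (fst w) (snd w)" for w
  define us where "us w = psum (ds a) (fst w) (snd w)" for w
  define uv where "uv w = psum (dv a) (fst w) (snd w)" for w
  have du: "(u has_derivative (\<lambda>h. fst h *\<^sub>R us (t, v) + snd h *\<^sub>R uv (t, v))) (at (t, v))" if "\<bar>t\<bar> < \<delta>" "\<bar>v\<bar> < \<delta>" for t v
    unfolding u_def[abs_def] us_def uv_def fst_conv snd_conv by (rule psum_has_derivative[OF g]) (use that in auto)
  have dus: "(us has_derivative (\<lambda>h. fst h *\<^sub>R psum (ds (ds a)) t v + snd h *\<^sub>R psum (ds (dv a)) t v)) (at (t, v))" if "\<bar>t\<bar> < \<delta>" "\<bar>v\<bar> < \<delta>" for t v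
    unfolding us_def[abs_def] dv_ds[symmetric] by (rule psum_has_derivative[OF g'(1) that])
  have duv: "(uv has_derivative (\<lambda>h. fst h *\<^sub>R psum (ds (dv a)) t v + snd h *\<^sub>R psum (dv (dv a)) t v)) (at (t, v))" if "\<bar>t\<bar> < \<delta>" "\<bar>v\<bar> < \<delta>" for t v
    unfolding uv_def[abs_def] by (rule psum_has_derivative[OF g'(2) that])
  define \<kappa> where "\<kappa> v = c3 (us (t, v)) - (c4 (u (t, v)) * c1 (us (t, v)) + c5 (u (t, v)) * c2 (us (t, v)))" for v
  have d\<kappa>: "(\<kappa> has_real_derivative 0) (at v)" if v: "\<bar>v\<bar> < \<delta>" for v
  proof -
    define w where "w = psum (ds (dv a)) t v"
    note cu = has_vector_derivative_c[OF has_derivative_snd_line[OF du[OF assms(2) v]]]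
    note cus = has_vector_derivative_c[OF has_derivative_snd_line[OF dus[OF assms(2) v]], folded w_def]
    note cu' = has_vector_derivative_c[OF has_derivative_fst_line[OF du[OF assms(2) v]]]
    note cuv = has_vector_derivative_c[OF has_derivative_fst_line[OF duv[OF assms(2) v]], folded w_def]
    have E: "uv (t, v) = rhs (u (t, v)) (us (t, v))" if "\<bar>t\<bar> < \<delta>" for t
      using eq[OF that v] by (simp add: u_def us_def uv_def)
    \<comment> \<open>The third equation of the system is the contact condition in the v-direction.
      Differentiating it in s expresses the mixed derivative of z.\<close>
    have zv: "c3 (uv (t, v)) = c4 (u (t, v)) * c1 (uv (t, v)) + c5 (u (t, v)) * c2 (uv (t, v))" if "\<bar>t\<bar> < \<delta>" for t
      unfolding E[OF that] rhs_def ma_rhs_def by (simp add: algebra_simps)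
    have D1: "((\<lambda>t. c4 (u (t, v)) * c1 (uv (t, v)) + c5 (u (t, v)) * c2 (uv (t, v))) has_real_derivative
       (c4 (us (t, v)) * c1 (uv (t, v)) + c1 w * c4 (u (t, v))) + (c5 (us (t, v)) * c2 (uv (t, v)) + c2 w * c5 (u (t, v)))) (at t)"
      by (intro DERIV_add DERIV_mult cu' cuv)
    have "((\<lambda>t. c3 (uv (t, v))) has_real_derivative
       (c4 (us (t, v)) * c1 (uv (t, v)) + c1 w * c4 (u (t, v))) + (c5 (us (t, v)) * c2 (uv (t, v)) + c2 w * c5 (u (t, v)))) (at t)"
      by (rule has_field_derivative_transform_within_open[OF D1, of "{-\<delta><..<\<delta>}"]) (use assms zv in auto)
    then have w3: "c3 w = (c4 (us (t, v)) * c1 (uv (t, v)) + c1 w * c4 (u (t, v))) + (c5 (us (t, v)) * c2 (uv (t, v)) + c2 w * c5 (u (t, v)))"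
      using cuv(3) DERIV_unique by blast
    have "(\<kappa> has_real_derivative c3 w - ((c4 (uv (t, v)) * c1 (us (t, v)) + c1 w * c4 (u (t, v))) +
        (c5 (uv (t, v)) * c2 (us (t, v)) + c2 w * c5 (u (t, v))))) (at v)"
      unfolding \<kappa>_def by (intro DERIV_add DERIV_diff DERIV_mult cu cus)
    \<comment> \<open>After the mixed derivatives of x and y cancel, p_s x_v + q_s y_v - p_v x_s -
      q_v y_s is left, and the system makes it vanish identically.\<close>
    also have "c3 w - ((c4 (uv (t, v)) * c1 (us (t, v)) + c1 w * c4 (u (t, v))) +
        (c5 (uv (t, v)) * c2 (us (t, v)) + c2 w * c5 (u (t, v)))) = 0"
      unfolding w3 E[OF assms(2)] rhs_def ma_rhs_def ma_a_def ma_b_def by (simp add: algebra_simps)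
    finally show ?thesis .
  qed
  have "\<exists>k. \<forall>x\<in>{-\<delta><..<\<delta>}. \<kappa> x = k"
  proof (rule has_field_derivative_zero_constant)
    show "(\<kappa> has_real_derivative 0) (at x within {-\<delta><..<\<delta>})" if "x \<in> {-\<delta><..<\<delta>}" for x
      by (rule has_field_derivative_at_within[OF d\<kappa>]) (use that in auto)
  qed simp
  then obtain k where k: "\<And>x. x \<in> {-\<delta><..<\<delta>} \<Longrightarrow> \<kappa> x = k" by blast
  have "\<kappa> v = \<kappa> 0" using k[of v] k[of 0] assms(3) \<delta> by (auto simp: abs_less_iff)
  \<comment> \<open>On the initial line x, y and z are identically 0, so their s-derivatives
    vanish.\<close>
  also have "\<kappa> 0 = 0"
  proof -
    note cu = has_vector_derivative_c[OF has_derivative_fst_line[OF du[of t 0]]]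
    have z: "((\<lambda>x. 0) has_real_derivative 0) (at t)" by simp
    have eqs: "c1 (u (x, 0)) = 0" "c2 (u (x, 0)) = 0" "c3 (u (x, 0)) = 0" if "x \<in> {-\<delta><..<\<delta>}" for x
      using init[of x] that by (auto simp: u_def c_defs)
    have "((\<lambda>x. c1 (u (x, 0))) has_real_derivative 0) (at t)" "((\<lambda>x. c2 (u (x, 0))) has_real_derivative 0) (at t)"
        "((\<lambda>x. c3 (u (x, 0))) has_real_derivative 0) (at t)"
      by (rule has_field_derivative_transform_within_open[OF z, of "{-\<delta><..<\<delta>}"]; use assms(2) eqs in force)+
    then have "c1 (us (t, 0)) = 0" "c2 (us (t, 0)) = 0" "c3 (us (t, 0)) = 0"
      using cu(1-3) assms(2) \<delta> by (auto dest: DERIV_unique)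
    then show ?thesis by (simp add: \<kappa>_def)
  qed
  finally show ?thesis by (simp add: \<kappa>_def u_def us_def)
qed

section \<open>The periodic solution\<close>

lemma periodic_of_int:
  fixes f :: "real \<Rightarrow> 'a"
  assumes per: "\<And>t. f (t + 1) = f t"
  shows "f (s + of_int k) = f s"
proof -
  have nat: "f (s + of_nat n) = f s" for s and n :: nat
    by (induction n) (use per in \<open>simp_all add: add.assoc[symmetric] add.commute[of 1]\<close>)
  show ?thesis
  proof (cases "k \<ge> 0")
    case True
    then show ?thesis using nat[of s "nat k"] by simp
  next
    case False
    then show ?thesis using nat[of "s + of_int k" "nat (- k)"] by simp
  qed
qed

lemma periodic_frac:
  fixes f :: "real \<Rightarrow> 'a"
  assumes per: "\<And>t. f (t + 1) = f t"
  shows "f (frac s) = f s"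
  using periodic_of_int[of f "frac s" "\<lfloor>s\<rfloor>", OF per] by (simp add: frac_def)

locale periodic_monge_ampere_data = monge_ampere_data +
  assumes period: "c (s + 1) = c s"
begin

text \<open>The system does not contain s explicitly; only the initial curve sees the
  translation.\<close>

lemma local_sol_shift: "local_sol s0 \<delta> a \<Longrightarrow> local_sol (s0 + of_int k) \<delta> a"
  using periodic_of_int[of c "s0 + _" k, OF period] by (simp add: local_sol_def add_ac)

text \<open>By compactness of one period, finitely many local solutions and their integer translates
  cover the line. The smallest of their radii is a width in v that serves for all s.\<close>

lemma local_sol_uniform:
  obtains d where "d > 0" "\<And>s. \<exists>s0 \<delta> a. local_sol s0 \<delta> a \<and> \<bar>s - s0\<bar> < \<delta> \<and> d \<le> \<delta>"
proof -
  obtain \<Delta> a where \<Delta>: "\<And>s. local_sol s (\<Delta> s) (a s)" using ex_local_sol by metis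
  have pos: "\<Delta> s > 0" for s using \<Delta>[of s] by (simp add: local_sol_def)
  have "compact {0..1::real}" by simp
  then obtain T where T: "T \<subseteq> {0..1}" "finite T" "{0..1} \<subseteq> (\<Union>s\<in>T. ball s (\<Delta> s))"
    by (rule compactE_image[where f = "\<lambda>s. ball s (\<Delta> s)" and C = "{0..1::real}"]) (use pos in auto)
  define d where "d = Min (insert 1 (\<Delta> ` T))"
  have d: "d > 0" "\<And>s. s \<in> T \<Longrightarrow> d \<le> \<Delta> s" using T(2) pos by (auto simp: d_def)
  show ?thesis
  proof (rule that[OF d(1)])
    fix s :: real
    have "frac s \<in> {0..1}" using frac_lt_1[of s] by auto
    with T(3) have "frac s \<in> (\<Union>s\<in>T. ball s (\<Delta> s))" by blast
    then obtain s0 where s0: "s0 \<in> T" "dist s0 (frac s) < \<Delta> s0" by auto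
    have "local_sol (s0 + of_int \<lfloor>s\<rfloor>) (\<Delta> s0) (a s0)" by (rule local_sol_shift[OF \<Delta>])
    moreover have "\<bar>s - (s0 + of_int \<lfloor>s\<rfloor>)\<bar> < \<Delta> s0" using s0(2) by (simp add: dist_real_def frac_def abs_minus_commute)
    ultimately show "\<exists>s0 \<delta> a. local_sol s0 \<delta> a \<and> \<bar>s - s0\<bar> < \<delta> \<and> d \<le> \<delta>" using d(2)[OF s0(1)] by blast
  qed
qed

text \<open>The Taylor coefficients in v at the point s, read off from any local solution around s;
  by \<open>local_sol_unique\<close> the choice is immaterial. Gluing coefficients instead of values
  avoids comparing the different ranges of v.\<close>

definition coef :: "real \<Rightarrow> nat \<Rightarrow> real five" where
  "coef s = (SOME X. \<exists>s0 \<delta> a. local_sol s0 \<delta> a \<and> \<bar>s - s0\<bar> < \<delta> \<and> X = (\<lambda>i. psum1 (a i) (s - s0)))"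

definition dcoef :: "real \<Rightarrow> nat \<Rightarrow> real five" where
  "dcoef s i = vector_derivative (\<lambda>s. coef s i) (at s)"

lemma coef_eq:
  assumes "local_sol s0 \<delta> a" "\<bar>s - s0\<bar> < \<delta>"
  shows "coef s = (\<lambda>i. psum1 (a i) (s - s0))"
proof -
  have "\<exists>s0 \<delta> a. local_sol s0 \<delta> a \<and> \<bar>s - s0\<bar> < \<delta> \<and> coef s = (\<lambda>i. psum1 (a i) (s - s0))"
    unfolding coef_def
    by (rule someI_ex[where P = "\<lambda>X. \<exists>s0 \<delta> a. local_sol s0 \<delta> a \<and> \<bar>s - s0\<bar> < \<delta> \<and> X = (\<lambda>i. psum1 (a i) (s - s0))"])
       (use assms in blast)
  then obtain s1 \<epsilon> b where "local_sol s1 \<epsilon> b" "\<bar>s - s1\<bar> < \<epsilon>" "coef s = (\<lambda>i. psum1 (b i) (s - s1))" by blast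
  then show ?thesis using local_sol_unique[OF assms(1) _ assms(2)] by presburger
qed

lemma dcoef_eq:
  assumes "local_sol s0 \<delta> a" "\<bar>s - s0\<bar> < \<delta>"
  shows "dcoef s = (\<lambda>i. psum1 (dseq (a i)) (s - s0))"
proof
  fix i
  have "((\<lambda>s. coef s i) has_vector_derivative psum1 (dseq (a i)) (s - s0)) (at s)"
    by (rule has_vector_derivative_transform_within_open[OF local_sol_deriv[OF assms], of "{s0 - \<delta><..<s0 + \<delta>}"])
       (use assms(2) coef_eq[OF assms(1)] in auto)
  then show "dcoef s i = psum1 (dseq (a i)) (s - s0)"
    unfolding dcoef_def by (rule vector_derivative_at)
qed

lemma coef_period: "coef (s + 1) = coef s" "dcoef (s + 1) = dcoef s"
proof -
  obtain \<delta> a where l: "local_sol s \<delta> a" using ex_local_sol by blast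
  then have l': "local_sol (s + 1) \<delta> a" using local_sol_shift[of s \<delta> a 1] by simp
  have "\<delta> > 0" using l by (simp add: local_sol_def)
  then show "coef (s + 1) = coef s" "dcoef (s + 1) = dcoef s"
    using coef_eq[OF l, of s] coef_eq[OF l', of "s + 1"] dcoef_eq[OF l, of s] dcoef_eq[OF l', of "s + 1"] by simp_all
qed

lemma coef_dcoef_psum:
  assumes "local_sol s0 \<delta> a" "\<bar>s - s0\<bar> < \<delta>"
  shows "psum1 (coef s) v = psum a (s - s0) v"
    "psum1 (dcoef s) v = psum (ds a) (s - s0) v"
    "psum1 (dseq (coef s)) v = psum (dv a) (s - s0) v"
    "psum1 (\<lambda>i. coef s (Suc i)) v = psum (\<lambda>i. a (Suc i)) (s - s0) v"
    "psum1 (\<lambda>i. dcoef s (Suc i)) v = psum (ds (\<lambda>i. a (Suc i))) (s - s0) v"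
    "psum1 (dseq (\<lambda>i. coef s (Suc i))) v = psum (dv (\<lambda>i. a (Suc i))) (s - s0) v"
    "gbound (\<lambda>i. a (Suc i)) (2 * \<delta>)"
proof -
  have \<delta>: "\<delta> > 0" and g: "gbound a (2 * \<delta>)" using assms(1) by (auto simp: local_sol_def)
  obtain M where M: "\<And>i j. norm (a i j) * (2 * \<delta>) ^ (i + j) \<le> M" using g unfolding gbound_def by blast
  have "norm (a (Suc i) j) * (2 * \<delta>) ^ (i + j) \<le> M / (2 * \<delta>)" for i j
    using M[of "Suc i" j] \<delta> by (simp add: field_simps)
  then show g': "gbound (\<lambda>i. a (Suc i)) (2 * \<delta>)" unfolding gbound_def by blast
  show "psum1 (coef s) v = psum a (s - s0) v"
    "psum1 (dcoef s) v = psum (ds a) (s - s0) v"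
    "psum1 (\<lambda>i. coef s (Suc i)) v = psum (\<lambda>i. a (Suc i)) (s - s0) v"
    "psum1 (\<lambda>i. dcoef s (Suc i)) v = psum (ds (\<lambda>i. a (Suc i))) (s - s0) v"
    by (simp_all add: psum_def ds_def coef_eq[OF assms] dcoef_eq[OF assms])
  show "psum1 (dseq (coef s)) v = psum (dv a) (s - s0) v"
    "psum1 (dseq (\<lambda>i. coef s (Suc i))) v = psum (dv (\<lambda>i. a (Suc i))) (s - s0) v"
    by (subst psum_dv[OF g] psum_dv[OF g']; use assms(2) \<delta> in \<open>simp add: coef_eq[OF assms]\<close>)+
qed

lemma has_derivative_strip:
  assumes l: "local_sol s0 \<delta> a" "\<bar>s - s0\<bar> < \<delta>" "\<bar>v\<bar> < \<delta>" and b: "gbound b \<delta>"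
    and eq: "\<And>s v. \<bar>s - s0\<bar> < \<delta> \<Longrightarrow> \<bar>v\<bar> < \<delta> \<Longrightarrow> f (s, v) = psum b (s - s0) v"
  shows "(f has_derivative (\<lambda>h. fst h *\<^sub>R psum (ds b) (s - s0) v + snd h *\<^sub>R psum (dv b) (s - s0) v)) (at (s, v))"
    and "isCont f (s, v)"
proof -
  let ?T = "\<lambda>w::real\<times>real. (fst w - s0, snd w)"
  have "(?T has_derivative (\<lambda>h. (fst h, snd h))) (at (s, v))"
    by (auto intro!: derivative_eq_intros)
  moreover have "((\<lambda>w. psum b (fst w) (snd w)) has_derivative
     (\<lambda>h. fst h *\<^sub>R psum (ds b) (s - s0) v + snd h *\<^sub>R psum (dv b) (s - s0) v)) (at (?T (s, v)))"
    using psum_has_derivative[OF b l(2,3)] by simp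
  ultimately have D: "((\<lambda>w. psum b (fst w - s0) (snd w)) has_derivative
     (\<lambda>h. fst h *\<^sub>R psum (ds b) (s - s0) v + snd h *\<^sub>R psum (dv b) (s - s0) v)) (at (s, v))"
    using diff_chain_at by (fastforce simp: o_def)
  show "(f has_derivative (\<lambda>h. fst h *\<^sub>R psum (ds b) (s - s0) v + snd h *\<^sub>R psum (dv b) (s - s0) v)) (at (s, v))"
    by (rule has_derivative_transform_within_open[OF D, of "{s0 - \<delta><..<s0 + \<delta>} \<times> {-\<delta><..<\<delta>}"])
       (use l eq in \<open>auto intro!: open_Times\<close>)
  then show "isCont f (s, v)" by (rule has_derivative_continuous)
qed

text \<open>The function \<omega> is the quotient of u(s, v) - u(s, 0) by v, obtained by dropping
  the lowest coefficient in v. It is therefore differentiable across v = 0, and its first two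
  components form the \<psi> of the blow-up.\<close>

lemma global_solution:
  obtains d :: real and u us uv \<omega> \<omega>s \<omega>v :: "real \<times> real \<Rightarrow> real five"
  where "d > 0"
    "\<And>s v. \<bar>v\<bar> < d \<Longrightarrow> (u has_derivative (\<lambda>h. fst h *\<^sub>R us (s, v) + snd h *\<^sub>R uv (s, v))) (at (s, v))"
    "\<And>s v. \<bar>v\<bar> < d \<Longrightarrow> (\<omega> has_derivative (\<lambda>h. fst h *\<^sub>R \<omega>s (s, v) + snd h *\<^sub>R \<omega>v (s, v))) (at (s, v))"
    "\<And>s v. \<bar>v\<bar> < d \<Longrightarrow> isCont us (s, v) \<and> isCont uv (s, v) \<and> isCont \<omega>s (s, v) \<and> isCont \<omega>v (s, v)"
    "\<And>s v. u (s + 1, v) = u (s, v) \<and> us (s + 1, v) = us (s, v) \<and> uv (s + 1, v) = uv (s, v)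
       \<and> \<omega> (s + 1, v) = \<omega> (s, v) \<and> \<omega>s (s + 1, v) = \<omega>s (s, v) \<and> \<omega>v (s + 1, v) = \<omega>v (s, v)"
    "\<And>s v. \<bar>v\<bar> < d \<Longrightarrow> u (s, v) \<in> U \<and> uv (s, v) = rhs (u (s, v)) (us (s, v))"
    "\<And>s v. \<bar>v\<bar> < d \<Longrightarrow> u (s, v) = (0, 0, 0, c s) + v *\<^sub>R \<omega> (s, v)"
    "\<And>s v. \<bar>v\<bar> < d \<Longrightarrow> c3 (us (s, v)) = c4 (u (s, v)) * c1 (us (s, v)) + c5 (u (s, v)) * c2 (us (s, v))"
proof -
  obtain d where d: "d > 0" and loc: "\<And>s. \<exists>s0 \<delta> a. local_sol s0 \<delta> a \<and> \<bar>s - s0\<bar> < \<delta> \<and> d \<le> \<delta>"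
    using local_sol_uniform by metis
  define u where "u w = psum1 (coef (fst w)) (snd w)" for w
  define us where "us w = psum1 (dcoef (fst w)) (snd w)" for w
  define uv where "uv w = psum1 (dseq (coef (fst w))) (snd w)" for w
  define \<omega> where "\<omega> w = psum1 (\<lambda>i. coef (fst w) (Suc i)) (snd w)" for w
  define \<omega>s where "\<omega>s w = psum1 (\<lambda>i. dcoef (fst w) (Suc i)) (snd w)" for w
  define \<omega>v where "\<omega>v w = psum1 (dseq (\<lambda>i. coef (fst w) (Suc i))) (snd w)" for w
  have *: "(u has_derivative (\<lambda>h. fst h *\<^sub>R us (s, v) + snd h *\<^sub>R uv (s, v))) (at (s, v)) \<and>
    (\<omega> has_derivative (\<lambda>h. fst h *\<^sub>R \<omega>s (s, v) + snd h *\<^sub>R \<omega>v (s, v))) (at (s, v)) \<and>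
    (isCont us (s, v) \<and> isCont uv (s, v) \<and> isCont \<omega>s (s, v) \<and> isCont \<omega>v (s, v)) \<and>
    (u (s, v) \<in> U \<and> uv (s, v) = rhs (u (s, v)) (us (s, v))) \<and>
    u (s, v) = (0, 0, 0, c s) + v *\<^sub>R \<omega> (s, v) \<and>
    c3 (us (s, v)) = c4 (u (s, v)) * c1 (us (s, v)) + c5 (u (s, v)) * c2 (us (s, v))" if v: "\<bar>v\<bar> < d" for s v
  proof -
    obtain s0 \<delta> a where l: "local_sol s0 \<delta> a" "\<bar>s - s0\<bar> < \<delta>" and "d \<le> \<delta>" using loc by blast
    then have v\<delta>: "\<bar>v\<bar> < \<delta>" using v by simp
    have \<delta>: "\<delta> > 0" and g: "gbound a (2 * \<delta>)" using l(1) by (auto simp: local_sol_def)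
    have g': "gbound (\<lambda>i. a (Suc i)) (2 * \<delta>)" by (rule coef_dcoef_psum(7)[OF l])
    have gs: "gbound a \<delta>" "gbound (ds a) \<delta>" "gbound (dv a) \<delta>" "gbound (\<lambda>i. a (Suc i)) \<delta>"
      "gbound (ds (\<lambda>i. a (Suc i))) \<delta>" "gbound (dv (\<lambda>i. a (Suc i))) \<delta>"
      using gbound_mono[OF g, of \<delta>] gbound_ds[OF g, of \<delta>] gbound_dv[OF g, of \<delta>]
        gbound_mono[OF g', of \<delta>] gbound_ds[OF g', of \<delta>] gbound_dv[OF g', of \<delta>] \<delta> by auto
    note S = has_derivative_strip[OF l v\<delta>]
    note E = coef_dcoef_psum(1-6)[OF l(1)]
    have eqs: "u (s, v) = psum a (s - s0) v" "us (s, v) = psum (ds a) (s - s0) v" "uv (s, v) = psum (dv a) (s - s0) v"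
      "\<omega> (s, v) = psum (\<lambda>i. a (Suc i)) (s - s0) v" "\<omega>s (s, v) = psum (ds (\<lambda>i. a (Suc i))) (s - s0) v"
      "\<omega>v (s, v) = psum (dv (\<lambda>i. a (Suc i))) (s - s0) v" if "\<bar>s - s0\<bar> < \<delta>" for s v
      by (simp_all add: u_def us_def uv_def \<omega>_def \<omega>s_def \<omega>v_def E[OF that])
    obtain M where M: "\<And>i. norm (coef s i) * \<delta> ^ i \<le> M"
      using local_sol_row_bound[OF l] coef_eq[OF l] by metis
    have "coef s 0 = (0, 0, 0, c s)"
    proof -
      have "psum a (s - s0) 0 = (0, 0, 0, c s)" using l by (simp add: local_sol_def)
      then show ?thesis by (simp add: coef_eq[OF l] psum_v0)
    qed
    then have "u (s, v) = (0, 0, 0, c s) + v *\<^sub>R \<omega> (s, v)"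
      using psum1_split_head[OF M v\<delta>] by (simp add: u_def \<omega>_def)
    moreover have "u (s, v) \<in> U \<and> uv (s, v) = rhs (u (s, v)) (us (s, v))"
      using l v\<delta> by (simp add: eqs local_sol_def)
    moreover have "c3 (us (s, v)) = c4 (u (s, v)) * c1 (us (s, v)) + c5 (u (s, v)) * c2 (us (s, v))"
      unfolding eqs[OF l(2)] by (rule local_sol_contact[OF l v\<delta>])
    moreover have "(u has_derivative (\<lambda>h. fst h *\<^sub>R us (s, v) + snd h *\<^sub>R uv (s, v))) (at (s, v))"
      unfolding eqs(2,3)[OF l(2)] by (rule S(1)[OF gs(1)]) (rule eqs)
    moreover have "(\<omega> has_derivative (\<lambda>h. fst h *\<^sub>R \<omega>s (s, v) + snd h *\<^sub>R \<omega>v (s, v))) (at (s, v))"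
      unfolding eqs(5,6)[OF l(2)] by (rule S(1)[OF gs(4)]) (rule eqs)
    moreover have "isCont us (s, v)" by (rule S(2)[OF gs(2)]) (rule eqs)
    moreover have "isCont uv (s, v)" by (rule S(2)[OF gs(3)]) (rule eqs)
    moreover have "isCont \<omega>s (s, v)" by (rule S(2)[OF gs(5)]) (rule eqs)
    moreover have "isCont \<omega>v (s, v)" by (rule S(2)[OF gs(6)]) (rule eqs)
    ultimately show ?thesis by blast
  qed
  show ?thesis
  proof (rule that[OF d, of u us uv \<omega> \<omega>s \<omega>v])
    show "u (s + 1, v) = u (s, v) \<and> us (s + 1, v) = us (s, v) \<and> uv (s + 1, v) = uv (s, v)
       \<and> \<omega> (s + 1, v) = \<omega> (s, v) \<and> \<omega>s (s + 1, v) = \<omega>s (s, v) \<and> \<omega>v (s + 1, v) = \<omega>v (s, v)" for s v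
      by (simp add: u_def us_def uv_def \<omega>_def \<omega>s_def \<omega>v_def coef_period)
  qed (use * in blast)+
qed

end

section \<open>The turning number of a simple closed curve\<close>

text \<open>The values lie in a discrete subgroup of the imaginary axis. This is how increments of
  logarithms are shown to be constant.\<close>

lemma exp_eq_1_constant:
  fixes f :: "'a::topological_space \<Rightarrow> complex"
  assumes "connected S" "continuous_on S f" "\<And>x. x \<in> S \<Longrightarrow> exp (f x) = 1"
  obtains m :: int where "\<And>x. x \<in> S \<Longrightarrow> f x = 2 * of_int m * of_real pi * \<i>"
proof -
  have form: "\<exists>n::int. f x = 2 * of_int n * of_real pi * \<i>" if x: "x \<in> S" for x
  proof -
    obtain n :: int where "Re (f x) = 0" "Im (f x) = of_int (2 * n) * pi"
      using assms(3)[OF x] unfolding exp_eq_1 by blast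
    then have "f x = 2 * of_int n * of_real pi * \<i>" by (simp add: complex_eq_iff)
    then show ?thesis by blast
  qed
  have "f constant_on S"
  proof (rule continuous_discrete_range_constant[OF assms(1,2)])
    fix x assume x: "x \<in> S"
    obtain n :: int where n: "f x = 2 * of_int n * of_real pi * \<i>" using form[OF x] by blast
    have "2 * pi \<le> cmod (f y - f x)" if y: "y \<in> S \<and> f y \<noteq> f x" for y
    proof -
      obtain m :: int where m: "f y = 2 * of_int m * of_real pi * \<i>" using form y by blast
      have "f y - f x = complex_of_real (2 * pi * real_of_int (m - n)) * \<i>"
        unfolding m n by (simp add: algebra_simps)
      then have "cmod (f y - f x) = 2 * pi * \<bar>real_of_int (m - n)\<bar>"
        by (simp only: norm_mult norm_of_real abs_mult) simp
      moreover have "1 \<le> \<bar>real_of_int (m - n)\<bar>" using y m n by (metis Ints_of_int Ints_nonzero_abs_ge1 diff_eq_diff_eq diff_self of_int_diff of_int_eq_iff right_minus_eq)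
      ultimately show ?thesis using mult_left_mono[of 1 "\<bar>real_of_int (m - n)\<bar>" "2 * pi"] by simp
    qed
    then show "\<exists>e>0. \<forall>y. y \<in> S \<and> f y \<noteq> f x \<longrightarrow> e \<le> norm (f y - f x)"
      by (intro exI[of _ "2 * pi"]) auto
  qed
  then obtain k where k: "\<And>x. x \<in> S \<Longrightarrow> f x = k" unfolding constant_on_def by blast
  show ?thesis
  proof (cases "S = {}")
    case False
    then show ?thesis using form k that by (metis ex_in_conv)
  qed (use that[of 0] in auto)
qed

text \<open>Near p the values of \<open>L\<close> stay within distance 1 < pi of \<open>L p\<close>,
  so \<open>L\<close> is there \<open>L p\<close> plus the principal logarithm of the quotient f /
  f(p).\<close>

lemma continuous_log_has_derivative:
  fixes f L :: "'a::real_normed_vector \<Rightarrow> complex"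
  assumes "open S" "p \<in> S" "continuous_on S L" "\<And>x. x \<in> S \<Longrightarrow> f x = exp (L x)"
    and f: "(f has_derivative f') (at p)"
  shows "(L has_derivative (\<lambda>h. f' h / f p)) (at p)"
proof -
  have fp: "f p \<noteq> 0" using assms(4)[OF assms(2)] by simp
  have "isCont L p" using assms(1-3) continuous_on_eq_continuous_at by blast
  then have "(L \<longlongrightarrow> L p) (nhds p)" by (simp add: continuous_at tendsto_at_iff_tendsto_nhds)
  then have "\<forall>\<^sub>F x in nhds p. dist (L x) (L p) < 1" by (rule tendstoD) simp
  then obtain T where T: "open T" "p \<in> T" "\<And>x. x \<in> T \<Longrightarrow> dist (L x) (L p) < 1"
    unfolding eventually_nhds by blast
  have D: "((\<lambda>x. L p + Ln (f x / f p)) has_derivative (\<lambda>h. f' h / f p)) (at p)"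
  proof -
    have "((\<lambda>x. f x / f p) has_derivative (\<lambda>h. f' h / f p)) (at p)"
      using bounded_linear.has_derivative[OF bounded_linear_divide f] .
    moreover have "(Ln has_derivative (*) (inverse (f p / f p))) (at (f p / f p))"
      using has_field_derivative_Ln[of 1] fp by (simp add: has_field_derivative_def)
    ultimately have "((\<lambda>x. Ln (f x / f p)) has_derivative (\<lambda>h. f' h / f p)) (at p)"
      using diff_chain_at[of "\<lambda>x. f x / f p" _ p Ln] fp by (fastforce simp: o_def)
    then show ?thesis by (auto intro!: derivative_eq_intros)
  qed
  show ?thesis
  proof (rule has_derivative_transform_within_open[OF D, of "S \<inter> T"])
    show "L p + Ln (f x / f p) = L x" if "x \<in> S \<inter> T" for x
    proof -
      have "f x / f p = exp (L x - L p)" using that assms(2,4) by (simp add: exp_diff)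
      moreover have "\<bar>Im (L x - L p)\<bar> < pi"
        using abs_Im_le_cmod[of "L x - L p"] T(3)[of x] that pi_gt3 by (auto simp: dist_norm)
      ultimately show ?thesis by (simp add: Ln_exp abs_less_iff)
    qed
  qed (use assms T in auto)
qed

text \<open>Joint continuity of the divided difference on the diagonal: the mean value inequality,
  applied to g minus its linearization at \<open>s0\<close>, controls it on a small ball.\<close>

lemma difference_quotient_isCont:
  fixes g :: "real \<Rightarrow> complex"
  assumes g: "\<And>t. (g has_vector_derivative g' t) (at t)" and g': "continuous_on UNIV g'"
  shows "isCont (\<lambda>w. if fst w = snd w then g' (fst w) else (g (snd w) - g (fst w)) / of_real (snd w - fst w)) (s0, s0)"
    (is "isCont ?Q _")
proof (rule continuous_at_eps_delta[THEN iffD2], intro allI impI)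
  fix e :: real assume "e > 0"
  have "isCont g' s0" using g' by (simp add: continuous_on_eq_continuous_at)
  then obtain \<delta> where \<delta>: "\<delta> > 0" "\<And>t. dist t s0 < \<delta> \<Longrightarrow> dist (g' t) (g' s0) < e / 2"
    unfolding continuous_at_eps_delta using \<open>e > 0\<close> by (metis half_gt_zero)
  have "dist (?Q w) (g' s0) < e" if w: "dist w (s0, s0) < \<delta>" for w
  proof -
    have st: "dist (fst w) s0 < \<delta>" "dist (snd w) s0 < \<delta>"
      using dist_fst_le[of w "(s0, s0)"] dist_snd_le[of w "(s0, s0)"] w by auto
    show ?thesis
    proof (cases "fst w = snd w")
      case True
      then show ?thesis using \<delta>(2)[OF st(1)] \<open>e > 0\<close> by simp
    next
      case False
      have "norm (g (snd w) - g (fst w) - (snd w - fst w) *\<^sub>R g' s0) \<le> norm (snd w - fst w) * (e / 2)"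
      proof (rule vector_differentiable_bound_linearization[where S = "ball s0 \<delta>"])
        show "(g has_vector_derivative g' t) (at t within ball s0 \<delta>)" for t
          using g by (rule has_vector_derivative_at_within)
        show "closed_segment (fst w) (snd w) \<subseteq> ball s0 \<delta>"
          using st by (intro closed_segment_subset) (auto simp: dist_commute)
        show "norm (g' x - g' s0) \<le> e / 2" if "x \<in> ball s0 \<delta>" for x
        proof -
          have "dist x s0 < \<delta>" using that by (simp add: dist_commute)
          from \<delta>(2)[OF this] show ?thesis by (simp add: dist_norm)
        qed
      qed (use \<delta> in simp)
      moreover have "?Q w - g' s0 = (g (snd w) - g (fst w) - (snd w - fst w) *\<^sub>R g' s0) / of_real (snd w - fst w)"
        using False by (simp add: field_simps scaleR_conv_of_real)
      ultimately have "norm (?Q w - g' s0) \<le> e / 2"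
        using False by (simp add: norm_divide divide_le_eq mult.commute del: of_real_diff)
      then show ?thesis using \<open>e > 0\<close> by (simp add: dist_norm)
    qed
  qed
  then show "\<exists>d>0. \<forall>x'. dist x' (s0, s0) < d \<longrightarrow> dist (?Q x') (?Q (s0, s0)) < e"
    using \<delta>(1) by (intro exI[of _ \<delta>]) auto
qed

lemma inverse_sinc_isCont: "isCont (\<lambda>x::real. if x = 0 then 1 / pi else x / sin (pi * x)) 0"
proof -
  have "((\<lambda>x. sin (pi * x)) has_real_derivative pi) (at 0)"
    by (auto intro!: derivative_eq_intros)
  then have "(\<lambda>x. sin (pi * x) / x) \<midarrow>0\<rightarrow> pi" by (simp add: DERIV_def)
  then have "(\<lambda>x. inverse (sin (pi * x) / x)) \<midarrow>0\<rightarrow> 1 / pi"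
    unfolding inverse_eq_divide[of pi, symmetric] by (intro tendsto_inverse) auto
  then have "(\<lambda>x. if x = 0 then 1 / pi else x / sin (pi * x)) \<midarrow>0\<rightarrow> 1 / pi"
    by (rule Lim_transform_eventually) (auto simp: eventually_at_filter inverse_eq_divide)
  then show ?thesis by (simp add: isCont_def)
qed

text \<open>Hopf's argument for the turning number of a simple closed curve. The secant map is divided by
  sin (pi (t - s)) rather than by its norm: the quotient extends to the whole plane without zeros,
  is symmetric and changes sign under t + 1, so its logarithm needs no restriction to a triangle.\<close>

lemma simple_closed_curve_turning:
  fixes g g' :: "real \<Rightarrow> complex"
  assumes g: "\<And>t. (g has_vector_derivative g' t) (at t)" and g': "continuous_on UNIV g'"
    and nz: "\<And>t. g' t \<noteq> 0" and per: "\<And>t. g (t + 1) = g t"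
    and inj: "\<And>s t. g s = g t \<Longrightarrow> t - s \<in> \<int>"
  obtains l and \<sigma> :: real where "continuous_on UNIV l" "\<And>s. g' s = exp (l s)" "\<bar>\<sigma>\<bar> = 1"
    "\<And>s. l (s + 1) = l s + 2 * of_real \<sigma> * of_real pi * \<i>"
proof -
  have per': "g' (t + 1) = g' t" for t
  proof -
    have "((\<lambda>s. g (s + 1)) has_vector_derivative g' (t + 1)) (at t)"
      using vector_diff_chain_at[of "\<lambda>s. s + 1" 1 t g "g' (t + 1)"] g
      by (simp add: o_def has_vector_derivative_add_const)
    then have "(g has_vector_derivative g' (t + 1)) (at t)" by (simp add: per)
    then show ?thesis using g vector_derivative_unique_at by blast
  qed
  have per_minus: "g (t - 1) = g t" for t using per[of "t - 1"] by simp
  \<comment> \<open>On the lines where t - s is an integer the value is the limit of the quotient.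
    It should be divided by pi times the cosine, but the cosine is 1 or -1 there and may be
    multiplied instead.\<close>
  define S where "S w = (if sin (pi * (snd w - fst w)) = 0 then of_real (cos (pi * (snd w - fst w)) / pi) * g' (fst w)
      else (g (snd w) - g (fst w)) / of_real (sin (pi * (snd w - fst w))))" for w
  have sin_iff: "sin (pi * x) = 0 \<longleftrightarrow> x \<in> \<int>" for x
    by (auto simp: sin_zero_iff_int2 Ints_def)
  have sin0: "\<bar>x\<bar> < 1 \<Longrightarrow> sin (pi * x) = 0 \<longleftrightarrow> x = 0" for x
    unfolding sin_iff by (auto elim!: Ints_cases)
  have S_shift: "S (s, t + 1) = - S (s, t)" for s t
  proof -
    have "sin (pi * (t + 1 - s)) = - sin (pi * (t - s))" "cos (pi * (t + 1 - s)) = - cos (pi * (t - s))"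
      using sin_periodic_pi[of "pi * (t - s)"] cos_periodic_pi[of "pi * (t - s)"] by (simp_all add: algebra_simps)
    then show ?thesis by (simp add: S_def per)
  qed
  have S_sym: "S (t, s) = S (s, t)" for s t
  proof -
    have e: "sin (pi * (s - t)) = - sin (pi * (t - s))" "cos (pi * (s - t)) = cos (pi * (t - s))"
      using sin_minus[of "pi * (t - s)"] cos_minus[of "pi * (t - s)"] by (simp_all add: algebra_simps)
    show ?thesis
    proof (cases "t - s \<in> \<int>")
      case True
      then obtain k :: int where k: "t = s + of_int k" by (metis Ints_cases add.commute diff_add_cancel)
      have "g' t = g' s" unfolding k by (rule periodic_of_int) (rule per')
      then show ?thesis using True sin_iff[of "t - s"] by (simp add: S_def e)
    next
      case False
      then show ?thesis using sin_iff[of "t - s"] by (simp add: S_def e diff_divide_distrib)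
    qed
  qed
  have S_nz: "S w \<noteq> 0" for w
  proof (cases "snd w - fst w \<in> \<int>")
    case True
    then have "cos (pi * (snd w - fst w)) \<noteq> 0" using sin_iff sin_cos_squared_add[of "pi * (snd w - fst w)"] by force
    then show ?thesis using True sin_iff nz by (simp add: S_def)
  next
    case False
    then show ?thesis using sin_iff inj by (auto simp: S_def)
  qed
  have S_diag: "isCont S (s, s)" for s
  proof -
    let ?Q = "\<lambda>w. if fst w = snd w then g' (fst w) else (g (snd w) - g (fst w)) / of_real (snd w - fst w)"
    let ?K = "\<lambda>x::real. if x = 0 then 1 / pi else x / sin (pi * x)"
    have "isCont (\<lambda>w. ?K (snd w - fst w)) (s, s)"
      by (rule isCont_o2[where f = "\<lambda>w. snd w - fst w" and g = ?K]) (auto intro!: continuous_intros simp: inverse_sinc_isCont)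
    then have "isCont (\<lambda>w. ?Q w * of_real (?K (snd w - fst w))) (s, s)"
      by (intro continuous_mult difference_quotient_isCont[OF g g'] continuous_of_real)
    moreover have "\<forall>\<^sub>F w in nhds (s, s). ?Q w * of_real (?K (snd w - fst w)) = S w"
    proof -
      have "open {w::real\<times>real. \<bar>snd w - fst w\<bar> < 1}"
        by (intro open_Collect_less continuous_intros)
      then have "\<forall>\<^sub>F w in nhds (s, s). \<bar>snd w - fst w\<bar> < 1"
        using eventually_nhds_in_open[of "{w. \<bar>snd w - fst w\<bar> < 1}" "(s, s)"] by simp
      then show ?thesis
        by (rule eventually_mono) (auto simp: S_def sin0)
    qed
    ultimately show ?thesis by (rule isCont_cong[THEN iffD1, rotated])
  qed
  have S_off: "isCont S (s, t)" if "t - s \<notin> \<int>" for s t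
  proof -
    let ?R = "\<lambda>w. (g (snd w) - g (fst w)) / of_real (sin (pi * (snd w - fst w)))"
    have gc: "continuous_on UNIV g" using g by (meson continuous_at_imp_continuous_on has_vector_derivative_continuous)
    have "continuous_on UNIV (\<lambda>w. g (snd w))" "continuous_on UNIV (\<lambda>w. g (fst w))"
      by (rule continuous_on_compose2[OF gc]; auto intro!: continuous_intros)+
    then have "continuous_on {w. sin (pi * (snd w - fst w)) \<noteq> 0} ?R"
      by (intro continuous_intros) (auto intro: continuous_on_subset)
    moreover have op: "open {w::real\<times>real. sin (pi * (snd w - fst w)) \<noteq> 0}"
      by (intro open_Collect_neq continuous_intros)
    ultimately have "isCont ?R (s, t)"
      using that sin_iff by (simp add: continuous_on_eq_continuous_at)
    moreover have "\<forall>\<^sub>F w in nhds (s, t). ?R w = S w"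
    proof -
      have "\<forall>\<^sub>F w in nhds (s, t). w \<in> {w. sin (pi * (snd w - fst w)) \<noteq> 0}"
        using eventually_nhds_in_open[OF op] that sin_iff by simp
      then show ?thesis by (rule eventually_mono) (simp add: S_def)
    qed
    ultimately show ?thesis by (rule isCont_cong[THEN iffD1, rotated])
  qed
  \<comment> \<open>Continuity on the diagonal is carried to the other lines with t - s an integer
    by the sign rule.\<close>
  have shift_cont: "isCont S (s, t + 1) \<longleftrightarrow> isCont S (s, t)" for s t
  proof -
    have fwd: "isCont S (s, t + 1)" if "isCont S (s, t)" for s t
    proof -
      have "isCont (\<lambda>w. (fst w, snd w - 1)) (s, t + 1)" by (intro continuous_intros)
      then have "isCont (\<lambda>w. S (fst w, snd w - 1)) (s, t + 1)"
        by (rule isCont_o2) (simp add: that)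
      then have "isCont (\<lambda>w. - S (fst w, snd w - 1)) (s, t + 1)" by (rule continuous_minus)
      moreover have "(\<lambda>w. - S (fst w, snd w - 1)) = S"
      proof
        show "- S (fst w, snd w - 1) = S w" for w using S_shift[of "fst w" "snd w - 1"] by simp
      qed
      ultimately show ?thesis by simp
    qed
    have bwd: "isCont S (s, t)" if "isCont S (s, t + 1)" for s t
    proof -
      have "isCont (\<lambda>w. (fst w, snd w + 1)) (s, t)" by (intro continuous_intros)
      then have "isCont (\<lambda>w. S (fst w, snd w + 1)) (s, t)"
        by (rule isCont_o2) (simp add: that)
      then have "isCont (\<lambda>w. - S (fst w, snd w + 1)) (s, t)" by (rule continuous_minus)
      moreover have "(\<lambda>w. - S (fst w, snd w + 1)) = S"
      proof
        show "- S (fst w, snd w + 1) = S w" for w using S_shift[of "fst w" "snd w"] by simp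
      qed
      ultimately show ?thesis by simp
    qed
    show ?thesis using fwd bwd by blast
  qed
  have S_cont: "isCont S (s, t)" for s t
  proof (cases "t - s \<in> \<int>")
    case True
    then obtain k :: int where k: "t = s + of_int k" by (metis Ints_cases add.commute diff_add_cancel)
    have "isCont S (s, s + of_int k)"
    proof (induction k rule: int_induct[where k = 0])
      case base
      then show ?case using S_diag by simp
    next
      case (step1 i)
      then show ?case using shift_cont[of s "s + of_int i"] by (simp add: add.assoc)
    next
      case (step2 i)
      then show ?case using shift_cont[of s "s + of_int (i - 1)"] by (simp add: algebra_simps)
    qed
    then show ?thesis by (simp add: k)
  qed (rule S_off)
  have contS: "continuous_on UNIV S" using S_cont by (auto intro!: continuous_at_imp_continuous_on)
  obtain L where L: "continuous_on UNIV L" "\<And>w. S w = exp (L w)"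
    using continuous_logarithm_on_contractible[OF contS contractible_UNIV] S_nz by auto
  have Lf: "continuous_on UNIV (\<lambda>w. L (f w))" if "continuous_on UNIV f" for f :: "real \<times> real \<Rightarrow> real \<times> real"
    by (rule continuous_on_compose2[OF L(1) that]) auto
  have e1: "exp (L (fst w, snd w + 1) - L w - of_real pi * \<i>) = 1" for w
    using S_shift[of "fst w" "snd w"] S_nz[of w] by (simp add: exp_diff L(2)[symmetric])
  have k1: "continuous_on UNIV (\<lambda>w. L (fst w, snd w + 1) - L w - of_real pi * \<i>)"
    by (intro continuous_on_diff Lf[of "\<lambda>w. (fst w, snd w + 1)"] L(1) continuous_on_const continuous_on_Pair
        continuous_on_add continuous_on_fst continuous_on_snd continuous_on_id)
  obtain m :: int where m0: "\<And>w. L (fst w, snd w + 1) - L w - of_real pi * \<i> = 2 * of_int m * of_real pi * \<i>"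
    by (rule exp_eq_1_constant[OF connected_UNIV k1 e1]) blast
  have e2: "exp (L (snd w, fst w) - L w) = 1" for w
    using S_sym[of "fst w" "snd w"] S_nz[of w] by (simp add: exp_diff L(2)[symmetric])
  have k2: "continuous_on UNIV (\<lambda>w. L (snd w, fst w) - L w)"
    by (intro continuous_on_diff Lf[of "\<lambda>w. (snd w, fst w)"] L(1) continuous_on_Pair
        continuous_on_fst continuous_on_snd continuous_on_id)
  obtain n :: int where n: "\<And>w. L (snd w, fst w) - L w = 2 * of_int n * of_real pi * \<i>"
    by (rule exp_eq_1_constant[OF connected_UNIV k2 e2]) blast
  \<comment> \<open>The sign change of \<open>S\<close> under t + 1 makes the increment of
    \<open>L\<close> an odd multiple of pi i. Being symmetric, \<open>L\<close> gains the same
    amount from either variable, hence twice that amount along the diagonal.\<close>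
  define \<sigma> where "\<sigma> = 2 * real_of_int m + 1"
  have m: "L (s, t + 1) = L (s, t) + of_real \<sigma> * of_real pi * \<i>" for s t
    using m0[of "(s, t)"] by (simp add: \<sigma>_def algebra_simps)
  \<comment> \<open>At (0, 0) the two arguments coincide, which forces the constant \<open>n\<close>
    to be 0.\<close>
  have sym: "L (t, s) = L (s, t)" for s t
    using n[of "(s, t)"] n[of "(0, 0)"] by simp
  \<comment> \<open>The term \<open>ln pi\<close> undoes the factor 1 / pi in the diagonal values of
    \<open>S\<close>.\<close>
  define l where "l s = L (s, s) + of_real (ln pi)" for s
  have "L (s + 1, s + 1) = L (s, s) + 2 * of_real \<sigma> * of_real pi * \<i>" for s
    using m[of "s + 1" s] m[of s s] sym[of s "s + 1"] by (simp add: algebra_simps)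
  then have lper: "l (s + 1) = l s + 2 * of_real \<sigma> * of_real pi * \<i>" for s by (simp add: l_def)
  have lexp: "g' s = exp (l s)" for s
  proof -
    have "exp (l s) = S (s, s) * of_real pi" by (simp add: l_def exp_add L(2) exp_of_real)
    then show ?thesis by (simp add: S_def)
  qed
  have lcont: "continuous_on UNIV l"
    unfolding l_def by (intro continuous_intros continuous_on_compose2[OF L(1)]) auto
  \<comment> \<open>As \<sigma> is odd, the alternative is a modulus of at least 3. From a lowest
    point of the curve all secants point upwards, so the sine of their angle \<open>f\<close> is
    nonnegative. But \<open>f\<close> would change by at least 3 pi over a period and hence meet a
    value where the sine is -1.\<close>
  have "\<bar>\<sigma>\<bar> = 1"
  proof (rule ccontr)
    assume "\<bar>\<sigma>\<bar> \<noteq> 1"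
    then have "m \<noteq> 0" "m \<noteq> - 1" by (auto simp: \<sigma>_def)
    then have "m \<ge> 1 \<or> m \<le> - 2" by linarith
    then have \<sigma>3: "\<bar>\<sigma>\<bar> \<ge> 3" unfolding \<sigma>_def by (elim disjE) (simp_all add: abs_if)
    have gc: "continuous_on UNIV g" using g by (meson continuous_at_imp_continuous_on has_vector_derivative_continuous)
    have "continuous_on {0..1} (\<lambda>t. Im (g t))"
      by (intro continuous_intros continuous_on_subset[OF gc]) auto
    then obtain s where s: "s \<in> {0..1}" "\<And>t. t \<in> {0..1} \<Longrightarrow> Im (g s) \<le> Im (g t)"
      using continuous_attains_inf[of "{0..1::real}" "\<lambda>t. Im (g t)"] by auto
    have min: "Im (g s) \<le> Im (g t)" if "t \<in> {s..s+1}" for t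
    proof (cases "t \<le> 1")
      case True
      then show ?thesis using s that by auto
    next
      case False
      then show ?thesis using s(1) s(2)[of "t - 1"] that per_minus[of t] by auto
    qed
    define f where "f t = Im (L (s, t))" for t
    have fc: "continuous_on UNIV f"
      unfolding f_def by (intro continuous_intros continuous_on_compose2[OF L(1)]) auto
    have f1: "f (s + 1) = f s + \<sigma> * pi" by (simp add: f_def m)
    have pos: "sin (f t) \<ge> 0" if t: "t \<in> {s<..<s+1}" for t
    proof -
      have "sin (pi * (t - s)) > 0" using t by (intro sin_gt_zero) auto
      moreover have "Im (S (s, t)) = Im (g t - g s) / sin (pi * (t - s))"
        using calculation by (simp add: S_def)
      ultimately have "Im (S (s, t)) \<ge> 0" using min[of t] t by simp
      moreover have "Im (S (s, t)) = exp (Re (L (s, t))) * sin (f t)"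
        by (simp add: L(2) Im_exp f_def)
      ultimately show ?thesis by (simp add: zero_le_mult_iff)
    qed
    define lo where "lo = min (f s) (f (s + 1))"
    define hi where "hi = max (f s) (f (s + 1))"
    have gap: "hi - lo \<ge> 3 * pi"
    proof -
      have "hi - lo = \<bar>\<sigma>\<bar> * pi" unfolding hi_def lo_def f1
        using pi_gt_zero by (cases "\<sigma> \<ge> 0") (auto simp: abs_if min_def max_def zero_le_mult_iff simp del: pi_gt_zero)
      then show ?thesis using \<sigma>3 by (simp add: mult_right_mono)
    qed
    \<comment> \<open>This makes \<open>y\<close> the least number above \<open>lo\<close> that is
      congruent to - pi / 2 modulo 2 pi; it is at most lo + 2 pi, hence below
      \<open>hi\<close>.\<close>
    define k where "k = \<lfloor>(lo + pi / 2) / (2 * pi)\<rfloor> + 1"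
    define y where "y = 2 * pi * of_int k - pi / 2"
    have y1: "lo < y"
    proof -
      have "(lo + pi / 2) / (2 * pi) < of_int k" unfolding k_def by linarith
      then show ?thesis by (simp add: y_def field_simps)
    qed
    have y2: "y < hi"
    proof -
      have "of_int k \<le> (lo + pi / 2) / (2 * pi) + 1" unfolding k_def by linarith
      then have "y \<le> lo + 2 * pi" by (simp add: y_def field_simps)
      then show ?thesis using gap pi_gt_zero by linarith
    qed
    have "\<exists>t\<in>{s..s+1}. f t = y"
    proof (cases "f s \<le> f (s + 1)")
      case True
      then show ?thesis
        using IVT'[of f s y "s + 1"] y1 y2 continuous_on_subset[OF fc] by (auto simp: lo_def hi_def)
    next
      case False
      then show ?thesis
        using IVT2'[of f "s + 1" y s] y1 y2 continuous_on_subset[OF fc] by (auto simp: lo_def hi_def)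
    qed
    then obtain t where t: "t \<in> {s..s+1}" "f t = y" by blast
    have "t \<noteq> s" "t \<noteq> s + 1" using t(2) y1 y2 by (auto simp: lo_def hi_def min_def max_def split: if_splits)
    then have "sin y \<ge> 0" using pos[of t] t by auto
    moreover have "sin y = - 1" by (simp add: y_def sin_diff)
    ultimately show False by simp
  qed
  then show ?thesis using that[OF lcont lexp _ lper] by blast
qed

section \<open>The blow-up map\<close>

text \<open>Both signs of v are included, so that v = 0 is an interior line and derivatives there
  are ordinary ones.\<close>

definition strip :: "real \<Rightarrow> (real \<times> real) set" where
  "strip d = {w. \<bar>snd w\<bar> < d}"

lemma open_strip: "open (strip d)"
  unfolding strip_def by (intro open_Collect_less continuous_intros)

lemma convex_strip: "convex (strip d)"
proof -
  have "strip d = UNIV \<times> {-d<..<d}" by (auto simp: strip_def abs_less_iff)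
  then show ?thesis by (simp add: convex_Times)
qed

lemma strip_mono: "e \<le> d \<Longrightarrow> strip e \<subseteq> strip d"
  by (auto simp: strip_def)

text \<open>Periodicity in s reduces the strip to a compact rectangle of half the width, where
  uniform continuity is available.\<close>

lemma strip_uniform:
  fixes f :: "real \<times> real \<Rightarrow> 'b::real_normed_vector"
  assumes d: "d > 0" and f: "continuous_on (strip d) f" and per: "\<And>s v. f (s + 1, v) = f (s, v)" and \<epsilon>: "\<epsilon> > 0"
  obtains e where "0 < e" "e \<le> d" "\<And>s v. \<bar>v\<bar> < e \<Longrightarrow> norm (f (s, v) - f (s, 0)) < \<epsilon>"
proof -
  have K: "compact ({0..1::real} \<times> {-d/2..d/2})" "{0..1} \<times> {-d/2..d/2} \<subseteq> strip d"
    using d by (intro compact_Times compact_Icc, auto simp: strip_def)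
  then have "uniformly_continuous_on ({0..1} \<times> {-d/2..d/2}) f"
    by (intro compact_uniformly_continuous continuous_on_subset[OF f])
  then obtain \<delta> where \<delta>: "\<delta> > 0" "\<And>w w'. w \<in> {0..1} \<times> {-d/2..d/2} \<Longrightarrow> w' \<in> {0..1} \<times> {-d/2..d/2} \<Longrightarrow>
      dist w' w < \<delta> \<Longrightarrow> dist (f w') (f w) < \<epsilon>"
    using \<epsilon> unfolding uniformly_continuous_on_def by metis
  show ?thesis
  proof (rule that[of "min \<delta> (d/2)"])
    fix s v :: real assume v: "\<bar>v\<bar> < min \<delta> (d/2)"
    have "dist (f (frac s, v)) (f (frac s, 0)) < \<epsilon>"
      by (rule \<delta>(2)) (use v d frac_lt_1[of s] in \<open>auto simp: dist_Pair_Pair less_imp_le\<close>)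
    then show "norm (f (s, v) - f (s, 0)) < \<epsilon>"
      by (simp add: dist_norm periodic_frac[where f = "\<lambda>s. f (s, _)", OF per])
  qed (use \<delta> d in auto)
qed

lemma strip_bounded:
  fixes f :: "real \<times> real \<Rightarrow> 'b::real_normed_vector"
  assumes d: "d > 0" and f: "continuous_on (strip d) f" and per: "\<And>s v. f (s + 1, v) = f (s, v)"
  obtains M where "M > 0" "\<And>s v. \<bar>v\<bar> \<le> d/2 \<Longrightarrow> norm (f (s, v)) \<le> M"
proof -
  have "compact (f ` ({0..1} \<times> {-d/2..d/2}))"
    using d by (intro compact_continuous_image continuous_on_subset[OF f] compact_Times compact_Icc) (auto simp: strip_def)
  then have "bounded (f ` ({0..1} \<times> {-d/2..d/2}))" by (rule compact_imp_bounded)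
  then obtain M where M: "M > 0" "\<And>w. w \<in> {0..1} \<times> {-d/2..d/2} \<Longrightarrow> norm (f w) \<le> M"
    unfolding bounded_pos by blast
  show ?thesis
  proof (rule that[OF M(1)])
    show "norm (f (s, v)) \<le> M" if v: "\<bar>v\<bar> \<le> d/2" for s v
    proof -
      have "- d/2 \<le> v \<and> v \<le> d/2" using v by linarith
      then show ?thesis
        using M(2)[of "(frac s, v)"] frac_lt_1[of s] by (simp add: periodic_frac[where f = "\<lambda>s. f (s, _)", OF per] less_imp_le)
    qed
  qed
qed

text \<open>This is the device by which each nondegeneracy condition known on the line v = 0 is
  extended, with a uniform lower bound, to a thin strip.\<close>

lemma strip_positive:
  fixes f :: "real \<times> real \<Rightarrow> real"
  assumes d: "d > 0" and f: "continuous_on (strip d) f" and per: "\<And>s v. f (s + 1, v) = f (s, v)"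
    and pos: "\<And>s. f (s, 0) > 0"
  obtains e m where "0 < e" "e \<le> d" "m > 0" "\<And>s v. \<bar>v\<bar> < e \<Longrightarrow> m \<le> f (s, v)"
proof -
  have "continuous_on {0..1} (\<lambda>s. f (s, 0))"
    by (rule continuous_on_compose2[OF f]) (use d in \<open>auto intro!: continuous_intros simp: strip_def\<close>)
  then obtain s0 where s0: "s0 \<in> {0..1}" "\<And>s. s \<in> {0..1} \<Longrightarrow> f (s0, 0) \<le> f (s, 0)"
    using continuous_attains_inf[of "{0..1::real}" "\<lambda>s. f (s, 0)"] by auto
  have le: "f (s0, 0) \<le> f (s, 0)" for s
    using s0(2)[of "frac s"] frac_lt_1[of s] by (simp add: periodic_frac[where f = "\<lambda>s. f (s, _)", OF per] less_imp_le)
  obtain e where e: "0 < e" "e \<le> d" "\<And>s v. \<bar>v\<bar> < e \<Longrightarrow> norm (f (s, v) - f (s, 0)) < f (s0, 0) / 2"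
    using strip_uniform[OF d f per, of "f (s0, 0) / 2"] pos[of s0] by auto
  show ?thesis
  proof (rule that[OF e(1,2), of "f (s0, 0) / 2"])
    show "f (s0, 0) / 2 \<le> f (s, v)" if "\<bar>v\<bar> < e" for s v
      using e(3)[OF that, of s] le[of s] unfolding real_norm_def by linarith
  qed (use pos[of s0] in simp)
qed

lemma strip_mvt:
  fixes f :: "real \<times> real \<Rightarrow> real"
  assumes f: "\<And>w. w \<in> strip d \<Longrightarrow> (f has_derivative (\<lambda>h. fst h * fs w + snd h * fv w)) (at w)"
    and PQ: "P \<in> strip d" "Q \<in> strip d"
  obtains \<xi> where "\<xi> \<in> strip d" "f Q - f P = (fst Q - fst P) * fs \<xi> + (snd Q - snd P) * fv \<xi>"
proof -
  have mem: "P + t *\<^sub>R (Q - P) \<in> strip d" if "0 \<le> t" "t \<le> 1" for t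
  proof -
    have "(1 - t) *\<^sub>R P + t *\<^sub>R Q \<in> strip d"
      using convexD_alt[OF convex_strip PQ that] .
    then show ?thesis by (simp add: algebra_simps)
  qed
  have "\<exists>z>0. z < 1 \<and> f (P + 1 *\<^sub>R (Q - P)) - f (P + 0 *\<^sub>R (Q - P))
    = (1 - 0) * (fst (Q - P) * fs (P + z *\<^sub>R (Q - P)) + snd (Q - P) * fv (P + z *\<^sub>R (Q - P)))"
  proof (rule MVT2)
    fix t :: real assume t: "0 \<le> t" "t \<le> 1"
    have "((\<lambda>t. P + t *\<^sub>R (Q - P)) has_derivative (\<lambda>h. h *\<^sub>R (Q - P))) (at t)"
      by (auto intro!: derivative_eq_intros)
    from diff_chain_at[OF this f[OF mem[OF t]]]
    show "((\<lambda>t. f (P + t *\<^sub>R (Q - P))) has_real_derivative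
      fst (Q - P) * fs (P + t *\<^sub>R (Q - P)) + snd (Q - P) * fv (P + t *\<^sub>R (Q - P))) (at t)"
      unfolding has_field_derivative_def o_def by (rule has_derivative_eq_rhs) (auto simp: algebra_simps)
  qed simp
  then obtain z where "0 < z" "z < 1" "f Q - f P = fst (Q - P) * fs (P + z *\<^sub>R (Q - P)) + snd (Q - P) * fv (P + z *\<^sub>R (Q - P))"
    by auto
  then show ?thesis using that[OF mem[of z]] by simp
qed

text \<open>Here \<psi> is (x, y) / v as a complex number, \<open>l\<close> a logarithm of it along
  v = 0, and \<sigma> the number of turns. The quantity in \<open>curv\<close> is the s-derivative
  of the angle of \<psi>(s, 0), so the angle is strictly monotone there.\<close>

locale winding_strip =
  fixes d :: real and \<psi> \<psi>s \<psi>v :: "real \<times> real \<Rightarrow> complex" and l :: "real \<Rightarrow> complex" and \<sigma> :: real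
  assumes d: "d > 0"
    and \<psi>: "\<And>w. w \<in> strip d \<Longrightarrow> (\<psi> has_derivative (\<lambda>h. fst h *\<^sub>R \<psi>s w + snd h *\<^sub>R \<psi>v w)) (at w)"
    and cont: "continuous_on (strip d) \<psi>s" "continuous_on (strip d) \<psi>v"
    and per: "\<And>s v. \<psi> (s + 1, v) = \<psi> (s, v)" "\<And>s v. \<psi>s (s + 1, v) = \<psi>s (s, v)" "\<And>s v. \<psi>v (s + 1, v) = \<psi>v (s, v)"
    and l: "continuous_on UNIV l" "\<And>s. \<psi> (s, 0) = exp (l s)" "\<bar>\<sigma>\<bar> = 1"
      "\<And>s. l (s + 1) = l s + 2 * of_real \<sigma> * of_real pi * \<i>"
    and curv: "\<And>s. Im (\<psi>s (s, 0) / \<psi> (s, 0)) \<noteq> 0"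
begin

lemma continuous_\<psi>: "continuous_on (strip d) \<psi>"
  using \<psi> by (meson has_derivative_continuous continuous_at_imp_continuous_on)

text \<open>The increment of a continuous logarithm over one period is constant on the connected
  strip. It can thus be computed on v = 0, where \<Lambda> and \<open>l\<close> differ by a
  constant.\<close>

lemma ex_log:
  obtains e \<Lambda> where "0 < e" "e \<le> d" "continuous_on (strip e) \<Lambda>" "\<And>w. w \<in> strip e \<Longrightarrow> \<psi> w = exp (\<Lambda> w)"
    "\<And>w. w \<in> strip e \<Longrightarrow> (\<Lambda> has_derivative (\<lambda>h. fst h *\<^sub>R (\<psi>s w / \<psi> w) + snd h *\<^sub>R (\<psi>v w / \<psi> w))) (at w)"
    "\<And>s v. \<bar>v\<bar> < e \<Longrightarrow> \<Lambda> (s + 1, v) = \<Lambda> (s, v) + 2 * of_real \<sigma> * of_real pi * \<i>"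
proof -
  obtain e m where e: "0 < e" "e \<le> d" "m > 0" "\<And>s v. \<bar>v\<bar> < e \<Longrightarrow> m \<le> norm (\<psi> (s, v))"
    using strip_positive[OF d, of "\<lambda>w. norm (\<psi> w)"] continuous_on_norm[OF continuous_\<psi>] per l(2)
    by (auto simp: norm_exp_eq_Re)
  have nz: "\<psi> w \<noteq> 0" if "w \<in> strip e" for w
    using e(4)[of "snd w" "fst w"] that e(3) by (auto simp: strip_def)
  have c\<psi>: "continuous_on (strip e) \<psi>" using continuous_\<psi> strip_mono[OF e(2)] by (rule continuous_on_subset)
  obtain \<Lambda> where \<Lambda>: "continuous_on (strip e) \<Lambda>" "\<And>w. w \<in> strip e \<Longrightarrow> \<psi> w = exp (\<Lambda> w)"
    using continuous_logarithm_on_contractible[OF c\<psi> convex_imp_contractible[OF convex_strip] nz] by metis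
  have D: "(\<Lambda> has_derivative (\<lambda>h. fst h *\<^sub>R (\<psi>s w / \<psi> w) + snd h *\<^sub>R (\<psi>v w / \<psi> w))) (at w)" if w: "w \<in> strip e" for w
  proof -
    have "w \<in> strip d" using w strip_mono[OF e(2)] by blast
    from continuous_log_has_derivative[OF open_strip w \<Lambda> \<psi>[OF this]] show ?thesis
      by (simp add: add_divide_distrib scaleR_conv_of_real)
  qed
  have in_strip: "(s, v) \<in> strip e \<longleftrightarrow> \<bar>v\<bar> < e" for s v by (simp add: strip_def)
  have c0: "continuous_on UNIV (\<lambda>s. \<Lambda> (s, 0) - l s)"
    by (intro continuous_on_diff l(1) continuous_on_compose2[OF \<Lambda>(1), of UNIV "\<lambda>s. (s, 0)"])
       (use e(1) in \<open>auto intro!: continuous_intros simp: in_strip\<close>)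
  have e0: "exp (\<Lambda> (s, 0) - l s) = 1" for s
    using \<Lambda>(2)[of "(s, 0)"] l(2)[of s] e(1) by (simp add: exp_diff in_strip)
  obtain m0 :: int where m0: "\<And>s. \<Lambda> (s, 0) - l s = 2 * of_int m0 * of_real pi * \<i>"
    by (rule exp_eq_1_constant[OF connected_UNIV c0 e0]) blast
  have cs: "continuous_on (strip e) (\<lambda>w. \<Lambda> (fst w + 1, snd w) - \<Lambda> w)"
    by (intro continuous_on_diff \<Lambda>(1) continuous_on_compose2[OF \<Lambda>(1), of _ "\<lambda>w. (fst w + 1, snd w)"])
       (auto intro!: continuous_intros simp: strip_def)
  have es: "exp (\<Lambda> (fst w + 1, snd w) - \<Lambda> w) = 1" if "w \<in> strip e" for w
    using \<Lambda>(2)[OF that] \<Lambda>(2)[of "(fst w + 1, snd w)"] that nz[OF that] per(1)[of "fst w" "snd w"]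
    by (simp add: exp_diff strip_def)
  obtain n0 :: int where n0: "\<And>w. w \<in> strip e \<Longrightarrow> \<Lambda> (fst w + 1, snd w) - \<Lambda> w = 2 * of_int n0 * of_real pi * \<i>"
    by (rule exp_eq_1_constant[OF convex_connected[OF convex_strip] cs es]) blast+
  have "2 * of_int n0 * of_real pi * \<i> = 2 * of_real \<sigma> * of_real pi * \<i>"
    using n0[of "(0, 0)"] m0[of 0] m0[of 1] l(4)[of 0] e(1) by (simp add: in_strip algebra_simps)
  then have "\<Lambda> (s + 1, v) = \<Lambda> (s, v) + 2 * of_real \<sigma> * of_real pi * \<i>" if "\<bar>v\<bar> < e" for s v
    using n0[of "(s, v)"] that by (simp add: in_strip algebra_simps)
  with e(1,2) \<Lambda> D show ?thesis by (rule that)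
qed

text \<open>For two points with the same angle Im \<open>\<Lambda>\<close> and the same radius, the mean value theorem applied to each of these
  functions gives a homogeneous 2x2 system for their difference. Its rows are taken at different points \<open>\<xi>\<close>, \<open>\<eta>\<close>, but on a
  thin strip the determinant is nonzero nevertheless.\<close>

lemma polar_coordinates:
  obtains e \<Lambda> m where "0 < e" "e \<le> d" "m > 0" "continuous_on (strip e) \<Lambda>" "\<And>w. w \<in> strip e \<Longrightarrow> \<psi> w = exp (\<Lambda> w)"
    "\<And>s v. \<bar>v\<bar> < e \<Longrightarrow> \<Lambda> (s + 1, v) = \<Lambda> (s, v) + 2 * of_real \<sigma> * of_real pi * \<i>"
    "\<And>w. w \<in> strip e \<Longrightarrow> m \<le> norm (\<psi> w)"
    "\<And>s v. \<bar>v\<bar> < e \<Longrightarrow> inj (\<lambda>s. Im (\<Lambda> (s, v)))"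
    "\<And>P Q. \<lbrakk>P \<in> strip e; Q \<in> strip e; Im (\<Lambda> P) = Im (\<Lambda> Q); snd P * exp (Re (\<Lambda> P)) = snd Q * exp (Re (\<Lambda> Q))\<rbrakk> \<Longrightarrow> P = Q"
    "\<And>w. w \<in> strip e \<Longrightarrow> Im (cnj (\<psi>s w) * (\<psi> w + snd w *\<^sub>R \<psi>v w)) \<noteq> 0"
proof -
  obtain e \<Lambda> where e: "0 < e" "e \<le> d" and \<Lambda>: "continuous_on (strip e) \<Lambda>" "\<And>w. w \<in> strip e \<Longrightarrow> \<psi> w = exp (\<Lambda> w)"
    and D: "\<And>w. w \<in> strip e \<Longrightarrow> (\<Lambda> has_derivative (\<lambda>h. fst h *\<^sub>R (\<psi>s w / \<psi> w) + snd h *\<^sub>R (\<psi>v w / \<psi> w))) (at w)"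
    and \<Lambda>per: "\<And>s v. \<bar>v\<bar> < e \<Longrightarrow> \<Lambda> (s + 1, v) = \<Lambda> (s, v) + 2 * of_real \<sigma> * of_real pi * \<i>"
    using that by (rule ex_log)
  note sub = strip_mono[OF e(2)]
  have nz: "\<psi> w \<noteq> 0" if "w \<in> strip e" for w using \<Lambda>(2)[OF that] by simp
  note C = continuous_on_subset[OF continuous_\<psi> sub] continuous_on_subset[OF cont(1) sub] continuous_on_subset[OF cont(2) sub]
  \<comment> \<open>The angle Im \<Lambda> will have partial derivatives a and b, the radius v *
    norm \<psi> will have v * p and q. At v = 0 this matrix is triangular with diagonal entries a
    and norm \<psi>, both nonzero.\<close>
  define a where "a w = Im (\<psi>s w / \<psi> w)" for w
  define b where "b w = Im (\<psi>v w / \<psi> w)" for w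
  define p where "p w = norm (\<psi> w) * Re (\<psi>s w / \<psi> w)" for w
  define q where "q w = norm (\<psi> w) * (1 + snd w * Re (\<psi>v w / \<psi> w))" for w
  define J where "J w = Im (cnj (\<psi>s w) * (\<psi> w + snd w *\<^sub>R \<psi>v w))" for w
  have cont_abpq: "continuous_on (strip e) (\<lambda>w. \<bar>a w\<bar>)" "continuous_on (strip e) b" "continuous_on (strip e) p"
    "continuous_on (strip e) q" "continuous_on (strip e) (\<lambda>w. \<bar>J w\<bar>)" "continuous_on (strip e) (\<lambda>w. norm (\<psi> w))"
    unfolding a_def b_def p_def q_def J_def by (intro continuous_intros C ballI nz; assumption)+
  have per_abpq: "\<bar>a (s + 1, v)\<bar> = \<bar>a (s, v)\<bar>" "b (s + 1, v) = b (s, v)" "p (s + 1, v) = p (s, v)" "q (s + 1, v) = q (s, v)"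
    "\<bar>J (s + 1, v)\<bar> = \<bar>J (s, v)\<bar>" "norm (\<psi> (s + 1, v)) = norm (\<psi> (s, v))" for s v
    by (simp_all add: a_def b_def p_def q_def J_def per)
  have nz0: "\<psi> (s, 0) \<noteq> 0" for s by (simp add: l(2))
  \<comment> \<open>With k = \<psi>s / \<psi> the value is - Im k times the squared norm of \<psi>,
    so \<open>curv\<close> applies.\<close>
  have J0: "J (s, 0) \<noteq> 0" for s
  proof -
    define k where "k = \<psi>s (s, 0) / \<psi> (s, 0)"
    have "\<psi>s (s, 0) = k * \<psi> (s, 0)" using nz0[of s] by (simp add: k_def)
    then have "J (s, 0) = Im (cnj k * complex_of_real ((norm (\<psi> (s, 0)))\<^sup>2))"
      unfolding J_def complex_norm_square by (simp add: mult_ac)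
    also have "\<dots> = - Im k * (norm (\<psi> (s, 0)))\<^sup>2" by (simp del: of_real_power)
    finally show ?thesis using curv[of s] nz0[of s] by (simp add: k_def)
  qed
  obtain e1 m1 where m1: "0 < e1" "e1 \<le> e" "m1 > 0" "\<And>s v. \<bar>v\<bar> < e1 \<Longrightarrow> m1 \<le> \<bar>a (s, v)\<bar>"
    using strip_positive[OF e(1) cont_abpq(1) per_abpq(1)] curv by (auto simp: a_def)
  obtain e2 \<mu> where \<mu>: "0 < e2" "e2 \<le> e" "\<mu> > 0" "\<And>s v. \<bar>v\<bar> < e2 \<Longrightarrow> \<mu> \<le> q (s, v)"
    using strip_positive[OF e(1) cont_abpq(4) per_abpq(4)] nz0 by (auto simp: q_def)
  obtain e3 m3 where m3: "0 < e3" "e3 \<le> e" "m3 > 0" "\<And>s v. \<bar>v\<bar> < e3 \<Longrightarrow> m3 \<le> \<bar>J (s, v)\<bar>"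
    using strip_positive[OF e(1) cont_abpq(5) per_abpq(5)] J0 by auto
  obtain e4 m where m: "0 < e4" "e4 \<le> e" "m > 0" "\<And>s v. \<bar>v\<bar> < e4 \<Longrightarrow> m \<le> norm (\<psi> (s, v))"
    using strip_positive[OF e(1) cont_abpq(6) per_abpq(6)] nz0 by auto
  obtain M where M: "M > 0" "\<And>s v. \<bar>v\<bar> \<le> e/2 \<Longrightarrow> norm (b (s, v)) \<le> M"
    using strip_bounded[OF e(1) cont_abpq(2) per_abpq(2)] by blast
  obtain N where N: "N > 0" "\<And>s v. \<bar>v\<bar> \<le> e/2 \<Longrightarrow> norm (p (s, v)) \<le> N"
    using strip_bounded[OF e(1) cont_abpq(3) per_abpq(3)] by blast
  \<comment> \<open>For v below this bound the off-diagonal product is at most half of m1 * \<mu>, a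
    lower bound for the diagonal product, even when the two rows are taken at different
    points.\<close>
  define X where "X = m1 * \<mu> / (2 * M * N)"
  have X: "X > 0" using m1(3) \<mu>(3) M(1) N(1) by (simp add: X_def)
  define f where "f = min (min e1 e2) (min (min e3 e4) (min (e/2) X))"
  have f: "0 < f" "f \<le> e1" "f \<le> e2" "f \<le> e3" "f \<le> e4" "f \<le> e/2" "f \<le> X"
    using m1(1) \<mu>(1) m3(1) m(1) e(1) X unfolding f_def by linarith+
  have fe: "f \<le> e" using f e by linarith
  have fsub: "strip f \<subseteq> strip e" by (rule strip_mono[OF fe])
  have gap: "f * (M * N) < m1 * \<mu>"
  proof -
    have "f * (M * N) \<le> m1 * \<mu> / (2 * M * N) * (M * N)" using f(7) M(1) N(1) unfolding X_def by (intro mult_right_mono) auto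
    also have "\<dots> = m1 * \<mu> / 2" using M(1) N(1) by simp
    finally show ?thesis using m1(3) \<mu>(3) by (smt (verit) field_sum_of_halves mult_pos_pos)
  qed
  define \<Theta> where "\<Theta> w = Im (\<Lambda> w)" for w
  define r where "r w = snd w * exp (Re (\<Lambda> w))" for w
  have D\<Theta>: "(\<Theta> has_derivative (\<lambda>h. fst h * a w + snd h * b w)) (at w)" if "w \<in> strip f" for w
  proof -
    have "w \<in> strip e" using that fsub by blast
    from bounded_linear.has_derivative[OF bounded_linear_Im D[OF this]]
    show ?thesis unfolding \<Theta>_def[abs_def] a_def b_def by simp
  qed
  have Dr: "(r has_derivative (\<lambda>h. fst h * (snd w * p w) + snd h * q w)) (at w)" if "w \<in> strip f" for w
  proof -
    have w: "w \<in> strip e" using that fsub by blast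
    have "norm (\<psi> w) = exp (Re (\<Lambda> w))" using \<Lambda>(2)[OF w] by simp
    then show ?thesis
      unfolding r_def[abs_def]
      by (auto intro!: derivative_eq_intros D[OF w] simp: p_def q_def algebra_simps fun_eq_iff)
  qed
  have st: "s \<in> strip f \<Longrightarrow> \<bar>snd s\<bar> < f" for s by (simp add: strip_def)
  have inj2: "P = Q" if PQ: "P \<in> strip f" "Q \<in> strip f" and eq: "\<Theta> P = \<Theta> Q" "r P = r Q" for P Q
  proof -
    define h1 where "h1 = fst Q - fst P"
    define h2 where "h2 = snd Q - snd P"
    obtain \<xi> where \<xi>: "\<xi> \<in> strip f" "h1 * a \<xi> + h2 * b \<xi> = 0"
      using strip_mvt[of f \<Theta> a b, OF D\<Theta> PQ] eq(1) unfolding h1_def h2_def by (metis diff_self)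
    obtain \<eta> where \<eta>: "\<eta> \<in> strip f" "h1 * (snd \<eta> * p \<eta>) + h2 * q \<eta> = 0"
      using strip_mvt[of f r "\<lambda>w. snd w * p w" q, OF Dr PQ] eq(2) unfolding h1_def h2_def by (metis diff_self)
    have bd: "m1 \<le> \<bar>a \<xi>\<bar>" "\<bar>b \<xi>\<bar> \<le> M" "\<mu> \<le> q \<eta>" "\<bar>p \<eta>\<bar> \<le> N" "\<bar>snd \<eta>\<bar> \<le> f"
      using m1(4)[of "snd \<xi>" "fst \<xi>"] M(2)[of "snd \<xi>" "fst \<xi>"] \<mu>(4)[of "snd \<eta>" "fst \<eta>"] N(2)[of "snd \<eta>" "fst \<eta>"]
        st[OF \<xi>(1)] st[OF \<eta>(1)] f by auto
    have "\<bar>h1\<bar> * \<bar>a \<xi>\<bar> = \<bar>h2\<bar> * \<bar>b \<xi>\<bar>" using \<xi>(2) by (metis abs_minus_cancel abs_mult add_eq_0_iff)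
    then have i1: "\<bar>h1\<bar> * m1 \<le> \<bar>h2\<bar> * M" using mult_left_mono[OF bd(1), of "\<bar>h1\<bar>"] mult_left_mono[OF bd(2), of "\<bar>h2\<bar>"] by auto
    have "\<bar>h2\<bar> * \<bar>q \<eta>\<bar> = \<bar>h1\<bar> * (\<bar>snd \<eta>\<bar> * \<bar>p \<eta>\<bar>)" using \<eta>(2) by (metis abs_minus_cancel abs_mult add_eq_0_iff)
    then have i2: "\<bar>h2\<bar> * \<mu> \<le> \<bar>h1\<bar> * (f * N)"
      using mult_left_mono[OF bd(3), of "\<bar>h2\<bar>"] mult_left_mono[OF mult_mono[OF bd(5,4)], of "\<bar>h1\<bar>"] f(1) bd(3) \<mu>(3) by auto
    have "\<bar>h1\<bar> * (m1 * \<mu>) \<le> \<bar>h2\<bar> * \<mu> * M" using mult_right_mono[OF i1, of \<mu>] \<mu>(3) by (simp add: mult_ac)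
    also have "\<dots> \<le> \<bar>h1\<bar> * (f * N) * M" using i2 M(1) by (intro mult_right_mono) auto
    finally have "\<bar>h1\<bar> * (m1 * \<mu>) \<le> \<bar>h1\<bar> * (f * (M * N))" by (simp add: mult_ac)
    then have "h1 = 0" using gap by (simp add: mult_le_cancel_left)
    moreover from this have "h2 = 0" using i2 \<mu>(3) by (simp add: mult_le_0_iff)
    ultimately show ?thesis by (simp add: h1_def h2_def prod_eq_iff)
  qed
  have inj1: "inj (\<lambda>s. Im (\<Lambda> (s, v)))" if v: "\<bar>v\<bar> < f" for v
  proof (rule linorder_inj_onI)
    fix x y :: real assume "x < y"
    \<comment> \<open>For equal v only the term with \<open>a\<close> survives, and \<open>a\<close>
      has no zero on the strip.\<close>
    obtain \<xi> where \<xi>: "\<xi> \<in> strip \<bar>f\<bar>" "\<Theta> (y, v) - \<Theta> (x, v) = (y - x) * a \<xi>"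
      using strip_mvt[of f \<Theta> a b "(x, v)" "(y, v)", OF D\<Theta>] v f(1) by (auto simp: strip_def)
    have "a \<xi> \<noteq> 0" using m1(4)[of "snd \<xi>" "fst \<xi>"] m1(3) \<xi>(1) f by (auto simp: strip_def)
    then show "Im (\<Lambda> (x, v)) \<noteq> Im (\<Lambda> (y, v))" using \<xi>(2) \<open>x < y\<close> by (auto simp: \<Theta>_def)
  qed auto
  show ?thesis
  proof (rule that[OF f(1) _ m(3)])
    show "f \<le> d" using fe e by simp
    show "continuous_on (strip f) \<Lambda>" using \<Lambda>(1) fsub by (rule continuous_on_subset)
    show "\<psi> w = exp (\<Lambda> w)" if "w \<in> strip f" for w using that fsub \<Lambda>(2) by blast
    show "\<Lambda> (s + 1, v) = \<Lambda> (s, v) + 2 * of_real \<sigma> * of_real pi * \<i>" if "\<bar>v\<bar> < f" for s v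
      using \<Lambda>per that fe by simp
    show "m \<le> norm (\<psi> w)" if "w \<in> strip f" for w using m(4)[of "snd w" "fst w"] st[OF that] f by simp
    show "Im (cnj (\<psi>s w) * (\<psi> w + snd w *\<^sub>R \<psi>v w)) \<noteq> 0" if "w \<in> strip f" for w
      using m3(4)[of "snd w" "fst w"] m3(3) st[OF that] f by (auto simp: J_def)
  qed (use inj1 inj2 in \<open>auto simp: \<Theta>_def r_def\<close>)
qed

end

context winding_strip
begin

text \<open>For surjectivity, the angle is a bijective function of s for every v, so the points of a given angle form a curve
  s = \<open>\<tau> v\<close>, along which the radius takes all small values.\<close>

lemma blow_up_map:
  obtains e m \<rho> where "0 < e" "e \<le> d" "m > 0" "\<rho> > 0" "\<And>w. w \<in> strip e \<Longrightarrow> m \<le> norm (\<psi> w)"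
    "\<And>w. w \<in> strip e \<Longrightarrow> Im (cnj (\<psi>s w) * (\<psi> w + snd w *\<^sub>R \<psi>v w)) \<noteq> 0"
    "\<And>s v s' v'. \<lbrakk>0 < v; v < e; 0 < v'; v' < e; v *\<^sub>R \<psi> (s, v) = v' *\<^sub>R \<psi> (s', v')\<rbrakk> \<Longrightarrow> v = v' \<and> (\<exists>k. s' = s + of_int k)"
    "\<And>w. \<lbrakk>w \<noteq> 0; norm w < \<rho>\<rbrakk> \<Longrightarrow> \<exists>s v. 0 < v \<and> v < e \<and> v *\<^sub>R \<psi> (s, v) = w"
proof -
  obtain e \<Lambda> m where e: "0 < e" "e \<le> d" and m: "m > 0" and \<Lambda>c: "continuous_on (strip e) \<Lambda>"
    and \<Lambda>: "\<And>w. w \<in> strip e \<Longrightarrow> \<psi> w = exp (\<Lambda> w)"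
    and \<Lambda>per: "\<And>s v. \<bar>v\<bar> < e \<Longrightarrow> \<Lambda> (s + 1, v) = \<Lambda> (s, v) + 2 * of_real \<sigma> * of_real pi * \<i>"
    and low: "\<And>w. w \<in> strip e \<Longrightarrow> m \<le> norm (\<psi> w)"
    and inj1: "\<And>s v. \<bar>v\<bar> < e \<Longrightarrow> inj (\<lambda>s. Im (\<Lambda> (s, v)))"
    and inj2: "\<And>P Q. \<lbrakk>P \<in> strip e; Q \<in> strip e; Im (\<Lambda> P) = Im (\<Lambda> Q); snd P * exp (Re (\<Lambda> P)) = snd Q * exp (Re (\<Lambda> Q))\<rbrakk> \<Longrightarrow> P = Q"
    and jac: "\<And>w. w \<in> strip e \<Longrightarrow> Im (cnj (\<psi>s w) * (\<psi> w + snd w *\<^sub>R \<psi>v w)) \<noteq> 0"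
    using that by (rule polar_coordinates)
  have mem: "(s, v) \<in> strip e \<longleftrightarrow> \<bar>v\<bar> < e" for s v by (simp add: strip_def)
  have \<sigma>: "\<sigma> = 1 \<or> \<sigma> = - 1" using l(3) by linarith
  have \<Lambda>nat: "\<Lambda> (s + of_nat n, v) = \<Lambda> (s, v) + 2 * of_real (\<sigma> * of_nat n) * of_real pi * \<i>" if "\<bar>v\<bar> < e" for s v n
  proof (induction n)
    case (Suc n)
    then show ?case using \<Lambda>per[OF that, of "s + of_nat n"] by (simp add: algebra_simps)
  qed simp
  have \<Lambda>int: "\<Lambda> (s + of_int k, v) = \<Lambda> (s, v) + 2 * of_real (\<sigma> * of_int k) * of_real pi * \<i>" if "\<bar>v\<bar> < e" for s v k
  proof (cases "k \<ge> 0")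
    case True
    then show ?thesis using \<Lambda>nat[OF that, of s "nat k"] by simp
  next
    case False
    then show ?thesis using \<Lambda>nat[OF that, of "s + of_int k" "nat (- k)"] by (simp add: algebra_simps)
  qed
  have inj: "v = v' \<and> (\<exists>k. s' = s + of_int k)"
    if v: "0 < v" "v < e" "0 < v'" "v' < e" and eq: "v *\<^sub>R \<psi> (s, v) = v' *\<^sub>R \<psi> (s', v')" for s v s' v'
  proof -
    have ev: "\<bar>v\<bar> < e" "\<bar>v'\<bar> < e" using v by auto
    have ex: "\<psi> (s, v) = exp (\<Lambda> (s, v))" "\<psi> (s', v') = exp (\<Lambda> (s', v'))"
      using \<Lambda> ev by (simp_all add: mem)
    have "norm (v *\<^sub>R \<psi> (s, v)) = norm (v' *\<^sub>R \<psi> (s', v'))" using eq by simp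
    then have r: "v * exp (Re (\<Lambda> (s, v))) = v' * exp (Re (\<Lambda> (s', v')))"
      using v by (simp add: ex)
    have "cis (Im (\<Lambda> (s, v))) = cis (Im (\<Lambda> (s', v')))"
    proof -
      have "(v * exp (Re (\<Lambda> (s, v)))) *\<^sub>R cis (Im (\<Lambda> (s, v))) = (v' * exp (Re (\<Lambda> (s', v')))) *\<^sub>R cis (Im (\<Lambda> (s', v')))"
        using eq by (simp add: ex exp_eq_polar scaleR_conv_of_real mult_ac)
      then show ?thesis using r v by simp
    qed
    then obtain k :: int where k0: "\<i> * of_real (Im (\<Lambda> (s, v))) = \<i> * of_real (Im (\<Lambda> (s', v'))) + (of_int (2 * k) * pi) * \<i>"
      unfolding cis_conv_exp exp_eq by blast
    have k: "Im (\<Lambda> (s, v)) = Im (\<Lambda> (s', v')) + 2 * pi * of_int k"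
      using arg_cong[OF k0, of Im] by simp
    \<comment> \<open>Each period adds 2 pi \<sigma> to the angle, so shifting by \<open>j\<close>
      periods accounts for the difference of 2 pi k; the sign \<sigma> is its own inverse.\<close>
    define j where "j = (if \<sigma> = 1 then k else - k)"
    have j: "\<sigma> * of_int j = of_int k" using \<sigma> by (auto simp: j_def)
    have "(s, v) = (s' + of_int j, v')"
    proof (rule inj2)
      show "Im (\<Lambda> (s, v)) = Im (\<Lambda> (s' + of_int j, v'))"
        unfolding \<Lambda>int[OF ev(2)] j using k by simp
      show "snd (s, v) * exp (Re (\<Lambda> (s, v))) = snd (s' + of_int j, v') * exp (Re (\<Lambda> (s' + of_int j, v')))"
        unfolding \<Lambda>int[OF ev(2)] j using r by simp
    qed (use ev in \<open>simp_all add: mem\<close>)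
    then have "v = v'" "s' = s + of_int (- j)" by auto
    then show ?thesis by blast
  qed
  have line: "continuous_on UNIV (\<lambda>s. Im (\<Lambda> (s, v)))" if "\<bar>v\<bar> < e" for v
    by (intro continuous_on_Im continuous_on_compose2[OF \<Lambda>c, of UNIV "\<lambda>s. (s, v)"])
       (use that in \<open>auto intro!: continuous_intros simp: mem\<close>)
  have ivt: "\<exists>s\<in>{a..b}. Im (\<Lambda> (s, v)) = \<theta>"
    if "\<bar>v\<bar> < e" "a \<le> b" "Im (\<Lambda> (a, v)) < \<theta> \<and> \<theta> < Im (\<Lambda> (b, v)) \<or> Im (\<Lambda> (b, v)) < \<theta> \<and> \<theta> < Im (\<Lambda> (a, v))" for v a b \<theta>
    using that IVT'[of "\<lambda>s. Im (\<Lambda> (s, v))" a \<theta> b] IVT2'[of "\<lambda>s. Im (\<Lambda> (s, v))" b \<theta> a]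
      continuous_on_subset[OF line[OF that(1)]] by fastforce
  have full: "\<exists>!s. Im (\<Lambda> (s, v)) = \<theta>" if v: "\<bar>v\<bar> < e" for v \<theta>
  proof -
    obtain n :: nat where n: "\<bar>\<theta> - Im (\<Lambda> (0, v))\<bar> < 2 * pi * real n"
      using reals_Archimedean2[of "\<bar>\<theta> - Im (\<Lambda> (0, v))\<bar> / (2 * pi)"] by (auto simp: field_simps)
    have "Im (\<Lambda> (real n, v)) = Im (\<Lambda> (0, v)) + \<sigma> * (2 * pi * real n)"
      using \<Lambda>int[OF v, of 0 "int n"] by simp
    moreover have "Im (\<Lambda> (- real n, v)) = Im (\<Lambda> (0, v)) - \<sigma> * (2 * pi * real n)"
      using \<Lambda>int[OF v, of 0 "- int n"] by simp
    ultimately have "\<exists>s\<in>{- real n..real n}. Im (\<Lambda> (s, v)) = \<theta>"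
      using n \<sigma> by (intro ivt[OF v]) (auto simp: abs_less_iff)
    then show ?thesis using inj1[OF v] by (auto simp: inj_def)
  qed
  \<comment> \<open>Along the curve of constant angle the radius is 0 at v = 0 and at least m * (e /
    2) at v = e / 2. This is where the size of the covered disc comes from.\<close>
  have surj: "\<exists>s v. 0 < v \<and> v < e \<and> v *\<^sub>R \<psi> (s, v) = w" if w: "w \<noteq> 0" "norm w < m * (e / 2)" for w
  proof -
    define \<theta> where "\<theta> = Arg w"
    define \<tau> where "\<tau> v = (THE s. Im (\<Lambda> (s, v)) = \<theta>)" for v
    have \<tau>: "Im (\<Lambda> (\<tau> v, v)) = \<theta>" if "\<bar>v\<bar> < e" for v
      unfolding \<tau>_def by (rule theI'[OF full[OF that]])
    have \<tau>u: "\<tau> v = s" if "\<bar>v\<bar> < e" "Im (\<Lambda> (s, v)) = \<theta>" for v s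
      using full[OF that(1), of \<theta>] \<tau>[OF that(1)] that(2) by blast
    have \<tau>c: "isCont \<tau> v0" if v0: "\<bar>v0\<bar> < e" for v0
    proof (rule continuous_at_eps_delta[THEN iffD2], intro allI impI)
      fix \<epsilon> :: real assume "\<epsilon> > 0"
      define a where "a = \<tau> v0 - \<epsilon> / 2"
      define b where "b = \<tau> v0 + \<epsilon> / 2"
      have ab: "a < \<tau> v0" "\<tau> v0 < b" using \<open>\<epsilon> > 0\<close> by (auto simp: a_def b_def)
      \<comment> \<open>The angle is strictly monotone in s, so \<theta> lies strictly between the
        angles at \<open>a\<close> and \<open>b\<close>. The strict inequalities persist for nearby
        v, and the intermediate value theorem traps \<tau> between \<open>a\<close> and
        \<open>b\<close>: this is the continuity of \<tau>.\<close>
      have alt: "Im (\<Lambda> (a, v0)) < \<theta> \<and> \<theta> < Im (\<Lambda> (b, v0)) \<or> Im (\<Lambda> (b, v0)) < \<theta> \<and> \<theta> < Im (\<Lambda> (a, v0))"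
        using continuous_inj_imp_mono[OF ab continuous_on_subset[OF line[OF v0]] inj_on_subset[OF inj1[OF v0]]] \<tau>[OF v0] by auto
      have col: "((\<lambda>v. Im (\<Lambda> (x, v))) \<longlongrightarrow> Im (\<Lambda> (x, v0))) (nhds v0)" for x
      proof -
        have "isCont \<Lambda> (x, v0)" using \<Lambda>c open_strip v0 by (simp add: continuous_on_eq_continuous_at mem)
        moreover have "isCont (\<lambda>v. (x, v)) v0" by (intro continuous_intros)
        ultimately have "isCont (\<lambda>v. Im (\<Lambda> (x, v))) v0"
          using isCont_o2 by (intro continuous_Im) blast
        then show ?thesis using isCont_def tendsto_at_iff_tendsto_nhds by blast
      qed
      have "\<forall>\<^sub>F v in nhds v0. v \<in> {-e<..<e}" using v0 by (intro eventually_nhds_in_open) auto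
      moreover have "\<forall>\<^sub>F v in nhds v0. Im (\<Lambda> (a, v)) < \<theta> \<and> \<theta> < Im (\<Lambda> (b, v)) \<or> Im (\<Lambda> (b, v)) < \<theta> \<and> \<theta> < Im (\<Lambda> (a, v))"
        using alt
      proof
        assume "Im (\<Lambda> (a, v0)) < \<theta> \<and> \<theta> < Im (\<Lambda> (b, v0))"
        then have "\<forall>\<^sub>F v in nhds v0. Im (\<Lambda> (a, v)) < \<theta> \<and> \<theta> < Im (\<Lambda> (b, v))"
          by (intro eventually_conj order_tendstoD(2)[OF col[of a]] order_tendstoD(1)[OF col[of b]]) simp_all
        then show ?thesis by (rule eventually_mono) blast
      next
        assume "Im (\<Lambda> (b, v0)) < \<theta> \<and> \<theta> < Im (\<Lambda> (a, v0))"
        then have "\<forall>\<^sub>F v in nhds v0. Im (\<Lambda> (b, v)) < \<theta> \<and> \<theta> < Im (\<Lambda> (a, v))"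
          by (intro eventually_conj order_tendstoD(2)[OF col[of b]] order_tendstoD(1)[OF col[of a]]) simp_all
        then show ?thesis by (rule eventually_mono) blast
      qed
      ultimately have "\<forall>\<^sub>F v in nhds v0. dist (\<tau> v) (\<tau> v0) < \<epsilon>"
      proof eventually_elim
        case (elim v)
        then have v: "\<bar>v\<bar> < e" by auto
        have "a \<le> b" using ab by simp
        from ivt[OF v this elim(2)] obtain s where "s \<in> {a..b}" "Im (\<Lambda> (s, v)) = \<theta>" by blast
        then have "\<tau> v \<in> {a..b}" using \<tau>u[OF v] by simp
        then show ?case using \<open>\<epsilon> > 0\<close> by (auto simp: dist_real_def a_def b_def abs_less_iff)
      qed
      then show "\<exists>\<delta>>0. \<forall>v. dist v v0 < \<delta> \<longrightarrow> dist (\<tau> v) (\<tau> v0) < \<epsilon>"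
        unfolding eventually_nhds_metric by blast
    qed
    define f where "f v = v * exp (Re (\<Lambda> (\<tau> v, v)))" for v
    have "continuous_on {0..e/2} \<tau>" using \<tau>c e(1) by (intro continuous_at_imp_continuous_on) auto
    then have "continuous_on {0..e/2} (\<lambda>v. \<Lambda> (\<tau> v, v))"
      by (intro continuous_on_compose2[OF \<Lambda>c] continuous_intros) (use e(1) in \<open>auto simp: mem\<close>)
    then have fc: "continuous_on {0..e/2} f" unfolding f_def by (intro continuous_intros)
    have "norm w \<le> f (e / 2)"
    proof -
      have "m \<le> exp (Re (\<Lambda> (\<tau> (e/2), e/2)))"
        using low[of "(\<tau> (e/2), e/2)"] \<Lambda>[of "(\<tau> (e/2), e/2)"] e(1) by (simp add: mem)
      then have "m * (e / 2) \<le> f (e / 2)" using e(1) by (simp add: f_def mult.commute)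
      then show ?thesis using w by simp
    qed
    then obtain v where v: "0 \<le> v" "v \<le> e / 2" "f v = norm w"
      using IVT'[of f 0 "norm w" "e/2"] fc e(1) by (auto simp: f_def)
    have "v \<noteq> 0" using v(3) w(1) by (auto simp: f_def)
    moreover have "v *\<^sub>R \<psi> (\<tau> v, v) = w"
    proof -
      have ve: "\<bar>v\<bar> < e" using v e(1) by auto
      have "v *\<^sub>R \<psi> (\<tau> v, v) = of_real (f v) * cis \<theta>"
        using \<Lambda>[of "(\<tau> v, v)"] \<tau>[OF ve] ve by (simp add: mem exp_eq_polar f_def scaleR_conv_of_real)
      also have "\<dots> = w" unfolding v(3) \<theta>_def using rcis_cmod_Arg[of w] by (simp add: rcis_def)
      finally show ?thesis .
    qed
    moreover have "v < e" using v e(1) by linarith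
    ultimately show ?thesis using v(1) by (metis less_eq_real_def)
  qed
  have "m * (e / 2) > 0" using m e(1) by simp
  then show ?thesis
    by (rule that[OF e m _ low jac inj surj])
qed

end

section \<open>From parametrized surfaces to graphs\<close>

text \<open>Injectivity is not asked for, since the parametrization is periodic in s. Instead, a
  function on the plane is assumed to pull back to a given function of the parameters, and local
  inverses carry over its regularity.\<close>

locale plane_parametrization =
  fixes \<Omega> :: "(real \<times> real) set" and x xs xv y ys yv :: "real \<times> real \<Rightarrow> real"
  assumes open_\<Omega>: "open \<Omega>"
    and x: "\<And>w. w \<in> \<Omega> \<Longrightarrow> (x has_derivative (\<lambda>h. fst h * xs w + snd h * xv w)) (at w)"
    and y: "\<And>w. w \<in> \<Omega> \<Longrightarrow> (y has_derivative (\<lambda>h. fst h * ys w + snd h * yv w)) (at w)"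
    and cont: "continuous_on \<Omega> xs" "continuous_on \<Omega> xv" "continuous_on \<Omega> ys" "continuous_on \<Omega> yv"
    and jac: "\<And>w. w \<in> \<Omega> \<Longrightarrow> xs w * yv w - ys w * xv w \<noteq> 0"
begin

definition J :: "real \<times> real \<Rightarrow> real" where
  "J w = xs w * yv w - ys w * xv w"

lemma J_nz: "w \<in> \<Omega> \<Longrightarrow> J w \<noteq> 0"
  using jac by (simp add: J_def)

lemma cramer:
  assumes "w \<in> \<Omega>" "fst h * xs w + snd h * xv w = k1" "fst h * ys w + snd h * yv w = k2"
  shows "fst h = (k1 * yv w - k2 * xv w) / J w" "snd h = (k2 * xs w - k1 * ys w) / J w"
  using J_nz[OF assms(1)] unfolding J_def assms(2,3)[symmetric] by (simp_all add: field_simps)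

text \<open>The inverse function theorem, with the derivative of the inverse written out by Cramer's
  rule so that second derivatives of the graph become explicit quotients.\<close>

lemma local_section:
  assumes P: "P \<in> \<Omega>"
  obtains N g where "open N" "(x P, y P) \<in> N" "g (x P, y P) = P" "\<And>q. q \<in> N \<Longrightarrow> g q \<in> \<Omega> \<and> (x (g q), y (g q)) = q"
    "(g has_derivative (\<lambda>k. ((fst k * yv P - snd k * xv P) / J P, (snd k * xs P - fst k * ys P) / J P))) (at (x P, y P))"
proof -
  define B1 where "B1 = Blinfun (\<lambda>h::real\<times>real. (fst h, 0::real))"
  define B2 where "B2 = Blinfun (\<lambda>h::real\<times>real. (snd h, 0::real))"
  define B3 where "B3 = Blinfun (\<lambda>h::real\<times>real. (0::real, fst h))"
  define B4 where "B4 = Blinfun (\<lambda>h::real\<times>real. (0::real, snd h))"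
  have B: "blinfun_apply B1 = (\<lambda>h. (fst h, 0))" "blinfun_apply B2 = (\<lambda>h. (snd h, 0))"
    "blinfun_apply B3 = (\<lambda>h. (0, fst h))" "blinfun_apply B4 = (\<lambda>h. (0, snd h))"
    unfolding B1_def B2_def B3_def B4_def
    by (intro bounded_linear_Blinfun_apply bounded_linear_Pair bounded_linear_fst bounded_linear_snd bounded_linear_zero)+
  define D where "D w = xs w *\<^sub>R B1 + xv w *\<^sub>R B2 + ys w *\<^sub>R B3 + yv w *\<^sub>R B4" for w
  have D: "blinfun_apply (D w) h = (fst h * xs w + snd h * xv w, fst h * ys w + snd h * yv w)" for w h
    by (simp add: D_def B blinfun.add_left blinfun.scaleR_left mult.commute)
  define I where "I = (yv P / J P) *\<^sub>R B1 - (xv P / J P) *\<^sub>R B2 - (ys P / J P) *\<^sub>R B3 + (xs P / J P) *\<^sub>R B4"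
  have I: "blinfun_apply I k = ((fst k * yv P - snd k * xv P) / J P, (snd k * xs P - fst k * ys P) / J P)" for k
    by (simp add: I_def B blinfun.add_left blinfun.diff_left blinfun.scaleR_left diff_divide_distrib mult.commute)
  have ID: "blinfun_apply I (blinfun_apply (D P) h) = h" for h
    using cramer[OF P refl refl, of h] by (simp add: I D prod_eq_iff)
  have "I o\<^sub>L D P = id_blinfun"
    by (rule blinfun_eqI) (simp add: ID)
  moreover have "((\<lambda>w. (x w, y w)) has_derivative blinfun_apply (D w)) (at w)" if "w \<in> \<Omega>" for w
    using has_derivative_Pair[OF x[OF that] y[OF that]] by (simp add: D[abs_def])
  moreover have "continuous_on \<Omega> D" unfolding D_def by (intro continuous_intros cont)
  ultimately obtain U' V g g' where g: "open U'" "U' \<subseteq> \<Omega>" "P \<in> U'" "open V" "(x P, y P) \<in> V" "homeomorphism U' V (\<lambda>w. (x w, y w)) g"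
    "\<And>q. q \<in> V \<Longrightarrow> (g has_derivative (g' q)) (at q)" "\<And>q. q \<in> V \<Longrightarrow> g' q = inv (blinfun_apply (D (g q)))"
    "\<And>q. q \<in> V \<Longrightarrow> bij (blinfun_apply (D (g q)))"
    using inverse_function_theorem[OF open_\<Omega>, of "\<lambda>w. (x w, y w)" D P I] P by blast
  have gP: "g (x P, y P) = P" using g(3,6) by (auto simp: homeomorphism_def)
  have "g' (x P, y P) = inv (blinfun_apply (D P))" using g(8)[OF g(5)] by (simp add: gP)
  also have "\<dots> = blinfun_apply I"
    using g(9)[OF g(5)] ID by (metis (no_types, lifting) bij_is_surj ext gP surj_f_inv_f)
  finally have "(g has_derivative (\<lambda>k. ((fst k * yv P - snd k * xv P) / J P, (snd k * xs P - fst k * ys P) / J P))) (at (x P, y P))"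
    using g(7)[OF g(5)] by (simp add: I[abs_def])
  moreover have "g q \<in> \<Omega> \<and> (x (g q), y (g q)) = q" if "q \<in> V" for q
    using g(2,6) that by (auto simp: homeomorphism_def)
  ultimately show ?thesis using that g(4,5) gP by blast
qed

text \<open>Near the point in question \<open>F\<close> is \<open>f\<close> composed with a local
  inverse of (x, y). The same argument, with the chain rule, gives its derivative below.\<close>

lemma descend_isCont:
  assumes P: "P \<in> \<Omega>" and F: "\<And>w. w \<in> \<Omega> \<Longrightarrow> F (x w, y w) = f w" and f: "isCont f P"
  shows "isCont F (x P, y P)"
proof -
  obtain N g where g: "open N" "(x P, y P) \<in> N" "g (x P, y P) = P" "\<And>q. q \<in> N \<Longrightarrow> g q \<in> \<Omega> \<and> (x (g q), y (g q)) = q"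
    and D: "(g has_derivative (\<lambda>k. ((fst k * yv P - snd k * xv P) / J P, (snd k * xs P - fst k * ys P) / J P))) (at (x P, y P))"
    using that by (rule local_section[OF P])
  have "isCont g (x P, y P)" using D by (rule has_derivative_continuous)
  then have "isCont (\<lambda>q. f (g q)) (x P, y P)" by (rule isCont_o2) (simp add: g(3) f)
  moreover have "\<forall>\<^sub>F q in nhds (x P, y P). f (g q) = F q"
    using eventually_nhds_in_open[OF g(1,2)] by (rule eventually_mono) (metis F g(4))
  ultimately show ?thesis by (rule isCont_cong[THEN iffD1, rotated])
qed

lemma descend_has_derivative:
  assumes P: "P \<in> \<Omega>" and F: "\<And>w. w \<in> \<Omega> \<Longrightarrow> F (x w, y w) = f w"
    and f: "(f has_derivative (\<lambda>h. fst h * fs + snd h * fv)) (at P)"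
  shows "(F has_derivative (\<lambda>k. fst k * ((fs * yv P - fv * ys P) / J P) + snd k * ((fv * xs P - fs * xv P) / J P))) (at (x P, y P))"
proof -
  obtain N g where g: "open N" "(x P, y P) \<in> N" "g (x P, y P) = P" "\<And>q. q \<in> N \<Longrightarrow> g q \<in> \<Omega> \<and> (x (g q), y (g q)) = q"
    and D: "(g has_derivative (\<lambda>k. ((fst k * yv P - snd k * xv P) / J P, (snd k * xs P - fst k * ys P) / J P))) (at (x P, y P))"
    using that by (rule local_section[OF P])
  have "((\<lambda>q. f (g q)) has_derivative (\<lambda>k. (fst k * yv P - snd k * xv P) / J P * fs + (snd k * xs P - fst k * ys P) / J P * fv)) (at (x P, y P))"
  proof -
    have "(f has_derivative (\<lambda>h. fst h * fs + snd h * fv)) (at (g (x P, y P)))" using f by (simp add: g(3))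
    from diff_chain_at[OF D this] show ?thesis by (simp add: o_def)
  qed
  then have "((\<lambda>q. f (g q)) has_derivative (\<lambda>k. fst k * ((fs * yv P - fv * ys P) / J P) + snd k * ((fv * xs P - fs * xv P) / J P))) (at (x P, y P))"
    by (rule has_derivative_eq_rhs) (auto simp: fun_eq_iff field_simps add_divide_distrib diff_divide_distrib)
  then show ?thesis
    by (rule has_derivative_transform_within_open[OF _ g(1,2)]) (metis F g(4))
qed

end

lemma has_derivative_partials:
  assumes "(F has_derivative (\<lambda>k. fst k * a + snd k * b)) (at (q1, q2))"
  shows "((\<lambda>t. F (t, q2)) has_real_derivative a) (at q1)" "((\<lambda>t. F (q1, t)) has_real_derivative b) (at q2)"
    "partial_x F (q1, q2) = a" "partial_y F (q1, q2) = b"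
proof -
  have *: "(F has_derivative (\<lambda>k. fst k *\<^sub>R a + snd k *\<^sub>R b)) (at (q1, q2))" using assms by simp
  show "((\<lambda>t. F (t, q2)) has_real_derivative a) (at q1)" "((\<lambda>t. F (q1, t)) has_real_derivative b) (at q2)"
    using has_derivative_fst_line[OF *] has_derivative_snd_line[OF *]
    by (simp_all add: has_real_derivative_iff_has_vector_derivative)
  then show "partial_x F (q1, q2) = a" "partial_y F (q1, q2) = b"
    by (simp_all add: partial_x_def partial_y_def DERIV_imp_deriv)
qed

lemma C1_onI:
  assumes "\<And>q. q \<in> V \<Longrightarrow> (F has_derivative (\<lambda>k. fst k * a q + snd k * b q)) (at q)"
    and "\<And>q. q \<in> V \<Longrightarrow> isCont (partial_x F) q" "\<And>q. q \<in> V \<Longrightarrow> isCont (partial_y F) q"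
  shows "C1_on F V"
  unfolding C1_on_def
proof (intro conjI ballI)
  show "continuous_on V (partial_x F)" "continuous_on V (partial_y F)"
    using assms(2,3) by (auto intro: continuous_at_imp_continuous_on)
  fix q assume q: "q \<in> V"
  obtain q1 q2 where e: "q = (q1, q2)" by force
  show "case q of (x, y) \<Rightarrow> (\<lambda>t. F (t, y)) differentiable at x \<and> (\<lambda>t. F (x, t)) differentiable at y"
    using has_derivative_partials(1,2)[OF assms(1)[OF q, unfolded e]] unfolding e
    by (auto simp: real_differentiable_def)
qed

text \<open>Here r, m, n, t stand for the entries of the derivative of (p, q) with respect to (x, y); its symmetry m = n is a
  consequence of the system.\<close>

lemma monge_ampere_of_system:
  fixes A B C E xs xv ys yv ps pv qs qv r m n t :: real
  assumes chain: "ps = r * xs + m * ys" "pv = r * xv + m * yv" "qs = n * xs + t * ys" "qv = n * xv + t * yv"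
    and sys: "yv = ps + C * xs - B * ys" "- xv = qs - B * xs + A * ys"
      "pv = B * yv - C * xv - (A * C - B * B + E) * ys" "qv = B * xv - A * yv + (A * C - B * B + E) * xs"
    and J: "xs * yv - ys * xv \<noteq> 0"
  shows "A * r + 2 * B * m + C * t + r * t - m\<^sup>2 = E"
proof -
  define D where "D = A * C - B * B + E"
  have ps: "ps = yv - C * xs + B * ys" and qs: "qs = - xv + B * xs - A * ys" using sys(1,2) by linarith+
  \<comment> \<open>This is the integrability condition for the form p dx + q dy. In terms of the
    chain rule its left side is the Jacobian times n - m.\<close>
  have "ps * xv + qs * yv - pv * xs - qv * ys = 0"
    unfolding ps qs sys(3,4) by (simp add: algebra_simps)
  then have "(xs * yv - ys * xv) * (n - m) = 0"
    unfolding chain by (simp add: algebra_simps)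
  then have nm: "n = m" using J by simp
  \<comment> \<open>These are the entries of the Hessian shifted by the coefficients; the equation
    becomes \<open>\<alpha> * \<tau> - \<beta> * \<beta> = D\<close>.\<close>
  define \<alpha> where "\<alpha> = r + C"
  define \<beta> where "\<beta> = m - B"
  define \<tau> where "\<tau> = t + A"
  have y: "yv = \<alpha> * xs + \<beta> * ys" using sys(1) chain(1) by (simp add: \<alpha>_def \<beta>_def algebra_simps)
  have x: "xv = - \<beta> * xs - \<tau> * ys" using sys(2) chain(3) nm by (simp add: \<tau>_def \<beta>_def algebra_simps)
  have "\<alpha> * xv + \<beta> * yv = - D * ys" using sys(3) chain(2) by (simp add: \<alpha>_def \<beta>_def D_def algebra_simps)
  \<comment> \<open>The last two equations of the system show that D minus the shifted determinant
    annihilates the vector (xs, ys), which is nonzero because the Jacobian is.\<close>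
  then have 1: "(\<beta> * \<beta> - \<alpha> * \<tau> + D) * ys = 0" unfolding x y by (simp add: algebra_simps)
  have "\<beta> * xv + \<tau> * yv = D * xs" using sys(4) chain(4) nm by (simp add: \<tau>_def \<beta>_def D_def algebra_simps)
  then have 2: "(\<beta> * \<beta> - \<alpha> * \<tau> + D) * xs = 0" unfolding x y by (simp add: algebra_simps)
  have "xs \<noteq> 0 \<or> ys \<noteq> 0" using J by auto
  then have "\<alpha> * \<tau> - \<beta> * \<beta> = D" using 1 2 by auto
  then show ?thesis by (simp add: \<alpha>_def \<beta>_def \<tau>_def D_def power2_eq_square algebra_simps)
qed

context plane_parametrization
begin

context
  fixes z p q ps pv qs qv :: "real \<times> real \<Rightarrow> real" and Z :: "real \<times> real \<Rightarrow> real" and V :: "(real \<times> real) set"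
  assumes V: "V \<subseteq> (\<lambda>w. (x w, y w)) ` \<Omega>"
    and z: "\<And>w. w \<in> \<Omega> \<Longrightarrow> (z has_derivative
      (\<lambda>h. fst h * (p w * xs w + q w * ys w) + snd h * (p w * xv w + q w * yv w))) (at w)"
    and p: "\<And>w. w \<in> \<Omega> \<Longrightarrow> (p has_derivative (\<lambda>h. fst h * ps w + snd h * pv w)) (at w)"
    and q: "\<And>w. w \<in> \<Omega> \<Longrightarrow> (q has_derivative (\<lambda>h. fst h * qs w + snd h * qv w)) (at w)"
    and pq_cont: "continuous_on \<Omega> ps" "continuous_on \<Omega> pv" "continuous_on \<Omega> qs" "continuous_on \<Omega> qv"
    and Z: "\<And>w. w \<in> \<Omega> \<Longrightarrow> Z (x w, y w) = z w"
begin

text \<open>Solving dz = p dx + q dy by Cramer's rule gives back p and q.\<close>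

lemma graph_gradient:
  assumes w: "w \<in> \<Omega>"
  shows "(Z has_derivative (\<lambda>k. fst k * p w + snd k * q w)) (at (x w, y w))"
    "partial_x Z (x w, y w) = p w" "partial_y Z (x w, y w) = q w"
proof -
  have e: "((p w * xs w + q w * ys w) * yv w - (p w * xv w + q w * yv w) * ys w) / J w = p w"
    "((p w * xv w + q w * yv w) * xs w - (p w * xs w + q w * ys w) * xv w) / J w = q w"
    using J_nz[OF w] by (simp_all add: divide_eq_eq) (simp_all add: J_def algebra_simps)
  show D: "(Z has_derivative (\<lambda>k. fst k * p w + snd k * q w)) (at (x w, y w))"
    using descend_has_derivative[where F = Z and f = z, OF w Z z[OF w]] unfolding e .
  show "partial_x Z (x w, y w) = p w" "partial_y Z (x w, y w) = q w"
    by (rule has_derivative_partials[OF D])+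
qed

lemma graph_C2:
  shows "C2_on Z V"
    "\<And>w. w \<in> \<Omega> \<Longrightarrow> partial_x (partial_x Z) (x w, y w) = (ps w * yv w - pv w * ys w) / J w"
    "\<And>w. w \<in> \<Omega> \<Longrightarrow> partial_y (partial_x Z) (x w, y w) = (pv w * xs w - ps w * xv w) / J w"
    "\<And>w. w \<in> \<Omega> \<Longrightarrow> partial_y (partial_y Z) (x w, y w) = (qv w * xs w - qs w * xv w) / J w"
proof -
  have Dp: "(partial_x Z has_derivative (\<lambda>k. fst k * ((ps w * yv w - pv w * ys w) / J w)
      + snd k * ((pv w * xs w - ps w * xv w) / J w))) (at (x w, y w))" if "w \<in> \<Omega>" for w
    by (rule descend_has_derivative[where f = p, OF that graph_gradient(2) p[OF that]])
  have Dq: "(partial_y Z has_derivative (\<lambda>k. fst k * ((qs w * yv w - qv w * ys w) / J w)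
      + snd k * ((qv w * xs w - qs w * xv w) / J w))) (at (x w, y w))" if "w \<in> \<Omega>" for w
    by (rule descend_has_derivative[where f = q, OF that graph_gradient(3) q[OF that]])
  show xx: "partial_x (partial_x Z) (x w, y w) = (ps w * yv w - pv w * ys w) / J w"
    and xy: "partial_y (partial_x Z) (x w, y w) = (pv w * xs w - ps w * xv w) / J w"
    and yy: "partial_y (partial_y Z) (x w, y w) = (qv w * xs w - qs w * xv w) / J w" if "w \<in> \<Omega>" for w
    by (rule has_derivative_partials(3,4)[OF Dp[OF that]] has_derivative_partials(4)[OF Dq[OF that]])+
  have yx: "partial_x (partial_y Z) (x w, y w) = (qs w * yv w - qv w * ys w) / J w" if "w \<in> \<Omega>" for w
    by (rule has_derivative_partials(3)[OF Dq[OF that]])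
  have quot: "isCont (\<lambda>w. (f w * g w - f' w * g' w) / J w) w"
    if "w \<in> \<Omega>" "continuous_on \<Omega> f" "continuous_on \<Omega> f'" "continuous_on \<Omega> g" "continuous_on \<Omega> g'" for f f' g g' w
  proof -
    have "continuous_on \<Omega> (\<lambda>w. (f w * g w - f' w * g' w) / J w)"
      using J_nz unfolding J_def by (intro continuous_intros that cont) auto
    then show ?thesis using open_\<Omega> that(1) by (simp add: continuous_on_eq_continuous_at)
  qed
  have V': "\<exists>w. w \<in> \<Omega> \<and> r = (x w, y w)" if "r \<in> V" for r using V that by blast
  have c: "isCont F r" if "r \<in> V" "\<And>w. w \<in> \<Omega> \<Longrightarrow> F (x w, y w) = f w" "\<And>w. w \<in> \<Omega> \<Longrightarrow> isCont f w" for F f r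
    using V'[OF that(1)] descend_isCont[where F = F and f = f] that(2,3) by blast
  have pc: "isCont p w" "isCont q w" if "w \<in> \<Omega>" for w
    using p[OF that] q[OF that] has_derivative_continuous by blast+
  have d: "\<exists>a b. \<forall>r\<in>V. (F has_derivative (\<lambda>k. fst k * a r + snd k * b r)) (at r)"
    if "\<And>w. w \<in> \<Omega> \<Longrightarrow> \<exists>a b. (F has_derivative (\<lambda>k. fst k * a + snd k * b)) (at (x w, y w))" for F
  proof -
    have "\<forall>r\<in>V. \<exists>a b. (F has_derivative (\<lambda>k. fst k * a + snd k * b)) (at r)"
      using that V' by blast
    then show ?thesis by (simp only: bchoice_iff)
  qed
  have C1: "C1_on F V" if "\<And>w. w \<in> \<Omega> \<Longrightarrow> \<exists>a b. (F has_derivative (\<lambda>k. fst k * a + snd k * b)) (at (x w, y w))"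
    "\<And>r. r \<in> V \<Longrightarrow> isCont (partial_x F) r" "\<And>r. r \<in> V \<Longrightarrow> isCont (partial_y F) r" for F
    using d[of F, OF that(1)] C1_onI[where F = F and V = V] that(2,3) by blast
  have "C1_on Z V"
    by (rule C1) (use graph_gradient(1) c[OF _ graph_gradient(2) pc(1)] c[OF _ graph_gradient(3) pc(2)] in blast)+
  moreover have "C1_on (partial_x Z) V"
    by (rule C1) (use Dp c[OF _ xx quot] c[OF _ xy quot] pq_cont cont in blast)+
  moreover have "C1_on (partial_y Z) V"
    by (rule C1) (use Dq c[OF _ yx quot] c[OF _ yy quot] pq_cont cont in blast)+
  ultimately show "C2_on Z V" by (simp add: C2_on_def)
qed

lemma graph_monge_ampere:
  fixes U :: "real five set"
  assumes U: "\<And>w. w \<in> \<Omega> \<Longrightarrow> (x w, y w, z w, p w, q w) \<in> U"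
    and sys: "\<And>w u. \<lbrakk>w \<in> \<Omega>; u = (x w, y w, z w, p w, q w)\<rbrakk> \<Longrightarrow>
      yv w = ps w + C u * xs w - B u * ys w \<and> - xv w = qs w - B u * xs w + A u * ys w \<and>
      pv w = B u * yv w - C u * xv w - (A u * C u - B u * B u + E u) * ys w \<and>
      qv w = B u * xv w - A u * yv w + (A u * C u - B u * B u + E u) * xs w"
  shows "monge_ampere_solution_on U A B C E Z V"
  unfolding monge_ampere_solution_on_def
proof (intro conjI ballI)
  show "C2_on Z V" by (rule graph_C2)
  fix r assume "r \<in> V"
  then obtain w where w: "w \<in> \<Omega>" "r = (x w, y w)" using V by blast
  define u where "u = (x w, y w, z w, p w, q w)"
  have jet: "jet1 Z r = u"
    using w by (simp add: jet1_def u_def Z graph_gradient(2,3)[OF w(1)])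
  show "jet1 Z r \<in> U" using U[OF w(1)] by (simp add: jet u_def)
  note J = J_nz[OF w(1)]
  have "A u * ((ps w * yv w - pv w * ys w) / J w) + 2 * B u * ((pv w * xs w - ps w * xv w) / J w)
      + C u * ((qv w * xs w - qs w * xv w) / J w)
      + ((ps w * yv w - pv w * ys w) / J w) * ((qv w * xs w - qs w * xv w) / J w)
      - ((pv w * xs w - ps w * xv w) / J w)\<^sup>2 = E u"
  proof (rule monge_ampere_of_system[where n = "(qs w * yv w - qv w * ys w) / J w"])
    show "ps w = (ps w * yv w - pv w * ys w) / J w * xs w + (pv w * xs w - ps w * xv w) / J w * ys w"
      "pv w = (ps w * yv w - pv w * ys w) / J w * xv w + (pv w * xs w - ps w * xv w) / J w * yv w"
      "qs w = (qs w * yv w - qv w * ys w) / J w * xs w + (qv w * xs w - qs w * xv w) / J w * ys w"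
      "qv w = (qs w * yv w - qv w * ys w) / J w * xv w + (qv w * xs w - qs w * xv w) / J w * yv w"
      using J by (simp_all add: field_simps) (simp_all add: J_def algebra_simps)
    show "xs w * yv w - ys w * xv w \<noteq> 0" using jac[OF w(1)] .
  qed (use sys[OF w(1) u_def] in blast)+
  then show "A (jet1 Z r) * partial_x (partial_x Z) r + 2 * B (jet1 Z r) * partial_y (partial_x Z) r
      + C (jet1 Z r) * partial_y (partial_y Z) r + partial_x (partial_x Z) r * partial_y (partial_y Z) r
      - (partial_y (partial_x Z) r)\<^sup>2 = E (jet1 Z r)"
    unfolding jet unfolding w(2) graph_C2(2-4)[OF w(1)] .
qed

end

end

section \<open>The singular solution\<close>

lemma has_derivative_c:
  assumes "(f has_derivative (\<lambda>h. fst h *\<^sub>R a + snd h *\<^sub>R b)) F"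
  shows "((\<lambda>w. c1 (f w)) has_derivative (\<lambda>h. fst h * c1 a + snd h * c1 b)) F"
    "((\<lambda>w. c2 (f w)) has_derivative (\<lambda>h. fst h * c2 a + snd h * c2 b)) F"
    "((\<lambda>w. c3 (f w)) has_derivative (\<lambda>h. fst h * c3 a + snd h * c3 b)) F"
    "((\<lambda>w. c4 (f w)) has_derivative (\<lambda>h. fst h * c4 a + snd h * c4 b)) F"
    "((\<lambda>w. c5 (f w)) has_derivative (\<lambda>h. fst h * c5 a + snd h * c5 b)) F"
  using bounded_linear.has_derivative[OF bounded_linear_c(1) assms]
    bounded_linear.has_derivative[OF bounded_linear_c(2) assms]
    bounded_linear.has_derivative[OF bounded_linear_c(3) assms]
    bounded_linear.has_derivative[OF bounded_linear_c(4) assms]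
    bounded_linear.has_derivative[OF bounded_linear_c(5) assms]
  by simp_all

text \<open>A simple path identifies at most the parameters 0 and 1, and a fractional part is never
  1.\<close>

lemma simple_closed_period:
  fixes c :: "real \<Rightarrow> 'a::real_normed_vector"
  assumes c: "simple_path c" "\<And>s. c (s + 1) = c s" and eq: "c s = c t"
  shows "t - s \<in> \<int>"
proof -
  have fr: "c (frac s) = c s" for s
    using periodic_frac[of c] c(2) by simp
  have "frac s \<in> {0..1}" "frac t \<in> {0..1}" using frac_lt_1[of s] frac_lt_1[of t] by auto
  moreover have "c (frac s) = c (frac t)" using eq fr by simp
  ultimately have "frac s = frac t"
    using c(1) frac_lt_1[of s] frac_lt_1[of t] unfolding simple_path_def loop_free_def by fastforce
  then have "t - s = of_int (\<lfloor>t\<rfloor> - \<lfloor>s\<rfloor>)" by (simp add: frac_def)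
  then show ?thesis by (metis Ints_of_int)
qed

locale convex_singularity_data = periodic_monge_ampere_data +
  assumes simple: "simple_path c"
    and regular: "\<And>t. velocity c t \<noteq> 0"
    and curved: "\<And>t. plane_curvature c t \<noteq> 0"
begin

text \<open>The bounds \<open>m\<close> and \<open>M\<close> make v comparable to the distance of
  (x, y) from the origin. Injectivity is stated as equality of the values of \<open>u\<close>, since
  s is determined only up to the period.\<close>

lemma ex_blow_up:
  obtains e m M \<rho> and u us uv \<omega> :: "real \<times> real \<Rightarrow> real five"
  where "e > 0" "m > 0" "M > 0" "\<rho> > 0"
    "\<And>s v. \<lbrakk>0 < v; v < e\<rbrakk> \<Longrightarrow> (u has_derivative (\<lambda>h. fst h *\<^sub>R us (s, v) + snd h *\<^sub>R uv (s, v))) (at (s, v))"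
    "\<And>s v. \<lbrakk>0 < v; v < e\<rbrakk> \<Longrightarrow> isCont us (s, v) \<and> isCont uv (s, v)"
    "\<And>s v. \<lbrakk>0 < v; v < e\<rbrakk> \<Longrightarrow> u (s, v) \<in> U \<and> uv (s, v) = rhs (u (s, v)) (us (s, v))"
    "\<And>s v. \<lbrakk>0 < v; v < e\<rbrakk> \<Longrightarrow> u (s, v) = (0, 0, 0, c s) + v *\<^sub>R \<omega> (s, v)"
    "\<And>s v. \<lbrakk>0 < v; v < e\<rbrakk> \<Longrightarrow> c3 (us (s, v)) = c4 (u (s, v)) * c1 (us (s, v)) + c5 (u (s, v)) * c2 (us (s, v))"
    "\<And>s v. \<lbrakk>0 < v; v < e\<rbrakk> \<Longrightarrow> norm (\<omega> (s, v)) \<le> M \<and> m \<le> norm (c1 (\<omega> (s, v)), c2 (\<omega> (s, v)))"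
    "\<And>s v. \<lbrakk>0 < v; v < e\<rbrakk> \<Longrightarrow> c1 (us (s, v)) * c2 (uv (s, v)) - c2 (us (s, v)) * c1 (uv (s, v)) \<noteq> 0"
    "\<And>s v s' v'. \<lbrakk>0 < v; v < e; 0 < v'; v' < e; c1 (u (s, v)) = c1 (u (s', v')); c2 (u (s, v)) = c2 (u (s', v'))\<rbrakk>
       \<Longrightarrow> u (s, v) = u (s', v')"
    "\<And>q. \<lbrakk>q \<noteq> 0; norm q < \<rho>\<rbrakk> \<Longrightarrow> \<exists>s v. 0 < v \<and> v < e \<and> (c1 (u (s, v)), c2 (u (s, v))) = q"
proof -
  obtain d :: real and u us uv \<omega> \<omega>s \<omega>v :: "real \<times> real \<Rightarrow> real five" where d: "d > 0"
    and du: "\<And>s v. \<bar>v\<bar> < d \<Longrightarrow> (u has_derivative (\<lambda>h. fst h *\<^sub>R us (s, v) + snd h *\<^sub>R uv (s, v))) (at (s, v))"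
    and d\<omega>: "\<And>s v. \<bar>v\<bar> < d \<Longrightarrow> (\<omega> has_derivative (\<lambda>h. fst h *\<^sub>R \<omega>s (s, v) + snd h *\<^sub>R \<omega>v (s, v))) (at (s, v))"
    and cont: "\<And>s v. \<bar>v\<bar> < d \<Longrightarrow> isCont us (s, v) \<and> isCont uv (s, v) \<and> isCont \<omega>s (s, v) \<and> isCont \<omega>v (s, v)"
    and per: "\<And>s v. u (s + 1, v) = u (s, v) \<and> us (s + 1, v) = us (s, v) \<and> uv (s + 1, v) = uv (s, v)
       \<and> \<omega> (s + 1, v) = \<omega> (s, v) \<and> \<omega>s (s + 1, v) = \<omega>s (s, v) \<and> \<omega>v (s + 1, v) = \<omega>v (s, v)"
    and sys: "\<And>s v. \<bar>v\<bar> < d \<Longrightarrow> u (s, v) \<in> U \<and> uv (s, v) = rhs (u (s, v)) (us (s, v))"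
    and u: "\<And>s v. \<bar>v\<bar> < d \<Longrightarrow> u (s, v) = (0, 0, 0, c s) + v *\<^sub>R \<omega> (s, v)"
    and contact: "\<And>s v. \<bar>v\<bar> < d \<Longrightarrow> c3 (us (s, v)) = c4 (u (s, v)) * c1 (us (s, v)) + c5 (u (s, v)) * c2 (us (s, v))"
    using that by (rule global_solution)
  have xy: "c1 (u (s, v)) = v * c1 (\<omega> (s, v))" "c2 (u (s, v)) = v * c2 (\<omega> (s, v))" if "\<bar>v\<bar> < d" for s v
    by (simp_all add: u[OF that] c_defs)
  have pq: "c4 (u (s, 0)) = fst (c s)" "c5 (u (s, 0)) = snd (c s)" for s
    using d by (simp_all add: u c_defs)
  have us12: "c1 (us (s, v)) = v * c1 (\<omega>s (s, v))" "c2 (us (s, v)) = v * c2 (\<omega>s (s, v))" if v: "\<bar>v\<bar> < d" for s v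
  proof -
    note D = has_vector_derivative_c[OF has_derivative_fst_line[OF du[OF v]]]
    note D\<omega> = has_vector_derivative_c[OF has_derivative_fst_line[OF d\<omega>[OF v]]]
    show "c1 (us (s, v)) = v * c1 (\<omega>s (s, v))"
      using D(1)[of s] DERIV_cmult[OF D\<omega>(1)[of s], of v] unfolding xy[OF v] by (rule DERIV_unique)
    show "c2 (us (s, v)) = v * c2 (\<omega>s (s, v))"
      using D(2)[of s] DERIV_cmult[OF D\<omega>(2)[of s], of v] unfolding xy[OF v] by (rule DERIV_unique)
  qed
  have uv12: "c1 (uv (s, v)) = c1 (\<omega> (s, v)) + v * c1 (\<omega>v (s, v))" "c2 (uv (s, v)) = c2 (\<omega> (s, v)) + v * c2 (\<omega>v (s, v))"
    if v: "\<bar>v\<bar> < d" for s v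
  proof -
    note D = has_vector_derivative_c[OF has_derivative_snd_line[OF du[OF v]]]
    note D\<omega> = has_vector_derivative_c[OF has_derivative_snd_line[OF d\<omega>[OF v]]]
    have P: "((\<lambda>v. v * c1 (\<omega> (s, v))) has_real_derivative c1 (\<omega> (s, v)) + v * c1 (\<omega>v (s, v))) (at v)"
      "((\<lambda>v. v * c2 (\<omega> (s, v))) has_real_derivative c2 (\<omega> (s, v)) + v * c2 (\<omega>v (s, v))) (at v)"
      by (auto intro!: derivative_eq_intros D\<omega>)
    have "((\<lambda>v. c1 (u (s, v))) has_real_derivative c1 (\<omega> (s, v)) + v * c1 (\<omega>v (s, v))) (at v)"
      "((\<lambda>v. c2 (u (s, v))) has_real_derivative c2 (\<omega> (s, v)) + v * c2 (\<omega>v (s, v))) (at v)"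
      by (rule has_field_derivative_transform_within_open[OF P(1), of "{-d<..<d}"]
            has_field_derivative_transform_within_open[OF P(2), of "{-d<..<d}"]; use v xy in force)+
    then show "c1 (uv (s, v)) = c1 (\<omega> (s, v)) + v * c1 (\<omega>v (s, v))" "c2 (uv (s, v)) = c2 (\<omega> (s, v)) + v * c2 (\<omega>v (s, v))"
      using D(1,2) DERIV_unique by blast+
  qed
  have z: "\<bar>0\<bar> < d" using d by simp
  \<comment> \<open>At v = 0 the derivatives x_s and y_s vanish, so the system reduces to x_v = -
    q_s and y_v = p_s: the tangent of the curve turned by a right angle.\<close>
  have \<omega>0: "c1 (\<omega> (s, 0)) = - c5 (us (s, 0))" "c2 (\<omega> (s, 0)) = c4 (us (s, 0))" for s
    using uv12[OF z, of s] us12[OF z, of s] sys[OF z, of s] by (simp_all add: rhs_def ma_rhs_def ma_a_def ma_b_def)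
  have dc: "(c has_vector_derivative (c2 (\<omega> (s, 0)), - c1 (\<omega> (s, 0)))) (at s)" for s
  proof -
    note D = has_vector_derivative_c[OF has_derivative_fst_line[OF du[OF z]]]
    have "((\<lambda>s. (fst (c s), snd (c s))) has_vector_derivative (c4 (us (s, 0)), c5 (us (s, 0)))) (at s)"
      using D(4,5)[of s] unfolding pq has_real_derivative_iff_has_vector_derivative
      by (rule has_vector_derivative_Pair)
    then show ?thesis by (simp add: \<omega>0)
  qed
  have vel: "velocity c s = (c2 (\<omega> (s, 0)), - c1 (\<omega> (s, 0)))" for s
    unfolding velocity_def by (rule vector_derivative_at[OF dc])
  have vel2: "velocity (velocity c) s = (c2 (\<omega>s (s, 0)), - c1 (\<omega>s (s, 0)))" for s
  proof -
    note D = has_vector_derivative_c[OF has_derivative_fst_line[OF d\<omega>[OF z]]]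
    have "((\<lambda>s. (c2 (\<omega> (s, 0)), - c1 (\<omega> (s, 0)))) has_vector_derivative (c2 (\<omega>s (s, 0)), - c1 (\<omega>s (s, 0)))) (at s)"
      using D(2)[of s] DERIV_minus[OF D(1)[of s]] unfolding has_real_derivative_iff_has_vector_derivative
      by (rule has_vector_derivative_Pair)
    then show ?thesis unfolding vel[abs_def, symmetric] velocity_def[of "velocity c"] by (rule vector_derivative_at)
  qed
  define K where "K w = Complex (c1 w) (c2 w)" for w :: "real five"
  have K: "bounded_linear K"
  proof -
    have "K = (\<lambda>w. c1 w *\<^sub>R 1 + c2 w *\<^sub>R \<i>)" by (simp add: fun_eq_iff K_def complex_eq_iff)
    moreover have "bounded_linear (\<lambda>w::real five. c1 w *\<^sub>R (1::complex) + c2 w *\<^sub>R \<i>)"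
      by (intro bounded_linear_add bounded_linear_scaleR_const bounded_linear_c)
    ultimately show ?thesis by simp
  qed
  define g where "g t = Complex (fst (c t)) (snd (c t))" for t
  define g' where "g' t = Complex (c2 (\<omega> (t, 0))) (- c1 (\<omega> (t, 0)))" for t
  have dg: "(g has_vector_derivative g' t) (at t)" for t
  proof -
    have B: "bounded_linear (\<lambda>r::real\<times>real. fst r *\<^sub>R (1::complex) + snd r *\<^sub>R \<i>)"
      by (intro bounded_linear_add bounded_linear_scaleR_const bounded_linear_fst bounded_linear_snd)
    have "g = (\<lambda>t. fst (c t) *\<^sub>R (1::complex) + snd (c t) *\<^sub>R \<i>)" by (simp add: g_def fun_eq_iff complex_eq_iff)
    moreover have "g' t = fst (c2 (\<omega> (t, 0)), - c1 (\<omega> (t, 0))) *\<^sub>R (1::complex) + snd (c2 (\<omega> (t, 0)), - c1 (\<omega> (t, 0))) *\<^sub>R \<i>"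
      by (simp add: g'_def complex_eq_iff)
    ultimately show ?thesis using bounded_linear.has_vector_derivative[OF B dc] by metis
  qed
  have ig': "K (\<omega> (t, 0)) = \<i> * g' t" for t by (simp add: K_def g'_def complex_eq_iff)
  have cg': "continuous_on UNIV g'"
  proof -
    have "continuous_on UNIV (\<lambda>t. \<omega> (t, 0))"
      using has_derivative_fst_line[OF d\<omega>[OF z]]
      by (intro continuous_at_imp_continuous_on) (auto intro: has_vector_derivative_continuous)
    then have "continuous_on UNIV (\<lambda>t. - \<i> * K (\<omega> (t, 0)))"
      by (intro continuous_intros bounded_linear.continuous_on[OF K])
    moreover have "(\<lambda>t. - \<i> * K (\<omega> (t, 0))) = g'" by (simp add: ig' fun_eq_iff)
    ultimately show ?thesis by (simp only:)
  qed
  have g'nz: "g' t \<noteq> 0" for t using regular[of t] by (auto simp: vel g'_def complex_eq_iff zero_prod_def)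
  have pg: "g (t + 1) = g t" for t by (simp add: g_def period)
  have injg: "t - s \<in> \<int>" if "g s = g t" for s t
    using simple_closed_period[OF simple period, of s t] that by (simp add: g_def prod_eq_iff)
  obtain l0 and \<sigma> :: real where l0: "continuous_on UNIV l0" "\<And>s. g' s = exp (l0 s)" "\<bar>\<sigma>\<bar> = 1"
    "\<And>s. l0 (s + 1) = l0 s + 2 * of_real \<sigma> * of_real pi * \<i>"
    by (rule simple_closed_curve_turning[OF dg cg' g'nz pg injg]) blast+
  have sub: "\<bar>snd w\<bar> < d" if "w \<in> strip (d/2)" for w using that d by (auto simp: strip_def)
  \<comment> \<open>At v = 0 the function \<psi> is i times the tangent \<open>g'\<close>, hence the
    shift of its logarithm by i pi / 2. Half the width is used so that the later strip lies where
    \<open>strip_bounded\<close> bounds \<omega>.\<close>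
  interpret S: winding_strip "d / 2" "\<lambda>w. K (\<omega> w)" "\<lambda>w. K (\<omega>s w)" "\<lambda>w. K (\<omega>v w)" "\<lambda>s. l0 s + of_real (pi / 2) * \<i>" \<sigma>
  proof
    show "((\<lambda>w. K (\<omega> w)) has_derivative (\<lambda>h. fst h *\<^sub>R K (\<omega>s w) + snd h *\<^sub>R K (\<omega>v w))) (at w)" if "w \<in> strip (d/2)" for w
      using bounded_linear.has_derivative[OF K d\<omega>[OF sub[OF that], of "fst w"]] by (simp add: linear_simps[OF K])
    show "continuous_on (strip (d/2)) (\<lambda>w. K (\<omega>s w))" "continuous_on (strip (d/2)) (\<lambda>w. K (\<omega>v w))"
      using cont[OF sub] by (intro bounded_linear.continuous_on[OF K] continuous_at_imp_continuous_on; force)+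
    show "continuous_on UNIV (\<lambda>s. l0 s + complex_of_real (pi / 2) * \<i>)" by (intro continuous_intros l0)
    show "K (\<omega> (s, 0)) = exp (l0 s + complex_of_real (pi / 2) * \<i>)" for s
    proof -
      have "exp (complex_of_real (pi / 2) * \<i>) = \<i>" using cis_pi_half by (simp add: cis_conv_exp mult.commute)
      then show ?thesis by (simp add: ig' l0(2)[symmetric] exp_add)
    qed
    show "Im (K (\<omega>s (s, 0)) / K (\<omega> (s, 0))) \<noteq> 0" for s
    proof -
      \<comment> \<open>The numerator of the curvature is unchanged when velocity and acceleration
        are both turned by a right angle, which turns it into the imaginary part of \<psi>s times
        the conjugate of \<psi>.\<close>
      have "fst (velocity c s) * snd (velocity (velocity c) s) - snd (velocity c s) * fst (velocity (velocity c) s) \<noteq> 0"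
        using curved[of s] unfolding plane_curvature_def by auto
      then have "Im (K (\<omega>s (s, 0))) * Re (K (\<omega> (s, 0))) - Re (K (\<omega>s (s, 0))) * Im (K (\<omega> (s, 0))) \<noteq> 0"
        unfolding vel vel2 by (simp add: K_def algebra_simps)
      moreover have "K (\<omega> (s, 0)) \<noteq> 0" using g'nz[of s] by (simp add: ig')
      ultimately show ?thesis by (simp add: Im_divide complex_eq_iff sum_power2_eq_zero_iff)
    qed
  qed (use d per l0 in simp_all)
  obtain e m \<rho> where e: "0 < e" "e \<le> d / 2" and m: "m > 0" and \<rho>: "\<rho> > 0"
    and low: "\<And>w. w \<in> strip e \<Longrightarrow> m \<le> norm (K (\<omega> w))"
    and jac: "\<And>w. w \<in> strip e \<Longrightarrow> Im (cnj (K (\<omega>s w)) * (K (\<omega> w) + snd w *\<^sub>R K (\<omega>v w))) \<noteq> 0"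
    and inj: "\<And>s v s' v'. \<lbrakk>0 < v; v < e; 0 < v'; v' < e; v *\<^sub>R K (\<omega> (s, v)) = v' *\<^sub>R K (\<omega> (s', v'))\<rbrakk> \<Longrightarrow> v = v' \<and> (\<exists>k. s' = s + of_int k)"
    and surj: "\<And>w. \<lbrakk>w \<noteq> 0; norm w < \<rho>\<rbrakk> \<Longrightarrow> \<exists>s v. 0 < v \<and> v < e \<and> v *\<^sub>R K (\<omega> (s, v)) = w"
    using that by (rule S.blow_up_map)
  have c\<omega>: "continuous_on (strip d) \<omega>"
    using has_derivative_continuous[OF d\<omega>] by (intro continuous_at_imp_continuous_on) (auto simp: strip_def)
  obtain M where M: "M > 0" "\<And>s v. \<bar>v\<bar> \<le> d/2 \<Longrightarrow> norm (\<omega> (s, v)) \<le> M"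
    using strip_bounded[OF d c\<omega>] per by blast
  have lt: "\<bar>v\<bar> < d" "\<bar>v\<bar> \<le> d/2" "(s, v) \<in> strip e" if "0 < v" "v < e" for s v using that e by (auto simp: strip_def)
  have Kxy: "v *\<^sub>R K (\<omega> (s, v)) = Complex (c1 (u (s, v))) (c2 (u (s, v)))" if "0 < v" "v < e" for s v
    by (simp add: K_def xy[OF lt(1)[OF that]] complex_eq_iff)
  show ?thesis
  proof (rule that[OF e(1) m M(1) \<rho>, of u us uv \<omega>])
    fix s v :: real assume v: "0 < v" "v < e"
    note l = lt[OF v]
    show "(u has_derivative (\<lambda>h. fst h *\<^sub>R us (s, v) + snd h *\<^sub>R uv (s, v))) (at (s, v))" by (rule du[OF l(1)])
    show "isCont us (s, v) \<and> isCont uv (s, v)" using cont[OF l(1)] by blast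
    show "u (s, v) \<in> U \<and> uv (s, v) = rhs (u (s, v)) (us (s, v))" by (rule sys[OF l(1)])
    show "u (s, v) = (0, 0, 0, c s) + v *\<^sub>R \<omega> (s, v)" by (rule u[OF l(1)])
    show "c3 (us (s, v)) = c4 (u (s, v)) * c1 (us (s, v)) + c5 (u (s, v)) * c2 (us (s, v))" by (rule contact[OF l(1)])
    show "norm (\<omega> (s, v)) \<le> M \<and> m \<le> norm (c1 (\<omega> (s, v)), c2 (\<omega> (s, v)))"
      using M(2)[OF l(2)] low[OF l(3)] by (simp add: K_def cmod_def norm_Pair)
    have "c1 (us (s, v)) * c2 (uv (s, v)) - c2 (us (s, v)) * c1 (uv (s, v))
        = v * Im (cnj (K (\<omega>s (s, v))) * (K (\<omega> (s, v)) + snd (s, v) *\<^sub>R K (\<omega>v (s, v))))"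
      by (simp add: us12[OF l(1)] uv12[OF l(1)] K_def algebra_simps)
    then show "c1 (us (s, v)) * c2 (uv (s, v)) - c2 (us (s, v)) * c1 (uv (s, v)) \<noteq> 0"
      using jac[OF l(3)] v by simp
  next
    fix s v s' v' assume v: "0 < v" "v < e" "0 < v'" "v' < e"
      and "c1 (u (s, v)) = c1 (u (s', v'))" "c2 (u (s, v)) = c2 (u (s', v'))"
    then have "v *\<^sub>R K (\<omega> (s, v)) = v' *\<^sub>R K (\<omega> (s', v'))" by (simp add: Kxy[OF v(1,2)] Kxy[OF v(3,4)])
    then obtain k :: int where "v = v'" "s' = s + of_int k" using inj[OF v] by blast
    then show "u (s, v) = u (s', v')" using periodic_of_int[of "\<lambda>s. u (s, v)" s k] per by simp
  next
    fix q :: "real \<times> real" assume "q \<noteq> 0" "norm q < \<rho>"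
    then have "Complex (fst q) (snd q) \<noteq> 0" "norm (Complex (fst q) (snd q)) < \<rho>"
      by (auto simp: complex_eq_iff prod_eq_iff cmod_def norm_prod_def)
    from surj[OF this] obtain s v where v: "0 < v" "v < e" "v *\<^sub>R K (\<omega> (s, v)) = Complex (fst q) (snd q)" by blast
    then have "(c1 (u (s, v)), c2 (u (s, v))) = q" using Kxy[OF v(1,2), of s] by (simp add: prod_eq_iff)
    then show "\<exists>s v. 0 < v \<and> v < e \<and> (c1 (u (s, v)), c2 (u (s, v))) = q" using v by blast
  qed
qed

end

context convex_singularity_data
begin

theorem ex_singular_solution:
  "\<exists>W z. open W \<and> (0, 0) \<in> W \<and> monge_ampere_solution_on U A B C E z (W - {(0, 0)}) \<and>
     isolated_singularity_at_origin z \<and> limit_gradient z (W - {(0, 0)}) = path_image c"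
proof -
  obtain e m M \<rho> and u us uv \<omega> :: "real \<times> real \<Rightarrow> real five"
    where e: "e > 0" and m: "m > 0" and M: "M > 0" and \<rho>: "\<rho> > 0"
    and du: "\<And>s v. \<lbrakk>0 < v; v < e\<rbrakk> \<Longrightarrow> (u has_derivative (\<lambda>h. fst h *\<^sub>R us (s, v) + snd h *\<^sub>R uv (s, v))) (at (s, v))"
    and cont: "\<And>s v. \<lbrakk>0 < v; v < e\<rbrakk> \<Longrightarrow> isCont us (s, v) \<and> isCont uv (s, v)"
    and sys: "\<And>s v. \<lbrakk>0 < v; v < e\<rbrakk> \<Longrightarrow> u (s, v) \<in> U \<and> uv (s, v) = rhs (u (s, v)) (us (s, v))"
    and u: "\<And>s v. \<lbrakk>0 < v; v < e\<rbrakk> \<Longrightarrow> u (s, v) = (0, 0, 0, c s) + v *\<^sub>R \<omega> (s, v)"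
    and contact: "\<And>s v. \<lbrakk>0 < v; v < e\<rbrakk> \<Longrightarrow> c3 (us (s, v)) = c4 (u (s, v)) * c1 (us (s, v)) + c5 (u (s, v)) * c2 (us (s, v))"
    and \<omega>: "\<And>s v. \<lbrakk>0 < v; v < e\<rbrakk> \<Longrightarrow> norm (\<omega> (s, v)) \<le> M \<and> m \<le> norm (c1 (\<omega> (s, v)), c2 (\<omega> (s, v)))"
    and jac: "\<And>s v. \<lbrakk>0 < v; v < e\<rbrakk> \<Longrightarrow> c1 (us (s, v)) * c2 (uv (s, v)) - c2 (us (s, v)) * c1 (uv (s, v)) \<noteq> 0"
    and inj: "\<And>s v s' v'. \<lbrakk>0 < v; v < e; 0 < v'; v' < e; c1 (u (s, v)) = c1 (u (s', v')); c2 (u (s, v)) = c2 (u (s', v'))\<rbrakk>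
       \<Longrightarrow> u (s, v) = u (s', v')"
    and surj: "\<And>q. \<lbrakk>q \<noteq> 0; norm q < \<rho>\<rbrakk> \<Longrightarrow> \<exists>s v. 0 < v \<and> v < e \<and> (c1 (u (s, v)), c2 (u (s, v))) = q"
    using that by (rule ex_blow_up)
  define \<Omega> where "\<Omega> = {w :: real \<times> real. 0 < snd w \<and> snd w < e}"
  have \<Omega>: "0 < snd w" "snd w < e" if "w \<in> \<Omega>" for w using that by (simp_all add: \<Omega>_def)
  have du': "(u has_derivative (\<lambda>h. fst h *\<^sub>R us w + snd h *\<^sub>R uv w)) (at w)" if "w \<in> \<Omega>" for w
    using du[OF \<Omega>[OF that], of "fst w"] by simp
  note D = has_derivative_c[OF du']
  have "continuous_on \<Omega> us" "continuous_on \<Omega> uv"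
    by (rule continuous_at_imp_continuous_on; use cont[OF \<Omega>] in force)+
  note Cc = bounded_linear.continuous_on[OF bounded_linear_c(1) this(1)] bounded_linear.continuous_on[OF bounded_linear_c(1) this(2)]
    bounded_linear.continuous_on[OF bounded_linear_c(2) this(1)] bounded_linear.continuous_on[OF bounded_linear_c(2) this(2)]
    bounded_linear.continuous_on[OF bounded_linear_c(4) this(1)] bounded_linear.continuous_on[OF bounded_linear_c(4) this(2)]
    bounded_linear.continuous_on[OF bounded_linear_c(5) this(1)] bounded_linear.continuous_on[OF bounded_linear_c(5) this(2)]
  interpret S: plane_parametrization \<Omega> "\<lambda>w. c1 (u w)" "\<lambda>w. c1 (us w)" "\<lambda>w. c1 (uv w)"
    "\<lambda>w. c2 (u w)" "\<lambda>w. c2 (us w)" "\<lambda>w. c2 (uv w)"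
  proof
    show "open \<Omega>" unfolding \<Omega>_def by (intro open_Collect_conj open_Collect_less continuous_intros)
    show "c1 (us w) * c2 (uv w) - c2 (us w) * c1 (uv w) \<noteq> 0" if "w \<in> \<Omega>" for w
      using jac[OF \<Omega>[OF that], of "fst w"] by simp
  qed (use D Cc in auto)
  define \<Phi> where "\<Phi> w = (c1 (u w), c2 (u w))" for w
  \<comment> \<open>Preimages in \<open>\<Omega>\<close> of the same point have the same value of u, so the choice is immaterial.\<close>
  define Z where "Z q = c3 (u (SOME w. w \<in> \<Omega> \<and> \<Phi> w = q))" for q
  have Z: "Z (c1 (u w), c2 (u w)) = c3 (u w)" if w: "w \<in> \<Omega>" for w
  proof -
    define w' where "w' = (SOME w'. w' \<in> \<Omega> \<and> \<Phi> w' = \<Phi> w)"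
    have w': "w' \<in> \<Omega>" "\<Phi> w' = \<Phi> w"
      using someI[of "\<lambda>w'. w' \<in> \<Omega> \<and> \<Phi> w' = \<Phi> w" w] w by (auto simp: w'_def)
    have "u (fst w', snd w') = u (fst w, snd w)"
      by (rule inj) (use \<Omega>[OF w] \<Omega>[OF w'(1)] w'(2) in \<open>auto simp: \<Phi>_def\<close>)
    then show ?thesis by (simp add: Z_def w'_def \<Phi>_def)
  qed
  define W where "W = ball (0::real, 0::real) \<rho>"
  let ?V = "W - {(0, 0)}"
  have memW: "q \<in> W \<longleftrightarrow> norm q < \<rho>" for q
    by (simp add: W_def dist_norm flip: zero_prod_def)
  have V: "?V \<subseteq> (\<lambda>w. (c1 (u w), c2 (u w))) ` \<Omega>"
  proof
    fix q assume "q \<in> ?V"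
    then have "q \<noteq> 0" "norm q < \<rho>" by (auto simp: memW zero_prod_def)
    from surj[OF this] show "q \<in> (\<lambda>w. (c1 (u w), c2 (u w))) ` \<Omega>" by (force simp: \<Omega>_def)
  qed
  have dz: "((\<lambda>w. c3 (u w)) has_derivative (\<lambda>h. fst h * (c4 (u w) * c1 (us w) + c5 (u w) * c2 (us w))
      + snd h * (c4 (u w) * c1 (uv w) + c5 (u w) * c2 (uv w)))) (at w)" if w: "w \<in> \<Omega>" for w
  proof -
    have "c3 (us w) = c4 (u w) * c1 (us w) + c5 (u w) * c2 (us w)"
      using contact[OF \<Omega>[OF w], of "fst w"] by simp
    moreover have "c3 (uv w) = c4 (u w) * c1 (uv w) + c5 (u w) * c2 (uv w)"
      using sys[OF \<Omega>[OF w], of "fst w"] by (simp add: rhs_def ma_rhs_def algebra_simps)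
    ultimately show ?thesis using D(3)[OF w] by simp
  qed
  note G = V dz D(4) D(5) Cc(5-8) Z
  have five: "(c1 w, c2 w, c3 w, c4 w, c5 w) = w" for w :: "real five" by (simp add: c_defs)
  have sol: "monge_ampere_solution_on U A B C E Z ?V"
  proof (rule S.graph_monge_ampere[OF G])
    show "(c1 (u w), c2 (u w), c3 (u w), c4 (u w), c5 (u w)) \<in> U" if "w \<in> \<Omega>" for w
      using sys[OF \<Omega>[OF that], of "fst w"] by (simp add: five)
    fix w and k :: "real five" assume w: "w \<in> \<Omega>" and k: "k = (c1 (u w), c2 (u w), c3 (u w), c4 (u w), c5 (u w))"
    have "k = u w" using k by (simp add: five)
    moreover have "uv w = rhs (u w) (us w)" using sys[OF \<Omega>[OF w], of "fst w"] by simp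
    ultimately show "c2 (uv w) = c4 (us w) + C k * c1 (us w) - B k * c2 (us w) \<and>
       - c1 (uv w) = c5 (us w) - B k * c1 (us w) + A k * c2 (us w) \<and>
       c4 (uv w) = B k * c2 (uv w) - C k * c1 (uv w) - (A k * C k - B k * B k + E k) * c2 (us w) \<and>
       c5 (uv w) = B k * c1 (uv w) - A k * c2 (uv w) + (A k * C k - B k * B k + E k) * c1 (us w)"
      by (simp add: rhs_def ma_rhs_def ma_a_def ma_b_def algebra_simps)
  qed
  define tl where "tl w = (c4 w, c5 w)" for w :: "real five"
  have tl: "tl w = snd (snd (snd w))" for w by (simp add: tl_def c_defs)
  have grad: "(partial_x Z (\<Phi> w), partial_y Z (\<Phi> w)) = tl (u w)" if "w \<in> \<Omega>" for w
    using S.graph_gradient(2,3)[OF G that] by (simp add: \<Phi>_def tl_def)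
  have tlu: "norm (tl (u (s, v)) - c s) \<le> v * M" if v: "0 < v" "v < e" for s v
  proof -
    have "tl (u (s, v)) - c s = v *\<^sub>R snd (snd (snd (\<omega> (s, v))))" by (simp add: tl u[OF v])
    moreover have "norm (snd (snd (snd (\<omega> (s, v))))) \<le> M"
      using \<omega>[OF v, of s] norm_snd_le by (metis order_trans prod.collapse)
    ultimately show ?thesis using v by (simp add: mult_left_mono)
  qed
  have \<Phi>v: "\<Phi> (s, v) = v *\<^sub>R (c1 (\<omega> (s, v)), c2 (\<omega> (s, v)))" if v: "0 < v" "v < e" for s v
    by (simp add: \<Phi>_def u[OF v] c_defs)
  \<comment> \<open>Together with \<open>up\<close> this shows that a point tends to the origin
    exactly when its parameter v tends to 0.\<close>
  have low: "v \<le> norm (\<Phi> (s, v)) / m" if v: "0 < v" "v < e" for s v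
    using \<omega>[OF v, of s] v m unfolding \<Phi>v[OF v] norm_scaleR by (simp add: pos_le_divide_eq mult_left_mono)
  have up: "norm (\<Phi> (s, v)) \<le> v * (2 * M)" if v: "0 < v" "v < e" for s v
  proof -
    have "norm (c1 (\<omega> (s, v)), c2 (\<omega> (s, v))) \<le> 2 * M"
      using norm_Pair_le[of "c1 (\<omega> (s, v))" "c2 (\<omega> (s, v))"] norm_c_le(1,2)[of "\<omega> (s, v)"] \<omega>[OF v, of s] by linarith
    then show ?thesis using v unfolding \<Phi>v[OF v] norm_scaleR by (simp add: mult_left_mono)
  qed
  have chart: "\<exists>s v. 0 < v \<and> v < e \<and> q = \<Phi> (s, v) \<and> v \<le> norm q / m" if q: "q \<in> ?V" for q
  proof -
    have "q \<in> \<Phi> ` \<Omega>" using V q unfolding \<Phi>_def by blast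
    then obtain w where "w \<in> \<Omega>" "q = \<Phi> w" by blast
    then show ?thesis using \<Omega>[of w] low[of "snd w" "fst w"] by (intro exI[of _ "fst w"] exI[of _ "snd w"]) auto
  qed
  have evV: "\<forall>\<^sub>F q in at (0, 0). q \<in> ?V"
  proof -
    have "\<forall>\<^sub>F q in at (0, 0). q \<in> W"
      by (rule eventually_at_in_open') (use \<rho> in \<open>auto simp: W_def\<close>)
    then show ?thesis using eventually_neq_at_within[of "(0, 0)" "(0::real, 0::real)"] by eventually_elim auto
  qed
  have Z0: "(Z \<longlongrightarrow> 0) (at (0, 0))"
  proof (rule tendsto_0_le[where f = "\<lambda>q. q" and K = "M / m"])
    show "((\<lambda>q. q) \<longlongrightarrow> 0) (at (0::real, 0::real))" by (metis tendsto_ident_at zero_prod_def)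
    show "\<forall>\<^sub>F q in at (0, 0). norm (Z q) \<le> norm q * (M / m)"
      using evV
    proof (rule eventually_mono)
      fix q assume "q \<in> ?V"
      then obtain s v where v: "0 < v" "v < e" "q = \<Phi> (s, v)" "v \<le> norm q / m" using chart by blast
      have "Z q = c3 (u (s, v))" using Z[of "(s, v)"] v by (simp add: \<Phi>_def \<Omega>_def)
      also have "\<dots> = v * c3 (\<omega> (s, v))" by (simp add: u[OF v(1,2)] c_defs)
      finally have "norm (Z q) = v * norm (c3 (\<omega> (s, v)))" using v by (simp add: abs_mult)
      also have "\<dots> \<le> norm q / m * M"
        using v(1,4) \<omega>[OF v(1,2), of s] norm_c_le(3)[of "\<omega> (s, v)"] by (intro mult_mono) auto
      finally show "norm (Z q) \<le> norm q * (M / m)" by simp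
    qed
  qed
  have per_img: "c s \<in> path_image c" for s
  proof -
    have "c (frac s) = c s" using periodic_frac[of c] period by simp
    then show ?thesis unfolding path_image_def by (metis atLeastAtMost_iff frac_ge_0 frac_lt_1 imageI less_imp_le)
  qed
  have approach: "\<exists>q. (\<forall>n. q n \<in> ?V) \<and> q \<longlonglongrightarrow> (0, 0) \<and> (\<lambda>n. (partial_x Z (q n), partial_y Z (q n))) \<longlonglongrightarrow> c s" for s
  proof -
    \<comment> \<open>The second bound keeps the image points, of norm at most 2 M v, inside the
      disc of radius \<rho>.\<close>
    define \<delta> where "\<delta> = min e (\<rho> / (2 * M))"
    have \<delta>: "\<delta> > 0" "\<delta> \<le> e" "\<delta> * (2 * M) \<le> \<rho>" using e \<rho> M by (auto simp: \<delta>_def min_def field_simps)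
    \<comment> \<open>The denominator n + 2 keeps already the first term strictly below
      \<delta>.\<close>
    define v where "v n = \<delta> / real (n + 2)" for n
    have v: "0 < v n" "v n < \<delta>" "v n < e" for n
    proof -
      show "0 < v n" using \<delta> by (simp add: v_def)
      have "\<delta> * 1 < \<delta> * real (n + 2)" using \<delta>(1) by (intro mult_strict_left_mono) auto
      then show "v n < \<delta>" by (simp add: v_def pos_divide_less_eq)
      then show "v n < e" using \<delta>(2) by simp
    qed
    have v0: "v \<longlonglongrightarrow> 0"
      unfolding v_def[abs_def] using LIMSEQ_ignore_initial_segment[OF lim_const_over_n[of \<delta>], of 2] by simp
    define q where "q n = \<Phi> (s, v n)" for n
    have "norm (q n) < \<rho>" for n
    proof -
      have "norm (q n) \<le> v n * (2 * M)" unfolding q_def by (rule up) (use v in auto)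
      also have "\<dots> < \<delta> * (2 * M)" using v(2)[of n] M by (intro mult_strict_right_mono) auto
      finally show ?thesis using \<delta>(3) by simp
    qed
    moreover have "q n \<noteq> (0, 0)" for n
      using low[of "v n" s] v[of n] m by (auto simp: q_def norm_prod_def)
    ultimately have "\<forall>n. q n \<in> ?V" by (simp add: memW)
    moreover have "q \<longlonglongrightarrow> (0, 0)"
      unfolding zero_prod_def[symmetric]
    proof (rule tendsto_0_le[OF v0, where K = "2 * M"])
      show "\<forall>\<^sub>F n in sequentially. norm (q n) \<le> norm (v n) * (2 * M)"
        unfolding q_def using up[of "v _" s] v by (intro always_eventually) (simp add: less_imp_le abs_of_pos)
    qed
    moreover have "(\<lambda>n. (partial_x Z (q n), partial_y Z (q n))) \<longlonglongrightarrow> c s"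
    proof -
      have e: "(partial_x Z (q n), partial_y Z (q n)) = tl (u (s, v n))" for n
        unfolding q_def by (rule grad) (use v in \<open>simp add: \<Omega>_def\<close>)
      have "(\<lambda>n. tl (u (s, v n)) - c s) \<longlonglongrightarrow> 0"
      proof (rule tendsto_0_le[OF v0, where K = M])
        show "\<forall>\<^sub>F n in sequentially. norm (tl (u (s, v n)) - c s) \<le> norm (v n) * M"
          using tlu[of "v _" s] v by (intro always_eventually) (simp add: less_imp_le abs_of_pos)
      qed
      then show ?thesis unfolding e by (rule LIM_zero_cancel)
    qed
    ultimately show ?thesis by blast
  qed
  have lim: "limit_gradient Z ?V = path_image c"
  proof
    show "path_image c \<subseteq> limit_gradient Z ?V"
      using approach unfolding limit_gradient_def path_image_def by blast
    show "limit_gradient Z ?V \<subseteq> path_image c"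
    proof
      fix \<xi> assume "\<xi> \<in> limit_gradient Z ?V"
      then obtain q where q: "\<And>n. q n \<in> ?V" "q \<longlonglongrightarrow> (0, 0)" "(\<lambda>n. (partial_x Z (q n), partial_y Z (q n))) \<longlonglongrightarrow> \<xi>"
        unfolding limit_gradient_def by blast
      obtain s v where sv: "\<And>n. 0 < v n \<and> v n < e \<and> q n = \<Phi> (s n, v n) \<and> v n \<le> norm (q n) / m"
        using chart[OF q(1)] by metis
      have e: "(partial_x Z (q n), partial_y Z (q n)) = tl (u (s n, v n))" for n
        using grad[of "(s n, v n)"] sv[of n] by (simp add: \<Omega>_def)
      have q0: "q \<longlonglongrightarrow> 0" using q(2) by (simp add: zero_prod_def)
      \<comment> \<open>The parameters \<open>s n\<close> need not converge. It suffices that the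
        points \<open>c (s n)\<close> do, because the image of the curve is closed.\<close>
      have "(\<lambda>n. tl (u (s n, v n)) - c (s n)) \<longlonglongrightarrow> 0"
      proof (rule tendsto_0_le[OF q0, where K = "M / m"])
        have "norm (tl (u (s n, v n)) - c (s n)) \<le> norm (q n) * (M / m)" for n
        proof -
          have "norm (tl (u (s n, v n)) - c (s n)) \<le> v n * M" using tlu sv by blast
          also have "\<dots> \<le> norm (q n) / m * M"
            by (rule mult_right_mono) (use sv M in \<open>blast, simp\<close>)
          finally show ?thesis by simp
        qed
        then show "\<forall>\<^sub>F n in sequentially. norm (tl (u (s n, v n)) - c (s n)) \<le> norm (q n) * (M / m)" by simp
      qed
      with q(3)[unfolded e] have "(\<lambda>n. tl (u (s n, v n)) - (tl (u (s n, v n)) - c (s n))) \<longlonglongrightarrow> \<xi> - 0"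
        by (rule tendsto_diff)
      then have "(\<lambda>n. c (s n)) \<longlonglongrightarrow> \<xi>" by simp
      moreover have "closed (path_image c)"
        using simple by (intro closed_path_image simple_path_imp_path)
      ultimately show "\<xi> \<in> path_image c"
        using per_img by (metis closed_sequentially)
    qed
  qed
  \<comment> \<open>For a C2 extension the gradient would be continuous at the origin, so all its
    limits \<open>c s\<close> would coincide; but \<open>c 0\<close> and \<open>c (1/2)\<close> are
    different points of a simple closed curve.\<close>
  have notC2: "\<not> (\<exists>N. open N \<and> (0, 0) \<in> N \<and> C2_on (Z((0, 0) := 0)) N)"
  proof
    assume "\<exists>N. open N \<and> (0, 0) \<in> N \<and> C2_on (Z((0, 0) := 0)) N"
    then obtain N where N: "open N" "(0, 0) \<in> N" "C2_on (Z((0, 0) := 0)) N" by blast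
    let ?Z = "Z((0, 0) := 0)"
    have ct: "isCont (partial_x ?Z) (0, 0)" "isCont (partial_y ?Z) (0, 0)"
      using N by (auto simp: C2_on_def C1_on_def continuous_on_eq_continuous_at)
    have agree: "partial_x ?Z q = partial_x Z q \<and> partial_y ?Z q = partial_y Z q" if q: "q \<in> ?V" for q
    proof -
      obtain w where w: "w \<in> \<Omega>" "q = (c1 (u w), c2 (u w))" using V q by blast
      note d = S.graph_gradient(1)[OF G w(1), folded w(2)]
      have d': "(?Z has_derivative (\<lambda>k. fst k * c4 (u w) + snd k * c5 (u w))) (at q)"
        by (rule has_derivative_transform_within_open[OF d, of "- {(0, 0)}"]) (use q in auto)
      obtain q1 q2 where q12: "q = (q1, q2)" by (rule prod.exhaust)
      from has_derivative_partials(3,4)[OF d[unfolded q12]] has_derivative_partials(3,4)[OF d'[unfolded q12]]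
      show ?thesis unfolding q12 by simp
    qed
    have "c s = (partial_x ?Z (0, 0), partial_y ?Z (0, 0))" for s
    proof -
      obtain q where q: "\<And>n. q n \<in> ?V" "q \<longlonglongrightarrow> (0, 0)" "(\<lambda>n. (partial_x Z (q n), partial_y Z (q n))) \<longlonglongrightarrow> c s"
        using approach[of s] by blast
      have "(\<lambda>n. (partial_x ?Z (q n), partial_y ?Z (q n))) \<longlonglongrightarrow> (partial_x ?Z (0, 0), partial_y ?Z (0, 0))"
        by (intro tendsto_Pair isCont_tendsto_compose[OF ct(1) q(2)] isCont_tendsto_compose[OF ct(2) q(2)])
      then show ?thesis using agree[OF q(1)] q(3) LIMSEQ_unique by fastforce
    qed
    then have "c 0 = c (1/2)" by metis
    then show False
      using simple_closed_period[OF simple period, of 0 "1/2"] by (auto elim!: Ints_cases simp: field_simps)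
  qed
  show ?thesis
  proof (intro exI conjI)
    show "open W" "(0, 0) \<in> W" using \<rho> by (auto simp: W_def)
    show "isolated_singularity_at_origin Z" using Z0 notC2 by (simp add: isolated_singularity_at_origin_def)
  qed (use sol lim in auto)
qed

end

theorem corollary1:
  fixes U :: "(real \<times> real \<times> real \<times> real \<times> real) set"
    and A B C E :: "real \<times> real \<times> real \<times> real \<times> real \<Rightarrow> real"
    and \<gamma> :: "(real \<times> real) set"
  assumes "open U"
    and "A real_analytic_on U" and "B real_analytic_on U"
    and "C real_analytic_on U" and "E real_analytic_on U"
    and "\<And>u. u \<in> U \<Longrightarrow> A u * C u - (B u)\<^sup>2 + E u > 0"
    and "analytic_regular_strictly_convex_jordan_curve \<gamma>"
    and "\<And>p q. (p, q) \<in> \<gamma> \<Longrightarrow> (0, 0, 0, p, q) \<in> U"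
  shows "\<exists>W z. open W \<and> (0, 0) \<in> W \<and>
           monge_ampere_solution_on U A B C E z (W - {(0, 0)}) \<and>
           isolated_singularity_at_origin z \<and>
           limit_gradient z (W - {(0, 0)}) = \<gamma>"
proof -
  obtain c where c: "analytic_regular_jordan_param c" "path_image c = \<gamma>" "\<And>t. plane_curvature c t \<noteq> 0"
    using assms(7) unfolding analytic_regular_strictly_convex_jordan_curve_def by blast
  have per: "c (s + 1) = c s" for s using c(1) by (simp add: analytic_regular_jordan_param_def)
  have "c s \<in> \<gamma>" for s
  proof -
    have "c (frac s) = c s" using periodic_frac[of c] per by simp
    moreover have "frac s \<in> {0..1}" using frac_lt_1[of s] by simp
    ultimately show ?thesis unfolding c(2)[symmetric] path_image_def by (metis imageI)
  qed
  then have "(0, 0, 0, c s) \<in> U" for s using assms(8)[of "fst (c s)" "snd (c s)"] by simp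
  then interpret convex_singularity_data U A B C E c
    by unfold_locales (use assms c per in \<open>auto simp: analytic_regular_jordan_param_def\<close>)
  show ?thesis using ex_singular_solution c(2) by simp
qed

end
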